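(* PCP parameterized by $p$ (the number of parts of the partition) is W[1]-hard, even when restricted to instances with $k$ equal to any fixed integer $k\ge 1$.
   Context: The Partition Coloring Problem (PCP): given a simple undirected graph $G=(V,E)$, a partition $\mathcal{V}=\{V_1,\dots,V_p\}$ of $V$ into $p$ pairwise disjoint parts whose union is $V$, and an integer $k$ (the number of colors), decide whether there is a selection $S$ of $\mathcal{V}$ (a set $S\subseteq V$ with $|S\cap V_i|=1$ for every $i$) such that $\chi(G[S])\le k$. *)

theory Defs
  imports "HOL-Library.Disjoint_Sets"
begin

section \<open>Partition coloring\<close>

definition simple_graph :: "'a set \<Rightarrow> 'a set set \<Rightarrow> bool" where
  "simple_graph V E \<longleftrightarrow> finite V \<and> (\<forall>e\<in>E. e \<subseteq> V \<and> card e = 2)"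

definition induced_edges :: "'a set set \<Rightarrow> 'a set \<Rightarrow> 'a set set" where
  "induced_edges E S = {e \<in> E. e \<subseteq> S}"

definition proper_coloring :: "'a set \<Rightarrow> 'a set set \<Rightarrow> nat \<Rightarrow> ('a \<Rightarrow> nat) \<Rightarrow> bool" where
  "proper_coloring V E k c \<longleftrightarrow>
     c ` V \<subseteq> {..<k} \<and> (\<forall>u\<in>V. \<forall>v\<in>V. {u, v} \<in> E \<longrightarrow> c u \<noteq> c v)"

definition chromatic_number :: "'a set \<Rightarrow> 'a set set \<Rightarrow> nat" where
  "chromatic_number V E = (LEAST k. \<exists>c. proper_coloring V E k c)"

definition selection :: "'a set \<Rightarrow> 'a set set \<Rightarrow> 'a set \<Rightarrow> bool" where
  "selection V \<V> S \<longleftrightarrow> S \<subseteq> V \<and> (\<forall>P\<in>\<V>. card (S \<inter> P) = 1)"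

definition pcp_instance :: "'a set \<Rightarrow> 'a set set \<Rightarrow> 'a set set \<Rightarrow> bool" where
  "pcp_instance V E \<V> \<longleftrightarrow> simple_graph V E \<and> partition_on V \<V>"

definition pcp_yes :: "'a set \<Rightarrow> 'a set set \<Rightarrow> 'a set set \<Rightarrow> nat \<Rightarrow> bool" where
  "pcp_yes V E \<V> k \<longleftrightarrow>
     (\<exists>S. selection V \<V> S \<and> chromatic_number S (induced_edges E S) \<le> k)"


section \<open>Encoding finite objects as binary words\<close>

text \<open>
  All codes are prefix-free, so tuples are encoded by concatenation. Numbers are written in
  unary; they are vertex names, gate names, lengths and the number of colors.
\<close>

definition enc_nat :: "nat \<Rightarrow> bool list" where
  "enc_nat n = replicate n True @ [False]"

definition enc_list :: "('a \<Rightarrow> bool list) \<Rightarrow> 'a list \<Rightarrow> bool list" where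
  "enc_list e xs = enc_nat (length xs) @ concat (map e xs)"

definition enc_pair :: "nat \<times> nat \<Rightarrow> bool list" where
  "enc_pair p = enc_nat (fst p) @ enc_nat (snd p)"

definition prefix_code :: "('a \<Rightarrow> bool list) \<Rightarrow> bool" where
  "prefix_code e \<longleftrightarrow> (\<forall>x y u v. e x @ u = e y @ v \<longrightarrow> x = y \<and> u = v)"

lemma prefix_codeD: "prefix_code e \<Longrightarrow> e x @ u = e y @ v \<Longrightarrow> x = y \<and> u = v"
  unfolding prefix_code_def by blast

lemma prefix_code_enc_nat: "prefix_code enc_nat"
proof -
  have "x = y \<and> u = v" if "enc_nat x @ u = enc_nat y @ v" for x y u v
    using that
  proof (induction x arbitrary: y)
    case 0
    then show ?case by (cases y) (auto simp: enc_nat_def)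
  next
    case (Suc x)
    then show ?case by (cases y) (auto simp: enc_nat_def)
  qed
  then show ?thesis unfolding prefix_code_def by blast
qed

lemma prefix_code_enc_pair: "prefix_code enc_pair"
  using prefix_codeD[OF prefix_code_enc_nat] 
  unfolding prefix_code_def enc_pair_def by (metis append.assoc prod_eq_iff)

lemma prefix_code_enc_list:
  assumes "prefix_code e"
  shows "prefix_code (enc_list e)"
proof -
  have *: "xs = ys \<and> u = v"
    if "length xs = length ys" "concat (map e xs) @ u = concat (map e ys) @ v" for xs ys u v
    using that by (induction xs ys rule: list_induct2) (auto dest: prefix_codeD[OF assms])
  show ?thesis
    unfolding prefix_code_def enc_list_def
    using * prefix_codeD[OF prefix_code_enc_nat] by (metis append.assoc)
qed


section \<open>A model of computation\<close>

text \<open>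
  The WHILE language of N. D. Jones (\<^emph>\<open>Computability and Complexity from a Programming
  Perspective\<close>): finitely many variables hold binary trees built from a single atom, and
  each assignment or test costs one unit. Expressions are part of the program, so charging
  for each operation separately would change the running time by a constant factor only.
  With subtrees shared, an assignment allocates a bounded number of cells, whence the model
  is polynomially equivalent to Turing machines. Words and numbers are right spines of such
  trees, so their length grows by at most a constant in each step.
\<close>

datatype data = Atom | Cell data data

datatype exp = Var nat | Quote_Atom | Cons exp exp | Hd exp | Tl exp

datatype com =
    Skip
  | Assign nat exp
  | Seq com com
  | If exp com com
  | While exp com

type_synonym store = "nat \<Rightarrow> data"

fun hd_data :: "data \<Rightarrow> data" where
  "hd_data Atom = Atom"
| "hd_data (Cell a b) = a"

fun tl_data :: "data \<Rightarrow> data" where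
  "tl_data Atom = Atom"
| "tl_data (Cell a b) = b"

fun eval_exp :: "exp \<Rightarrow> store \<Rightarrow> data" where
  "eval_exp (Var x) s = s x"
| "eval_exp Quote_Atom s = Atom"
| "eval_exp (Cons a b) s = Cell (eval_exp a s) (eval_exp b s)"
| "eval_exp (Hd a) s = hd_data (eval_exp a s)"
| "eval_exp (Tl a) s = tl_data (eval_exp a s)"

text \<open>\<open>exec c s t s'\<close>: program \<open>c\<close> started in \<open>s\<close> halts in \<open>s'\<close> after \<open>t\<close> steps.\<close>

inductive exec :: "com \<Rightarrow> store \<Rightarrow> nat \<Rightarrow> store \<Rightarrow> bool" where
  Skip: "exec Skip s 1 s"
| Assign: "exec (Assign x a) s 1 (s(x := eval_exp a s))"
| Seq: "exec c\<^sub>1 s t\<^sub>1 s' \<Longrightarrow> exec c\<^sub>2 s' t\<^sub>2 s'' \<Longrightarrow> exec (Seq c\<^sub>1 c\<^sub>2) s (t\<^sub>1 + t\<^sub>2) s''"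
| IfTrue: "eval_exp a s \<noteq> Atom \<Longrightarrow> exec c\<^sub>1 s t s' \<Longrightarrow> exec (If a c\<^sub>1 c\<^sub>2) s (t + 1) s'"
| IfFalse: "eval_exp a s = Atom \<Longrightarrow> exec c\<^sub>2 s t s' \<Longrightarrow> exec (If a c\<^sub>1 c\<^sub>2) s (t + 1) s'"
| WhileFalse: "eval_exp a s = Atom \<Longrightarrow> exec (While a c) s 1 s"
| WhileTrue: "eval_exp a s \<noteq> Atom \<Longrightarrow> exec c s t\<^sub>1 s' \<Longrightarrow> exec (While a c) s' t\<^sub>2 s'' \<Longrightarrow>
    exec (While a c) s (t\<^sub>1 + t\<^sub>2 + 1) s''"

lemma exec_deterministic: "exec c s t s' \<Longrightarrow> exec c s u s'' \<Longrightarrow> t = u \<and> s' = s''"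
proof (induction arbitrary: u s'' rule: exec.induct)
  case Skip
  then show ?case by (auto elim: exec.cases)
next
  case Assign
  then show ?case by (auto elim: exec.cases)
next
  case Seq
  from Seq.prems show ?case by cases (use Seq.IH in blast)
next
  case IfTrue
  from IfTrue.prems show ?case by cases (use IfTrue in blast)+
next
  case IfFalse
  from IfFalse.prems show ?case by cases (use IfFalse in blast)+
next
  case WhileFalse
  from WhileFalse.prems show ?case by cases (use WhileFalse in blast)+
next
  case WhileTrue
  from WhileTrue.prems show ?case by cases (use WhileTrue in blast)+
qed

primrec data_of_word :: "bool list \<Rightarrow> data" where
  "data_of_word [] = Atom"
| "data_of_word (b # w) = Cell (if b then Cell Atom Atom else Atom) (data_of_word w)"

primrec data_of_nat :: "nat \<Rightarrow> data" where
  "data_of_nat 0 = Atom"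
| "data_of_nat (Suc n) = Cell Atom (data_of_nat n)"

definition empty_store :: store where
  "empty_store = (\<lambda>_. Atom)"

definition computable :: "(nat \<Rightarrow> nat) \<Rightarrow> bool" where
  "computable f \<longleftrightarrow>
     (\<exists>c. \<forall>n. \<exists>t s. exec c (empty_store(0 := data_of_nat n)) t s \<and> s 0 = data_of_nat (f n))"


section \<open>Parameterized problems and fpt-reductions\<close>

type_synonym param_problem = "(bool list \<times> nat) set"

definition fpt_reducible :: "param_problem \<Rightarrow> param_problem \<Rightarrow> bool" where
  "fpt_reducible A B \<longleftrightarrow>
     (\<exists>c f g d. computable f \<and> computable g \<and>
        (\<forall>x \<kappa>. \<exists>x' \<kappa>' t s.
           exec c (empty_store(0 := data_of_word x, 1 := data_of_nat \<kappa>)) t s \<and>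
           s 0 = data_of_word x' \<and> s 1 = data_of_nat \<kappa>' \<and>
           t \<le> f \<kappa> * (length x + 1) ^ d \<and>
           \<kappa>' \<le> g \<kappa> \<and>
           ((x, \<kappa>) \<in> A \<longleftrightarrow> (x', \<kappa>') \<in> B)))"


section \<open>The W-hierarchy\<close>

text \<open>
  A circuit lists its gates in a topological order. Its output is the last gate.
\<close>

datatype gate = Input | Neg nat | Conj "nat list" | Disj "nat list"

type_synonym circuit = "gate list"

fun preds :: "gate \<Rightarrow> nat list" where
  "preds Input = []"
| "preds (Neg i) = [i]"
| "preds (Conj js) = js"
| "preds (Disj js) = js"

fun gate_ok :: "gate \<Rightarrow> bool" where
  "gate_ok Input \<longleftrightarrow> True"
| "gate_ok (Neg i) \<longleftrightarrow> True"
| "gate_ok (Conj js) \<longleftrightarrow> distinct js \<and> length js \<ge> 2"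
| "gate_ok (Disj js) \<longleftrightarrow> distinct js \<and> length js \<ge> 2"

definition wf_circuit :: "circuit \<Rightarrow> bool" where
  "wf_circuit C \<longleftrightarrow> C \<noteq> [] \<and> (\<forall>i<length C. gate_ok (C ! i) \<and> (\<forall>j\<in>set (preds (C ! i)). j < i))"

definition circuit_path :: "circuit \<Rightarrow> nat list \<Rightarrow> bool" where
  "circuit_path C xs \<longleftrightarrow>
     xs \<noteq> [] \<and> set xs \<subseteq> {..<length C} \<and>
     successively (\<lambda>i j. i \<in> set (preds (C ! j))) xs \<and>
     C ! hd xs = Input \<and> last xs = length C - 1"

definition depth_le :: "circuit \<Rightarrow> nat \<Rightarrow> bool" where
  "depth_le C d \<longleftrightarrow> (\<forall>xs. circuit_path C xs \<longrightarrow> length xs - 1 \<le> d)"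

definition weft_le :: "circuit \<Rightarrow> nat \<Rightarrow> bool" where
  "weft_le C t \<longleftrightarrow>
     (\<forall>xs. circuit_path C xs \<longrightarrow> length (filter (\<lambda>i. length (preds (C ! i)) > 2) xs) \<le> t)"

fun gate_value :: "gate \<Rightarrow> (nat \<Rightarrow> bool) \<Rightarrow> bool \<Rightarrow> bool" where
  "gate_value Input v b = b"
| "gate_value (Neg i) v b = (\<not> v i)"
| "gate_value (Conj js) v b = (\<forall>j\<in>set js. v j)"
| "gate_value (Disj js) v b = (\<exists>j\<in>set js. v j)"

text \<open>
  On a well-formed circuit, every choice of values at the input gates extends to exactly one
  valuation of all gates that satisfies \<open>valuation\<close>.
\<close>

definition valuation :: "circuit \<Rightarrow> (nat \<Rightarrow> bool) \<Rightarrow> bool" where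
  "valuation C v \<longleftrightarrow> (\<forall>i<length C. v i = gate_value (C ! i) v (v i))"

definition weighted_satisfiable :: "circuit \<Rightarrow> nat \<Rightarrow> bool" where
  "weighted_satisfiable C k \<longleftrightarrow>
     (\<exists>v. valuation C v \<and> v (length C - 1) \<and> card {i. i < length C \<and> C ! i = Input \<and> v i} = k)"

fun enc_gate :: "gate \<Rightarrow> bool list" where
  "enc_gate Input = enc_nat 0"
| "enc_gate (Neg i) = enc_nat 1 @ enc_nat i"
| "enc_gate (Conj js) = enc_nat 2 @ enc_list enc_nat js"
| "enc_gate (Disj js) = enc_nat 3 @ enc_list enc_nat js"

lemma prefix_code_enc_gate: "prefix_code enc_gate"
proof -
  note N = prefix_codeD[OF prefix_code_enc_nat]
  note L = prefix_codeD[OF prefix_code_enc_list[OF prefix_code_enc_nat]]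
  have "x = y \<and> u = v" if "enc_gate x @ u = enc_gate y @ v" for x y u v
    using that by (cases x; cases y) (auto dest: N L)
  then show ?thesis unfolding prefix_code_def by blast
qed

definition enc_circuit :: "circuit \<Rightarrow> bool list" where
  "enc_circuit = enc_list enc_gate"

definition WCS :: "nat \<Rightarrow> nat \<Rightarrow> param_problem" where
  "WCS t d = {(enc_circuit C, k) | C k.
     wf_circuit C \<and> weft_le C t \<and> depth_le C d \<and> weighted_satisfiable C k}"

definition W :: "nat \<Rightarrow> param_problem set" where
  "W t = {A. \<exists>d\<ge>1. fpt_reducible A (WCS t d)}"

definition W_hard :: "nat \<Rightarrow> param_problem \<Rightarrow> bool" where
  "W_hard t B \<longleftrightarrow> (\<forall>A\<in>W t. fpt_reducible A B)"


section \<open>Partition coloring as a parameterized problem\<close>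

definition enc_pcp :: "nat \<Rightarrow> (nat \<times> nat) list \<Rightarrow> nat list list \<Rightarrow> nat \<Rightarrow> bool list" where
  "enc_pcp n es ps k =
     enc_nat n @ enc_list enc_pair es @ enc_list (enc_list enc_nat) ps @ enc_nat k"

lemma enc_pcp_inject:
  "enc_pcp n es ps k = enc_pcp n' es' ps' k' \<longleftrightarrow> n = n' \<and> es = es' \<and> ps = ps' \<and> k = k'"
proof
  note N = prefix_codeD[OF prefix_code_enc_nat]
  note E = prefix_codeD[OF prefix_code_enc_list[OF prefix_code_enc_pair]]
  note P = prefix_codeD[OF prefix_code_enc_list[OF prefix_code_enc_list[OF prefix_code_enc_nat]]]
  assume eq: "enc_pcp n es ps k = enc_pcp n' es' ps' k'"
  from N[OF eq[unfolded enc_pcp_def]] have n: "n = n'"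
    and 1: "enc_list enc_pair es @ enc_list (enc_list enc_nat) ps @ enc_nat k =
      enc_list enc_pair es' @ enc_list (enc_list enc_nat) ps' @ enc_nat k'" by auto
  from E[OF 1] have es: "es = es'"
    and 2: "enc_list (enc_list enc_nat) ps @ enc_nat k =
      enc_list (enc_list enc_nat) ps' @ enc_nat k'" by auto
  from P[OF 2] have ps: "ps = ps'" and 3: "enc_nat k = enc_nat k'" by auto
  from N[of k "[]" k' "[]"] 3 n es ps show "n = n' \<and> es = es' \<and> ps = ps' \<and> k = k'" by simp
qed simp

text \<open>
  \<open>pcp_code w V E \<V> k\<close>: the word \<open>w\<close> describes the graph \<open>(V, E)\<close> on an initial segment
  of the natural numbers by a list of its edges, the partition \<open>\<V>\<close> by a list of its
  parts (each a list of vertices), and the number \<open>k\<close> of colors.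
\<close>

definition pcp_code :: "bool list \<Rightarrow> nat set \<Rightarrow> nat set set \<Rightarrow> nat set set \<Rightarrow> nat \<Rightarrow> bool" where
  "pcp_code w V E \<V> k \<longleftrightarrow>
     (\<exists>n es ps. w = enc_pcp n es ps k \<and>
        V = {..<n} \<and> E = {{u, v} | u v. (u, v) \<in> set es} \<and> \<V> = set ` set ps)"

text \<open>
  The parameter is the number of parts. \<open>PCP_with K\<close> is the restriction to instances
  whose number of colors lies in \<open>K\<close>.
\<close>

definition PCP_with :: "nat set \<Rightarrow> param_problem" where
  "PCP_with K = {(w, p). \<exists>V E \<V> k.
     pcp_code w V E \<V> k \<and> pcp_instance V E \<V> \<and> p = card \<V> \<and> k \<in> K \<and> pcp_yes V E \<V> k}"

definition PCP :: param_problem where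
  "PCP = PCP_with UNIV"

end

theory Submission
  imports Defs
begin

text \<open>
  Since fpt-reductions compose, it suffices to reduce weighted satisfiability of circuits of
  weft 1 and depth at most \<open>d\<close>, and for fixed \<open>d\<close> this can be done in time polynomial in the
  input and the parameter \<open>\<kappa>\<close>.

  A set of \<open>\<kappa>\<close> true inputs is an increasing sequence \<open>x\<^sub>1 < \<dots> < x\<^sub>\<kappa>\<close>, completed by sentinels
  \<open>x\<^sub>0\<close> and \<open>x\<close> with index \<open>\<kappa> + 1\<close>; consecutive entries also tell which inputs are false. If the
  output is true, this has a certificate of bounded size: a set of gates with their
  values in which each value follows from the recorded values of some arguments, except for
  the large gates all of whose arguments matter. Below such a gate there are no further
  large gates, so each of its arguments depends on at most \<open>2 ^ d\<close> inputs, and a wrong value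
  of an argument is visible on some \<open>2 ^ (d + 1)\<close> entries of \<open>x\<close>.

  A vertex is therefore a certificate together with the values of \<open>x\<close> at \<open>2 ^ (d + 1)\<close> indices that
  do not refute it; there is one part for each tuple of indices, and two vertices are adjacent
  if they disagree. Independent selections correspond to satisfying assignments of weight \<open>\<kappa>\<close>.
  For \<open>k\<close> colors, add \<open>k - 1\<close> singleton parts whose vertices are adjacent to all others.

  Polynomial time is established by closure properties: a class of functions between coded
  types, realized by WHILE programs, which contains the constructors and is closed under
  composition, case distinction and folds with polynomially bounded intermediate results.
\<close>


section \<open>Functions realized by programs\<close>


text \<open>Edges are binary, whereas the value of a gate depends on many inputs at once. All tests
  of higher arity are therefore made inside single vertices, and only two relations are left between
  vertices: equality of certificates, and belonging to one strictly increasing sequence. Both hold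
  globally as soon as they hold for all pairs.

  No vertex can confirm a large universal gate, whose arguments are unbounded in number. So a vertex
  is not asked to verify values; it is discarded if it refutes one. When the recorded value is
  wrong, a single argument is to blame, and some part then has no vertex that fits the sequence.

  The constant 2 ^ (d + 1) arises twice. A certificate follows at most two arguments per gate, hence
  forms a binary tree of depth d with fewer than 2 ^ (d + 1) nodes. An argument of a large gate
  depends on at most 2 ^ d inputs, each located by at most two entries.

  W[1] admits every constant depth, so there is one reduction for each d. The parameter rises to
  (\<kappa> + 2) ^ 2 ^ (d + 1) + (k - 1), which is harmless because any computable bound is
  allowed.\<close>

class coded =
  fixes repr :: "'a \<Rightarrow> data"

instantiation unit :: coded
begin
definition repr_unit :: "unit \<Rightarrow> data" where "repr_unit u = Atom"
instance ..
end

instantiation bool :: coded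
begin
definition repr_bool :: "bool \<Rightarrow> data" where "repr_bool b = (if b then Cell Atom Atom else Atom)"
instance ..
end

instantiation nat :: coded
begin
definition repr_nat :: "nat \<Rightarrow> data" where "repr_nat = data_of_nat"
instance ..
end

instantiation prod :: (coded, coded) coded
begin
definition repr_prod :: "'a \<times> 'b \<Rightarrow> data" where "repr_prod p = Cell (repr (fst p)) (repr (snd p))"
instance ..
end

instantiation list :: (coded) coded
begin
primrec repr_list :: "'a list \<Rightarrow> data" where
  "repr_list [] = Atom"
| "repr_list (x # xs) = Cell (repr x) (repr_list xs)"
instance ..
end

lemma repr_word: "repr (w :: bool list) = data_of_word w"
  by (induction w) (auto simp: repr_bool_def)

text \<open>Since numbers and unit lists are the same trees, the identity program converts between
  them; loops counted by a number thereby become folds over a list.\<close>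

lemma repr_replicate_unit: "repr (replicate n ()) = repr n"
  by (induction n) (auto simp: repr_unit_def repr_nat_def)

primrec cells :: "data \<Rightarrow> nat" where
  "cells Atom = 0"
| "cells (Cell a b) = Suc (cells a + cells b)"

text \<open>Cells are counted without sharing. Numbers are unary, so the size of a number is its
  value, and polynomial time means polynomial in that value.\<close>

definition sz :: "'a::coded \<Rightarrow> nat" where
  "sz x = cells (repr x)"

lemma sz_simps [simp]:
  "sz () = 0" "sz True = 1" "sz False = 0" "sz (n::nat) = n" "sz (x, y) = Suc (sz x + sz y)"
  "sz ([] :: 'a::coded list) = 0" "sz (x # xs) = Suc (sz x + sz xs)"
proof -
  have "cells (data_of_nat n) = n" for n by (induction n) auto
  then show "sz (n::nat) = n" by (simp add: sz_def repr_nat_def)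
qed (simp_all add: sz_def repr_unit_def repr_bool_def repr_prod_def)

lemma sz_bool_le: "sz (b :: bool) \<le> 1"
  by (cases b) auto

lemma sz_fst_le: "sz (fst p) \<le> sz p" and sz_snd_le: "sz (snd p) \<le> sz p"
  by (cases p; simp)+

lemma sz_append [simp]: "sz (xs @ ys) = sz xs + sz ys"
  by (induction xs) auto

lemma sz_rev [simp]: "sz (rev xs) = sz xs"
  by (induction xs) auto

lemma length_le_sz: "length xs \<le> sz xs"
  by (induction xs) auto

lemma sz_mem_le: "x \<in> set xs \<Longrightarrow> sz x < sz xs"
  by (induction xs) auto

lemma sz_list_le: "(\<And>x. x \<in> set xs \<Longrightarrow> sz x \<le> B) \<Longrightarrow> sz xs \<le> length xs * Suc B"
proof (induction xs)
  case (Cons x xs)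
  have "sz x \<le> B" "sz xs \<le> length xs * Suc B" using Cons by auto
  then show ?case by simp
qed simp


section \<open>Programs running within a time bound\<close>

definition runs :: "com \<Rightarrow> store \<Rightarrow> nat \<Rightarrow> store \<Rightarrow> bool" where
  "runs c s T s' \<longleftrightarrow> (\<exists>t\<le>T. exec c s t s')"

lemma runs_Assign: "s' = s(x := eval_exp a s) \<Longrightarrow> 1 \<le> T \<Longrightarrow> runs (Assign x a) s T s'"
  unfolding runs_def using exec.Assign by blast

lemma runs_Seq:
  assumes "runs c\<^sub>1 s T\<^sub>1 s'" "runs c\<^sub>2 s' T\<^sub>2 s''" "T\<^sub>1 + T\<^sub>2 \<le> T"
  shows "runs (Seq c\<^sub>1 c\<^sub>2) s T s''"
proof -
  obtain t u where "t \<le> T\<^sub>1" "exec c\<^sub>1 s t s'" "u \<le> T\<^sub>2" "exec c\<^sub>2 s' u s''"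
    using assms unfolding runs_def by blast
  then have "exec (Seq c\<^sub>1 c\<^sub>2) s (t + u) s''" "t + u \<le> T" using assms(3) by (auto intro: exec.Seq)
  then show ?thesis unfolding runs_def by blast
qed

lemma runs_If:
  assumes "eval_exp a s \<noteq> Atom \<Longrightarrow> runs c\<^sub>1 s T s'" "eval_exp a s = Atom \<Longrightarrow> runs c\<^sub>2 s T s'" "T + 1 \<le> T'"
  shows "runs (If a c\<^sub>1 c\<^sub>2) s T' s'"
proof (cases "eval_exp a s = Atom")
  case True
  then obtain t where "t \<le> T" "exec c\<^sub>2 s t s'" using assms unfolding runs_def by blast
  then have "exec (If a c\<^sub>1 c\<^sub>2) s (t + 1) s'" "t + 1 \<le> T'"
    using exec.IfFalse[OF True] assms(3) by auto
  then show ?thesis unfolding runs_def by blast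
next
  case False
  then obtain t where "t \<le> T" "exec c\<^sub>1 s t s'" using assms unfolding runs_def by blast
  then have "exec (If a c\<^sub>1 c\<^sub>2) s (t + 1) s'" "t + 1 \<le> T'"
    using exec.IfTrue[OF False] assms(3) by auto
  then show ?thesis unfolding runs_def by blast
qed

lemma runs_While_False: "eval_exp a s = Atom \<Longrightarrow> 1 \<le> T \<Longrightarrow> runs (While a c) s T s"
  unfolding runs_def using exec.WhileFalse by blast

lemma runs_While_True:
  assumes "eval_exp a s \<noteq> Atom" "runs c s T\<^sub>1 s'" "runs (While a c) s' T\<^sub>2 s''" "T\<^sub>1 + T\<^sub>2 + 1 \<le> T"
  shows "runs (While a c) s T s''"
proof -
  obtain t u where "t \<le> T\<^sub>1" "exec c s t s'" "u \<le> T\<^sub>2" "exec (While a c) s' u s''"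
    using assms unfolding runs_def by blast
  then have "exec (While a c) s (t + u + 1) s''" "t + u + 1 \<le> T"
    using exec.WhileTrue[OF assms(1)] assms(4) by (blast, simp)
  then show ?thesis unfolding runs_def by blast
qed

lemma runs_mono: "runs c s T s' \<Longrightarrow> T \<le> T' \<Longrightarrow> runs c s T' s'"
  unfolding runs_def using order_trans by blast

text \<open>
  A program that realizes a function transforms register 0 and may use the registers below
  \<open>m\<close> as scratch space, provided it finds and leaves them cleared.
\<close>

definition realizes :: "com \<Rightarrow> nat \<Rightarrow> ('a::coded \<Rightarrow> 'b::coded) \<Rightarrow> ('a \<Rightarrow> nat) \<Rightarrow> bool" where
  "realizes c m f T \<longleftrightarrow>
     (\<forall>s x. s 0 = repr x \<longrightarrow> (\<forall>i. 0 < i \<and> i < m \<longrightarrow> s i = Atom) \<longrightarrow>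
        runs c s (T x) (s(0 := repr (f x))))"

lemma realizesD:
  assumes "realizes c m f T" "s 0 = repr x" "\<And>i. 0 < i \<Longrightarrow> i < m \<Longrightarrow> s i = Atom"
  shows "runs c s (T x) (s(0 := repr (f x)))"
  using assms unfolding realizes_def by blast

lemma realizes_exp:
  assumes "\<And>s x. s 0 = repr x \<Longrightarrow> eval_exp a s = repr (f x)"
  shows "realizes (Assign 0 a) 0 f (\<lambda>_. 1)"
  unfolding realizes_def using assms by (auto intro!: runs_Assign)

lemma realizes_comp:
  fixes f :: "'a::coded \<Rightarrow> 'b::coded" and g :: "'b \<Rightarrow> 'c::coded"
  assumes "realizes c\<^sub>1 m\<^sub>1 f T\<^sub>1" "realizes c\<^sub>2 m\<^sub>2 g T\<^sub>2"
  shows "realizes (Seq c\<^sub>1 c\<^sub>2) (max m\<^sub>1 m\<^sub>2) (\<lambda>x. g (f x)) (\<lambda>x. T\<^sub>1 x + T\<^sub>2 (f x))"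
  unfolding realizes_def
proof (intro allI impI)
  fix s :: store and x :: 'a
  assume s: "s 0 = repr x" "\<forall>i. 0 < i \<and> i < max m\<^sub>1 m\<^sub>2 \<longrightarrow> s i = Atom"
  have "runs c\<^sub>1 s (T\<^sub>1 x) (s(0 := repr (f x)))"
    using s by (intro realizesD[OF assms(1)]) auto
  moreover have "runs c\<^sub>2 (s(0 := repr (f x))) (T\<^sub>2 (f x)) ((s(0 := repr (f x)))(0 := repr (g (f x))))"
    using s by (intro realizesD[OF assms(2)]) auto
  ultimately show "runs (Seq c\<^sub>1 c\<^sub>2) s (T\<^sub>1 x + T\<^sub>2 (f x)) (s(0 := repr (g (f x))))"
    by (auto intro: runs_Seq)
qed

lemma realizes_pair:
  fixes f :: "'a::coded \<Rightarrow> 'b::coded" and g :: "'a \<Rightarrow> 'c::coded"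
  assumes "realizes c\<^sub>1 m\<^sub>1 f T\<^sub>1" "realizes c\<^sub>2 m\<^sub>2 g T\<^sub>2"
  shows "\<exists>c m. realizes c m (\<lambda>x. (f x, g x)) (\<lambda>x. T\<^sub>1 x + T\<^sub>2 x + 6)"
proof -
  \<comment> \<open>Register \<open>k\<close> keeps the argument and \<open>Suc k\<close> the first
    result. Both lie above the scratch space of the two programs and are cleared at the end; 6 is
    the number of assignments around them.\<close>
  define k where "k = Suc (max m\<^sub>1 m\<^sub>2)"
  define c where "c = Seq (Assign k (Var 0)) (Seq c\<^sub>1 (Seq (Assign (Suc k) (Var 0))
    (Seq (Assign 0 (Var k)) (Seq c\<^sub>2 (Seq (Assign 0 (Cons (Var (Suc k)) (Var 0)))
      (Seq (Assign k Quote_Atom) (Assign (Suc k) Quote_Atom)))))))"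
  have "realizes c (k + 2) (\<lambda>x. (f x, g x)) (\<lambda>x. T\<^sub>1 x + T\<^sub>2 x + 6)"
    unfolding realizes_def
  proof (intro allI impI)
    fix s :: store and x :: 'a
    assume s: "s 0 = repr x" "\<forall>i. 0 < i \<and> i < k + 2 \<longrightarrow> s i = Atom"
    define s1 where "s1 = s(k := repr x)"
    define s2 where "s2 = s1(0 := repr (f x))"
    define s3 where "s3 = s2(Suc k := repr (f x))"
    define s4 where "s4 = s3(0 := repr x)"
    define s5 where "s5 = s4(0 := repr (g x))"
    define s6 where "s6 = s5(0 := repr (f x, g x))"
    define s7 where "s7 = s6(k := Atom)"
    note S = s1_def s2_def s3_def s4_def s5_def s6_def s7_def
    have k: "k > 0" "m\<^sub>1 < k" "m\<^sub>2 < k" by (auto simp: k_def)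
    have 1: "runs c\<^sub>1 s1 (T\<^sub>1 x) s2"
      unfolding s2_def using s k by (intro realizesD[OF assms(1)]) (auto simp: S)
    have 2: "runs c\<^sub>2 s4 (T\<^sub>2 x) s5"
      unfolding s5_def using s k by (intro realizesD[OF assms(2)]) (auto simp: S)
    have 3: "s(0 := repr (f x, g x)) = s7(Suc k := Atom)"
      using s k by (auto simp: S fun_eq_iff)
    show "runs c s (T\<^sub>1 x + T\<^sub>2 x + 6) (s(0 := repr (f x, g x)))"
      unfolding c_def 3
      apply (rule runs_Seq[where T\<^sub>1 = 1 and s' = s1])
        apply (rule runs_Assign; simp add: s s1_def)
       apply (rule runs_Seq[OF 1])
        apply (rule runs_Seq[where T\<^sub>1 = 1 and s' = s3])
          apply (rule runs_Assign; simp add: s2_def s3_def)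
         apply (rule runs_Seq[where T\<^sub>1 = 1 and s' = s4])
           apply (rule runs_Assign; use k in \<open>simp add: S\<close>)
          apply (rule runs_Seq[OF 2])
           apply (rule runs_Seq[where T\<^sub>1 = 1 and s' = s6])
             apply (rule runs_Assign; use k in \<open>simp add: S repr_prod_def\<close>)
            apply (rule runs_Seq[where T\<^sub>1 = 1 and T\<^sub>2 = 1 and s' = s7 and T = 2])
              apply (rule runs_Assign; simp add: s7_def)
             apply (rule runs_Assign; simp)
            apply (rule order_refl | simp)+
      done
  qed
  then show ?thesis by blast
qed

lemma realizes_if:
  fixes P :: "'a::coded \<Rightarrow> bool" and f g :: "'a \<Rightarrow> 'b::coded"
  assumes "realizes c\<^sub>0 m\<^sub>0 P T\<^sub>0" "realizes c\<^sub>1 m\<^sub>1 f T\<^sub>1" "realizes c\<^sub>2 m\<^sub>2 g T\<^sub>2"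
  shows "\<exists>c m. realizes c m (\<lambda>x. if P x then f x else g x) (\<lambda>x. T\<^sub>0 x + (T\<^sub>1 x + T\<^sub>2 x) + 6)"
proof -
  define k where "k = Suc (max m\<^sub>0 (max m\<^sub>1 m\<^sub>2))"
  \<comment> \<open>The outcome of the test is kept in \<open>Suc k\<close>. Only the first branch
    has to clear that register, because \<open>False\<close> is represented by \<open>Atom\<close>.
    The sum of the two branch times bounds either of them, so time bounds need no case
    distinction.\<close>
  define c where "c = Seq (Assign k (Var 0)) (Seq c\<^sub>0 (Seq (Assign (Suc k) (Var 0))
    (Seq (Assign 0 (Var k)) (Seq (Assign k Quote_Atom)
      (If (Var (Suc k)) (Seq (Assign (Suc k) Quote_Atom) c\<^sub>1) c\<^sub>2)))))"
  have "realizes c (k + 2) (\<lambda>x. if P x then f x else g x) (\<lambda>x. T\<^sub>0 x + (T\<^sub>1 x + T\<^sub>2 x) + 6)"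
    unfolding realizes_def
  proof (intro allI impI)
    fix s :: store and x :: 'a
    assume s: "s 0 = repr x" "\<forall>i. 0 < i \<and> i < k + 2 \<longrightarrow> s i = Atom"
    define s1 where "s1 = s(k := repr x)"
    define s2 where "s2 = s1(0 := repr (P x))"
    define s3 where "s3 = s2(Suc k := repr (P x))"
    define s4 where "s4 = s3(0 := repr x)"
    define s5 where "s5 = s4(k := Atom)"
    note S = s1_def s2_def s3_def s4_def s5_def
    have k: "k > 0" "m\<^sub>0 < k" "m\<^sub>1 < k" "m\<^sub>2 < k" by (auto simp: k_def)
    have 1: "runs c\<^sub>0 s1 (T\<^sub>0 x) s2"
      unfolding s2_def using s k by (intro realizesD[OF assms(1)]) (auto simp: S)
    have s5: "s5 = s(Suc k := repr (P x))" using s k by (auto simp: S)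
    have 2: "runs c\<^sub>1 s (T\<^sub>1 x) (s(0 := repr (f x)))"
      using s k by (intro realizesD[OF assms(2)]) auto
    have 3: "runs c\<^sub>2 s (T\<^sub>2 x) (s(0 := repr (g x)))"
      using s k by (intro realizesD[OF assms(3)]) auto
    have sk: "s(Suc k := Atom) = s" using s by auto
    have 4: "runs (If (Var (Suc k)) (Seq (Assign (Suc k) Quote_Atom) c\<^sub>1) c\<^sub>2) s5 (T\<^sub>1 x + T\<^sub>2 x + 2)
        (s(0 := repr (if P x then f x else g x)))"
    proof (rule runs_If[where T = "T\<^sub>1 x + T\<^sub>2 x + 1"])
      assume "eval_exp (Var (Suc k)) s5 \<noteq> Atom"
      then have "P x" by (auto simp: s5 repr_bool_def split: if_splits)
      then show "runs (Seq (Assign (Suc k) Quote_Atom) c\<^sub>1) s5 (T\<^sub>1 x + T\<^sub>2 x + 1)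
          (s(0 := repr (if P x then f x else g x)))"
        using 2 sk by (auto intro!: runs_Seq[where T\<^sub>1 = 1] runs_Assign simp: s5)
    next
      assume "eval_exp (Var (Suc k)) s5 = Atom"
      then have "\<not> P x" by (auto simp: s5 repr_bool_def split: if_splits)
      then show "runs c\<^sub>2 s5 (T\<^sub>1 x + T\<^sub>2 x + 1) (s(0 := repr (if P x then f x else g x)))"
        using 3 sk by (auto intro: runs_mono simp: s5 repr_bool_def)
    qed simp
    show "runs c s (T\<^sub>0 x + (T\<^sub>1 x + T\<^sub>2 x) + 6) (s(0 := repr (if P x then f x else g x)))"
      unfolding c_def
      apply (rule runs_Seq[where T\<^sub>1 = 1 and s' = s1])
        apply (rule runs_Assign; simp add: s s1_def)
       apply (rule runs_Seq[OF 1])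
        apply (rule runs_Seq[where T\<^sub>1 = 1 and s' = s3])
          apply (rule runs_Assign; simp add: s2_def s3_def)
         apply (rule runs_Seq[where T\<^sub>1 = 1 and s' = s4])
           apply (rule runs_Assign; use k in \<open>simp add: S\<close>)
          apply (rule runs_Seq[where T\<^sub>1 = 1 and s' = s5])
            apply (rule runs_Assign; use k in \<open>simp add: S\<close>)
           apply (rule 4)
          apply (rule order_refl | simp)+
      done
  qed
  then show ?thesis by blast
qed

primrec fold_time :: "('a \<times> 'b \<Rightarrow> nat) \<Rightarrow> ('a \<Rightarrow> 'b \<Rightarrow> 'b) \<Rightarrow> 'a list \<Rightarrow> 'b \<Rightarrow> nat" where
  "fold_time T g [] b = 1"
| "fold_time T g (y # ys) b = T (y, b) + 3 + fold_time T g ys (g y b)"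

lemma realizes_fold:
  fixes g :: "'a::coded \<Rightarrow> 'b::coded \<Rightarrow> 'b"
  assumes "realizes c m (\<lambda>p. g (fst p) (snd p)) T"
  shows "\<exists>c m. realizes c m (\<lambda>p. fold g (snd p) (fst p)) (\<lambda>p. fold_time T g (snd p) (fst p) + 2)"
proof -
  define k where "k = Suc m"
  \<comment> \<open>Register \<open>k\<close> holds the rest of the list. The empty list is
    \<open>Atom\<close>, so the loop ends with \<open>k\<close> already cleared. Each round costs
    two assignments and a test besides the step itself, which is the 3 in
    \<open>fold_time\<close>.\<close>
  define w where "w = While (Var k) (Seq (Assign 0 (Cons (Hd (Var k)) (Var 0)))
    (Seq (Assign k (Tl (Var k))) c))"
  define c' where "c' = Seq (Assign k (Tl (Var 0))) (Seq (Assign 0 (Hd (Var 0))) w)"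
  have loop: "runs w s (fold_time T g ys b) (s(0 := repr (fold g ys b), k := Atom))"
    if "s 0 = repr b" "s k = repr ys" "\<And>i. 0 < i \<Longrightarrow> i < k \<Longrightarrow> s i = Atom" for s ys b
    using that
  proof (induction ys arbitrary: s b)
    case Nil
    then have "s(0 := repr (fold g [] b), k := Atom) = s" by auto
    then show ?case using Nil unfolding w_def by (simp only:) (auto intro: runs_While_False)
  next
    case (Cons y ys)
    define s1 where "s1 = s(0 := repr (y, b))"
    define s2 where "s2 = s1(k := repr ys)"
    define s3 where "s3 = s2(0 := repr (g y b))"
    have k: "k > 0" "m < k" by (auto simp: k_def)
    note S = s1_def s2_def s3_def
    have "runs c s2 (T (y, b)) (s2(0 := repr (g (fst (y, b)) (snd (y, b)))))"
      using Cons.prems k by (intro realizesD[OF assms]) (auto simp: S)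
    then have 1: "runs c s2 (T (y, b)) s3" by (simp add: s3_def)
    have 2: "runs w s3 (fold_time T g ys (g y b)) (s3(0 := repr (fold g ys (g y b)), k := Atom))"
      using Cons.prems k by (intro Cons.IH) (auto simp: S)
    have 3: "s3(0 := repr (fold g ys (g y b)), k := Atom) = s(0 := repr (fold g (y # ys) b), k := Atom)"
      by (auto simp: S)
    have 4: "runs (Seq (Assign 0 (exp.Cons (Hd (Var k)) (Var 0))) (Seq (Assign k (Tl (Var k))) c)) s
        (T (y, b) + 2) s3"
      apply (rule runs_Seq[where T\<^sub>1 = 1 and s' = s1])
        apply (rule runs_Assign; use Cons.prems in \<open>simp add: S repr_prod_def\<close>)
       apply (rule runs_Seq[where T\<^sub>1 = 1 and s' = s2])
         apply (rule runs_Assign; use Cons.prems k in \<open>simp add: S\<close>)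
        apply (rule 1)
       apply (rule order_refl | simp)+
      done
    show ?case unfolding w_def
      by (rule runs_While_True[OF _ 4 2[unfolded 3 w_def]]) (use Cons.prems in auto)
  qed
  have "realizes c' (k + 1) (\<lambda>p. fold g (snd p) (fst p)) (\<lambda>p. fold_time T g (snd p) (fst p) + 2)"
    unfolding realizes_def
  proof (intro allI impI)
    fix s :: store and x :: "'b \<times> 'a list"
    assume s: "s 0 = repr x" "\<forall>i. 0 < i \<and> i < k + 1 \<longrightarrow> s i = Atom"
    have k: "k > 0" by (auto simp: k_def)
    obtain b ys where x: "x = (b, ys)" by (cases x)
    define s1 where "s1 = s(k := repr ys)"
    define s2 where "s2 = s1(0 := repr b)"
    note S = s1_def s2_def
    have 1: "runs w s2 (fold_time T g ys b) (s2(0 := repr (fold g ys b), k := Atom))"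
      using s k by (intro loop) (auto simp: S)
    have 2: "s2(0 := repr (fold g ys b), k := Atom) = s(0 := repr (fold g (snd x) (fst x)))"
      using s k by (auto simp: S x)
    show "runs c' s (fold_time T g (snd x) (fst x) + 2) (s(0 := repr (fold g (snd x) (fst x))))"
      unfolding c'_def 2[symmetric]
      apply (rule runs_Seq[where T\<^sub>1 = 1 and s' = s1])
        apply (rule runs_Assign; use s in \<open>simp add: x S repr_prod_def\<close>)
       apply (rule runs_Seq[where T\<^sub>1 = 1 and s' = s2])
         apply (rule runs_Assign; use s k in \<open>simp add: x S repr_prod_def\<close>)
        apply (rule 1)
       apply (rule order_refl | simp add: x)+
      done
  qed
  then show ?thesis by blast
qed


section \<open>Polynomial time\<close>

text \<open>The base is at least 2, so a single exponent absorbs constants, sums and products.\<close>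

definition pbound :: "('a::coded \<Rightarrow> nat) \<Rightarrow> bool" where
  "pbound T \<longleftrightarrow> (\<exists>e. \<forall>x. T x \<le> (sz x + 2) ^ e)"

named_theorems pbound_intros

lemma pbound_mono: "pbound T' \<Longrightarrow> (\<And>x. T x \<le> T' x) \<Longrightarrow> pbound T"
  unfolding pbound_def using order_trans by blast

lemma pbound_const [pbound_intros]: "pbound (\<lambda>_. c)"
proof -
  have "c \<le> (n + 2) ^ c" for n :: nat
    using power_mono[of 2 "n + 2" c] less_exp[of c] by linarith
  then show ?thesis unfolding pbound_def by blast
qed

lemma pbound_sz [pbound_intros]: "pbound (\<lambda>x. sz x)"
  unfolding pbound_def by (intro exI[of _ 1]) simp

lemma pbound_mult [pbound_intros]:
  assumes "pbound S" "pbound T"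
  shows "pbound (\<lambda>x. S x * T x)"
proof -
  obtain a b where "\<And>x. S x \<le> (sz x + 2) ^ a" "\<And>x. T x \<le> (sz x + 2) ^ b"
    using assms unfolding pbound_def by blast
  then have "S x * T x \<le> (sz x + 2) ^ (a + b)" for x
    unfolding power_add by (intro mult_mono) auto
  then show ?thesis unfolding pbound_def by blast
qed

text \<open>The product \<open>(S x + 1) * (T x + 1)\<close> dominates the sum, and adding 1 to a
  bound costs one more factor of a base that is at least 2.\<close>

lemma pbound_add [pbound_intros]:
  assumes "pbound S" "pbound T"
  shows "pbound (\<lambda>x. S x + T x)"
proof -
  have "pbound (\<lambda>x. (S x + 1) * (T x + 1))"
  proof -
    have "pbound (\<lambda>x. F x + 1)" if "pbound F" for F :: "'a \<Rightarrow> nat"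
    proof -
      obtain a where a: "\<And>x. F x \<le> (sz x + 2) ^ a" using \<open>pbound F\<close> unfolding pbound_def by blast
      have "F x + 1 \<le> (sz x + 2) ^ (a + 1)" for x
      proof -
        have "F x + 1 \<le> 2 * (sz x + 2) ^ a" using a[of x] one_le_power[of "sz x + 2" a] by linarith
        also have "\<dots> \<le> (sz x + 2) * (sz x + 2) ^ a" by (intro mult_right_mono) auto
        finally show ?thesis by simp
      qed
      then show ?thesis unfolding pbound_def by blast
    qed
    then show ?thesis using assms by (intro pbound_mult)
  qed
  then show ?thesis by (rule pbound_mono) auto
qed

lemma pbound_Suc [pbound_intros]: "pbound T \<Longrightarrow> pbound (\<lambda>x. Suc (T x))"
  using pbound_add[OF pbound_const[of 1]] by simp

lemma pbound_power [pbound_intros]: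
  assumes "pbound T"
  shows "pbound (\<lambda>x. T x ^ e)"
  by (induction e) (auto intro: pbound_intros assms)

lemma pbound_comp:
  assumes "pbound T" "pbound (\<lambda>x. sz (f x))"
  shows "pbound (\<lambda>x. T (f x))"
proof -
  obtain e where e: "\<And>y. T y \<le> (sz y + 2) ^ e" using assms(1) unfolding pbound_def by blast
  have "pbound (\<lambda>x. (sz (f x) + 2) ^ e)" by (intro pbound_intros assms)
  then show ?thesis by (rule pbound_mono) (rule e)
qed

text \<open>Without any resource bound, this describes the functions \<open>f\<close> and
  \<open>g\<close> of \<open>fpt_reducible\<close>, which are merely computable.\<close>

definition realizable :: "('a::coded \<Rightarrow> 'b::coded) \<Rightarrow> bool" where
  "realizable f \<longleftrightarrow> (\<exists>c m T. realizes c m f T)"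

text \<open>The size of the result is bounded separately: an assignment can double a tree in one
  step, so the running time alone does not control the size, and composition would fail.\<close>

definition ptime :: "('a::coded \<Rightarrow> 'b::coded) \<Rightarrow> bool" where
  "ptime f \<longleftrightarrow> (\<exists>c m T. realizes c m f T \<and> pbound T) \<and> pbound (\<lambda>x. sz (f x))"

named_theorems ptime_intros

lemma ptime_realizable: "ptime f \<Longrightarrow> realizable f"
  unfolding ptime_def realizable_def by blast

lemma ptime_pbound: "ptime f \<Longrightarrow> pbound (\<lambda>x. sz (f x))"
  unfolding ptime_def by blast

lemma realizable_comp: "realizable g \<Longrightarrow> realizable f \<Longrightarrow> realizable (\<lambda>x. g (f x))"
  unfolding realizable_def using realizes_comp[of _ _ f _ _ _ g] by blast

lemma realizable_Pair: "realizable f \<Longrightarrow> realizable g \<Longrightarrow> realizable (\<lambda>x. (f x, g x))"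
  unfolding realizable_def using realizes_pair[of _ _ f _ _ _ g] by blast

lemma ptime_exp:
  assumes "\<And>s x. s 0 = repr x \<Longrightarrow> eval_exp a s = repr (f x)" "pbound (\<lambda>x. sz (f x))"
  shows "ptime f"
  unfolding ptime_def using realizes_exp[of a f, OF assms(1)] assms(2) pbound_const by blast

lemma ptime_comp:
  assumes "ptime g" "ptime f"
  shows "ptime (\<lambda>x. g (f x))"
proof -
  obtain c m T c' m' T' where *: "realizes c m f T" "pbound T" "realizes c' m' g T'" "pbound T'"
    using assms unfolding ptime_def by blast
  have "pbound (\<lambda>x. T x + T' (f x))"
    by (intro pbound_intros * pbound_comp[OF *(4)] ptime_pbound assms)
  then show ?thesis
    using realizes_comp[OF *(1,3)] pbound_comp[OF ptime_pbound[OF assms(1)] ptime_pbound[OF assms(2)]]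
    unfolding ptime_def by blast
qed

lemma ptime_id [ptime_intros]: "ptime (\<lambda>x. x)"
  by (rule ptime_exp[of "Var 0"]) (auto intro: pbound_intros)

lemma ptime_const [ptime_intros]: "ptime (\<lambda>_. c)"
proof -
  have "\<exists>a. \<forall>s. eval_exp a s = d" for d
  proof (induction d)
    case Atom
    show ?case by (intro exI[of _ Quote_Atom]) simp
  next
    case (Cell d d')
    then obtain a a' where "\<forall>s. eval_exp a s = d" "\<forall>s. eval_exp a' s = d'" by blast
    then show ?case by (intro exI[of _ "exp.Cons a a'"]) simp
  qed
  then obtain a where "\<forall>s. eval_exp a s = repr c" by blast
  then show ?thesis by (intro ptime_exp[of a]) (auto intro: pbound_intros)
qed

lemma ptime_Pair [ptime_intros]:
  assumes "ptime f" "ptime g"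
  shows "ptime (\<lambda>x. (f x, g x))"
proof -
  obtain c m T c' m' T' where *: "realizes c m f T" "pbound T" "realizes c' m' g T'" "pbound T'"
    using assms unfolding ptime_def by blast
  have "pbound (\<lambda>x. T x + T' x + 6)" "pbound (\<lambda>x. sz (f x, g x))"
    unfolding sz_simps by (intro pbound_intros * ptime_pbound assms)+
  then show ?thesis using realizes_pair[OF *(1,3)] unfolding ptime_def by blast
qed

lemma ptime_fst [ptime_intros]: "ptime f \<Longrightarrow> ptime (\<lambda>x. fst (f x))"
  by (rule ptime_comp[of fst], rule ptime_exp[of "Hd (Var 0)"])
    (auto simp: repr_prod_def intro: pbound_mono[OF pbound_sz] sz_fst_le)

lemma ptime_snd [ptime_intros]: "ptime f \<Longrightarrow> ptime (\<lambda>x. snd (f x))"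
  by (rule ptime_comp[of snd], rule ptime_exp[of "Tl (Var 0)"])
    (auto simp: repr_prod_def intro: pbound_mono[OF pbound_sz] sz_snd_le)

lemma ptime_app2:
  assumes "ptime (\<lambda>p. h (fst p) (snd p))" "ptime f" "ptime g"
  shows "ptime (\<lambda>x. h (f x) (g x))"
  using ptime_comp[OF assms(1) ptime_Pair[OF assms(2,3)]] by simp

lemma ptime_If [ptime_intros]:
  assumes "ptime P" "ptime f" "ptime g"
  shows "ptime (\<lambda>x. if P x then f x else g x)"
proof -
  obtain c m T c' m' T' c'' m'' T'' where *: "realizes c m P T" "pbound T"
      "realizes c' m' f T'" "pbound T'" "realizes c'' m'' g T''" "pbound T''"
    using assms unfolding ptime_def by blast
  have "pbound (\<lambda>x. T x + (T' x + T'' x) + 6)" "pbound (\<lambda>x. sz (f x) + sz (g x))"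
    by (intro pbound_intros * ptime_pbound assms)+
  moreover from this(2) have "pbound (\<lambda>x. sz (if P x then f x else g x))"
    by (rule pbound_mono) simp
  ultimately show ?thesis using realizes_if[OF *(1,3,5)] unfolding ptime_def by blast
qed

lemma ptime_conj [ptime_intros]: "ptime P \<Longrightarrow> ptime Q \<Longrightarrow> ptime (\<lambda>x. P x \<and> Q x)"
  using ptime_If[of P Q "\<lambda>_. False"] ptime_const[of False] by (simp add: if_bool_eq_disj)

lemma ptime_not [ptime_intros]: "ptime P \<Longrightarrow> ptime (\<lambda>x. \<not> P x)"
  using ptime_If[of P "\<lambda>_. False" "\<lambda>_. True"] ptime_const[of False] ptime_const[of True]
  by (simp add: if_bool_eq_disj)

lemma ptime_disj [ptime_intros]: "ptime P \<Longrightarrow> ptime Q \<Longrightarrow> ptime (\<lambda>x. P x \<or> Q x)"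
  using ptime_not[OF ptime_conj[OF ptime_not ptime_not], of P Q] by simp

lemma ptime_imp [ptime_intros]: "ptime P \<Longrightarrow> ptime Q \<Longrightarrow> ptime (\<lambda>x. P x \<longrightarrow> Q x)"
  unfolding imp_conv_disj by (intro ptime_disj ptime_not)

lemma ptime_eq_bool [ptime_intros]: "ptime P \<Longrightarrow> ptime Q \<Longrightarrow> ptime (\<lambda>x. (P x :: bool) = Q x)"
  unfolding iff_conv_conj_imp by (intro ptime_conj ptime_imp)

text \<open>A pair of an element and a list is the same tree as the nonempty list made of them, so
  the identity program does the work.\<close>

lemma ptime_Cons [ptime_intros]: "ptime f \<Longrightarrow> ptime g \<Longrightarrow> ptime (\<lambda>x. f x # g x)"
  by (rule ptime_app2[of "(#)"], rule ptime_exp[of "Var 0"])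
    (auto simp: repr_prod_def sz_def intro!: pbound_mono[OF pbound_sz])

lemma ptime_tl [ptime_intros]:
  fixes f :: "'a::coded \<Rightarrow> 'b::coded list"
  assumes "ptime f"
  shows "ptime (\<lambda>x. tl (f x))"
proof (rule ptime_comp[of tl, OF _ assms], rule ptime_exp[of "Tl (Var 0)"])
  fix s :: store and xs :: "'b list" assume "s 0 = repr xs"
  then show "eval_exp (Tl (Var 0)) s = repr (tl xs)" by (cases xs) auto
next
  show "pbound (\<lambda>xs :: 'b list. sz (tl xs))"
  proof (rule pbound_mono[OF pbound_sz])
    show "sz (tl xs) \<le> sz xs" for xs :: "'b list" by (cases xs) auto
  qed
qed

lemma ptime_Suc [ptime_intros]: "ptime f \<Longrightarrow> ptime (\<lambda>x. Suc (f x))"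
  by (rule ptime_comp[of Suc], rule ptime_exp[of "exp.Cons Quote_Atom (Var 0)"])
    (simp add: repr_nat_def, simp, rule pbound_Suc, rule pbound_mono[OF pbound_sz], simp)

lemma ptime_replicate_unit: "ptime f \<Longrightarrow> ptime (\<lambda>x. replicate (f x) ())"
  by (rule ptime_comp[of "\<lambda>n. replicate n ()"], rule ptime_exp[of "Var 0"])
    (auto simp: repr_replicate_unit sz_def intro!: pbound_mono[OF pbound_sz[unfolded sz_def]])

lemma ptime_length_unit: "ptime (length :: unit list \<Rightarrow> nat)"
proof (rule ptime_exp[of "Var 0"])
  fix s :: store and xs :: "unit list" assume "s 0 = repr xs"
  moreover have "xs = replicate (length xs) ()" by (induction xs) auto
  ultimately show "eval_exp (Var 0) s = repr (length xs)" using repr_replicate_unit by (metis eval_exp.simps(1))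
qed (auto intro: pbound_mono[OF pbound_sz] length_le_sz)

text \<open>In \<open>realizes_fold\<close> the step sees just the element and the accumulator.
  Carrying the outer argument along in the accumulator gives steps that depend on it.\<close>

lemma fold_carry: "fold (\<lambda>y p. (fst p, g (fst p) y (snd p))) ys (x, b) = (x, fold (g x) ys b)"
  by (induction ys arbitrary: b) auto

lemma realizable_fold:
  assumes "realizable l" "realizable a" "realizable (\<lambda>p. g (fst p) (fst (snd p)) (snd (snd p)))"
  shows "realizable (\<lambda>x. fold (g x) (l x) (a x))"
proof -
  have id: "realizable (\<lambda>x. x)" and fst: "realizable fst" and snd: "realizable snd"
    by (intro ptime_realizable ptime_intros)+
  let ?G = "\<lambda>y p. (fst p, g (fst p) y (snd p))"
  have "realizable (\<lambda>p. g (fst (fst (snd p), (fst p, snd (snd p))))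
      (fst (snd (fst (snd p), (fst p, snd (snd p))))) (snd (snd (fst (snd p), (fst p, snd (snd p))))))"
    by (rule realizable_comp[OF assms(3), of "\<lambda>p. (fst (snd p), (fst p, snd (snd p)))"])
      (intro realizable_Pair realizable_comp[OF fst] realizable_comp[OF snd] id)
  then have "realizable (\<lambda>p. g (fst (snd p)) (fst p) (snd (snd p)))" by simp
  then have "realizable (\<lambda>p. ?G (fst p) (snd p))"
    by (intro realizable_Pair realizable_comp[OF fst] snd)
  then obtain c m T where "realizes c m (\<lambda>p. ?G (fst p) (snd p)) T"
    unfolding realizable_def by blast
  from realizes_fold[OF this] have *: "realizable (\<lambda>p. fold ?G (snd p) (fst p))"
    unfolding realizable_def by blast
  have "realizable (\<lambda>x. fold ?G (snd ((x, a x), l x)) (fst ((x, a x), l x)))"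
    by (rule realizable_comp[OF *]) (intro realizable_Pair id assms)
  from realizable_comp[OF snd this] show ?thesis by (simp add: fold_carry)
qed

lemma fold_time_le:
  assumes "\<And>ys y zs. xs = ys @ y # zs \<Longrightarrow> T (y, fold g ys b) \<le> M"
  shows "fold_time T g xs b \<le> 1 + length xs * (M + 3)"
  using assms
proof (induction xs arbitrary: b)
  case (Cons x xs)
  have "T (x, b) \<le> M" using Cons.prems[of "[]"] by simp
  moreover have "fold_time T g xs (g x b) \<le> 1 + length xs * (M + 3)"
  proof (rule Cons.IH)
    show "T (y, fold g ys (g x b)) \<le> M" if "xs = ys @ y # zs" for ys y zs
      using Cons.prems[of "x # ys" y zs] that by simp
  qed
  ultimately show ?case by simp
qed simp

text \<open>Iterating a polynomial-time step can square or double the accumulator in every round.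
  Hence the bound \<open>B\<close> is demanded for the fold over each prefix of the list.\<close>

lemma ptime_fold:
  fixes l :: "'x::coded \<Rightarrow> 'a::coded list" and a :: "'x \<Rightarrow> 'b::coded"
  assumes l: "ptime l" and a: "ptime a"
    and g: "ptime (\<lambda>p. g (fst p) (fst (snd p)) (snd (snd p)))"
    and B: "pbound B" "\<And>x ys zs. l x = ys @ zs \<Longrightarrow> sz (fold (g x) ys (a x)) \<le> B x"
  shows "ptime (\<lambda>x. fold (g x) (l x) (a x))"
proof -
  let ?G = "\<lambda>y p. (fst p, g (fst p) y (snd p))"
  have "ptime (\<lambda>p. g (fst (snd p)) (fst p) (snd (snd p)))"
    using ptime_comp[OF g, of "\<lambda>p. (fst (snd p), (fst p, snd (snd p)))"] by (simp add: ptime_intros)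
  then have "ptime (\<lambda>p. ?G (fst p) (snd p))" by (intro ptime_intros)
  then obtain c m T where T: "realizes c m (\<lambda>p. ?G (fst p) (snd p)) T" "pbound T"
    unfolding ptime_def by blast
  obtain c1 m1 T1 where T1: "realizes c1 m1 (\<lambda>x. ((x, a x), l x)) T1" "pbound T1"
    using ptime_Pair[OF ptime_Pair[OF ptime_id a] l] unfolding ptime_def by blast
  obtain c2 m2 where "realizes c2 m2 (\<lambda>p. fold ?G (snd p) (fst p)) (\<lambda>p. fold_time T ?G (snd p) (fst p) + 2)"
    using realizes_fold[OF T(1)] by blast
  from realizes_comp[OF T1(1) this]
  have R: "realizes (Seq c1 c2) (max m1 m2) (\<lambda>x. (x, fold (g x) (l x) (a x)))
      (\<lambda>x. T1 x + (fold_time T ?G (l x) (x, a x) + 2))" by (simp add: fold_carry)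
  obtain e where e: "\<And>p. T p \<le> (sz p + 2) ^ e" using T(2) unfolding pbound_def by blast
  \<comment> \<open>The step runs on \<open>(y, (x, acc))\<close>: two pairing cells and the
    additive 2 in the base of \<open>pbound\<close> make up the 4.\<close>
  define M where "M x = (sz x + sz (l x) + B x + 4) ^ e" for x
  have M: "fold_time T ?G (l x) (x, a x) \<le> 1 + length (l x) * (M x + 3)" for x
  proof (rule fold_time_le)
    fix ys y zs assume *: "l x = ys @ y # zs"
    have "sz (fold (g x) ys (a x)) \<le> B x" using B(2)[OF *] .
    moreover have "sz y < sz (l x)" using * by (intro sz_mem_le) auto
    ultimately have "sz (y, fold ?G ys (x, a x)) + 2 \<le> sz x + sz (l x) + B x + 4"
      by (simp add: fold_carry)
    then show "T (y, fold ?G ys (x, a x)) \<le> M x"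
      unfolding M_def using e order_trans power_mono by blast
  qed
  have "pbound (\<lambda>x. sz x + B x + 1)" by (intro pbound_intros B(1))
  then have "pbound (\<lambda>x. sz (x, fold (g x) (l x) (a x)))"
    by (rule pbound_mono) (use B(2)[of _ _ "[]"] in auto)
  moreover have "pbound (\<lambda>x. T1 x + ((1 + sz (l x) * (M x + 3)) + 2))"
    unfolding M_def by (intro pbound_intros T1(2) ptime_pbound[OF l] B(1))
  then have "pbound (\<lambda>x. T1 x + (fold_time T ?G (l x) (x, a x) + 2))"
  proof (rule pbound_mono)
    fix x
    have "fold_time T ?G (l x) (x, a x) \<le> 1 + sz (l x) * (M x + 3)"
      using M[of x] mult_le_mono1[OF length_le_sz[of "l x"], of "M x + 3"] by linarith
    then show "T1 x + (fold_time T ?G (l x) (x, a x) + 2) \<le> T1 x + ((1 + sz (l x) * (M x + 3)) + 2)"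
      by simp
  qed
  ultimately have "ptime (\<lambda>x. (x, fold (g x) (l x) (a x)))"
    using R unfolding ptime_def by blast
  from ptime_snd[OF this] show ?thesis by simp
qed


section \<open>Polynomial-time functions on lists and numbers\<close>

lemma fold_Cons_eq: "fold (#) xs ys = rev xs @ ys"
  by (induction xs arbitrary: ys) auto

lemma ptime_rev [ptime_intros]:
  assumes "ptime l"
  shows "ptime (\<lambda>x. rev (l x))"
proof -
  have "ptime (\<lambda>x. fold (#) (l x) [])"
    by (rule ptime_fold[where B = "\<lambda>x. sz (l x)"])
      (auto intro!: ptime_intros assms ptime_pbound simp: fold_Cons_eq)
  then show ?thesis by (simp add: fold_Cons_eq)
qed

lemma ptime_append [ptime_intros]:
  assumes "ptime f" "ptime g"
  shows "ptime (\<lambda>x. f x @ g x)"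
proof -
  have "ptime (\<lambda>x. fold (#) (rev (f x)) (g x))"
  proof (rule ptime_fold[where B = "\<lambda>x. sz (f x) + sz (g x)"])
    fix x ys zs assume "rev (f x) = ys @ zs"
    then have "sz (rev (f x)) = sz ys + sz zs" by (simp only: sz_append)
    then show "sz (fold (#) ys (g x)) \<le> sz (f x) + sz (g x)" by (simp add: fold_Cons_eq)
  qed (auto intro!: ptime_intros pbound_intros assms ptime_pbound)
  then show ?thesis by (simp add: fold_Cons_eq)
qed

text \<open>Under a binder the argument is a pair of the outer argument and the bound element.
  Hypotheses about functions of the outer argument are moved there by \<open>ptime_comp\<close> with
  a projection; the same pattern recurs for all bounded quantifiers and filters below.\<close>

lemma ptime_map [ptime_intros]:
  assumes f: "ptime (\<lambda>p. f (fst p) (snd p))" and l: "ptime l"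
  shows "ptime (\<lambda>x. map (f x) (l x))"
proof -
  have *: "fold (\<lambda>y acc. f x y # acc) ys [] = rev (map (f x) ys)" for x ys
    using fold_Cons_eq[of "map (f x) ys" "[]"] by (simp add: fold_map comp_def)
  obtain e where e: "\<And>p. sz (f (fst p) (snd p)) \<le> (sz p + 2) ^ e"
    using ptime_pbound[OF f] unfolding pbound_def by blast
  define M where "M x = (sz x + sz (l x) + 3) ^ e" for x
  have "ptime (\<lambda>x. fold (\<lambda>y acc. f x y # acc) (l x) [])"
  proof (rule ptime_fold[where B = "\<lambda>x. sz (l x) * Suc (M x)"])
    fix x ys zs assume l: "l x = ys @ zs"
    have "sz (map (f x) ys) \<le> length (map (f x) ys) * Suc (M x)"
    proof (rule sz_list_le)
      fix u assume "u \<in> set (map (f x) ys)"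
      then obtain y where y: "y \<in> set ys" "u = f x y" by auto
      have "sz y < sz (l x)" using y l by (intro sz_mem_le) auto
      then show "sz u \<le> M x"
        using e[of "(x, y)"] power_mono[of "sz (x, y) + 2" "sz x + sz (l x) + 3" e]
        by (simp add: y M_def)
    qed
    moreover have "length ys \<le> sz (l x)" using length_le_sz[of "l x"] l by auto
    ultimately show "sz (fold (\<lambda>y acc. f x y # acc) ys []) \<le> sz (l x) * Suc (M x)"
      unfolding * sz_rev using mult_le_mono1[of "length ys" "sz (l x)" "Suc (M x)"] by simp
  next
    show "pbound (\<lambda>x. sz (l x) * Suc (M x))"
      unfolding M_def by (intro pbound_intros ptime_pbound l)
    show "ptime (\<lambda>p. f (fst p) (fst (snd p)) # snd (snd p))"
      by (intro ptime_intros ptime_app2[OF f])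
  qed (intro ptime_intros l)+
  then have "ptime (\<lambda>x. rev (rev (map (f x) (l x))))" unfolding * by (rule ptime_rev)
  then show ?thesis by simp
qed

lemma ptime_concat [ptime_intros]:
  assumes "ptime l"
  shows "ptime (\<lambda>x. concat (l x))"
proof -
  have *: "fold (\<lambda>y acc. acc @ y) xs ys = ys @ concat xs" for xs :: "'b list list" and ys
    by (induction xs arbitrary: ys) auto
  have le: "sz (concat xs) \<le> sz xs" for xs :: "'b list list" by (induction xs) auto
  have "ptime (\<lambda>x. fold (\<lambda>y acc. acc @ y) (l x) [])"
  proof (rule ptime_fold[where B = "\<lambda>x. sz (l x)"])
    fix x ys zs assume "l x = ys @ zs"
    then show "sz (fold (\<lambda>y acc. acc @ y) ys []) \<le> sz (l x)"
      using le[of ys] by (simp add: *)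
  qed (auto intro!: ptime_intros assms ptime_pbound)
  then show ?thesis by (simp add: *)
qed

lemma ptime_filter [ptime_intros]:
  assumes "ptime (\<lambda>p. P (fst p) (snd p))" "ptime l"
  shows "ptime (\<lambda>x. filter (P x) (l x))"
proof -
  have "ptime (\<lambda>x. concat (map (\<lambda>y. if P x y then [y] else []) (l x)))"
    by (intro ptime_intros assms)
  moreover have "concat (map (\<lambda>y. if Q y then [y] else []) ys) = filter Q ys" for Q and ys :: "'b list"
    by (induction ys) auto
  ultimately show ?thesis by simp
qed

lemma ptime_Ball [ptime_intros]:
  assumes "ptime (\<lambda>p. P (fst p) (snd p))" "ptime l"
  shows "ptime (\<lambda>x. \<forall>y\<in>set (l x). P x y)"
proof -
  have *: "fold (\<lambda>y acc. acc \<and> P x y) ys b \<longleftrightarrow> b \<and> (\<forall>y\<in>set ys. P x y)" for x ys b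
    by (induction ys arbitrary: b) auto
  have "ptime (\<lambda>x. fold (\<lambda>y acc. acc \<and> P x y) (l x) True)"
    by (rule ptime_fold[where B = "\<lambda>x. 1"])
      (intro ptime_intros ptime_app2[OF assms(1)] assms pbound_intros sz_bool_le)+
  then show ?thesis by (simp add: *)
qed

lemma ptime_Bex [ptime_intros]:
  assumes "ptime (\<lambda>p. P (fst p) (snd p))" "ptime l"
  shows "ptime (\<lambda>x. \<exists>y\<in>set (l x). P x y)"
  using ptime_not[OF ptime_Ball[OF ptime_not[OF assms(1)] assms(2)]] by simp

lemma ptime_length [ptime_intros]:
  assumes "ptime l"
  shows "ptime (\<lambda>x. length (l x))"
  using ptime_comp[OF ptime_length_unit ptime_map[OF ptime_const[of "()"] assms]] by simp

lemma ptime_eq_Nil [ptime_intros]: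
  assumes "ptime l"
  shows "ptime (\<lambda>x. l x = [])"
proof -
  have "ptime (\<lambda>x. \<forall>y\<in>set (l x). False)" by (intro ptime_intros assms)
  then show ?thesis by simp
qed

definition head :: "'a \<Rightarrow> 'a list \<Rightarrow> 'a" where
  "head d xs = (case xs of [] \<Rightarrow> d | x # _ \<Rightarrow> x)"

lemma head_simps [simp]: "head d [] = d" "head d (x # xs) = x"
  by (simp_all add: head_def)

text \<open>Folds replace case analysis on lists here: the head is the last element met when the
  reversed list is traversed, and the default survives if there is none.\<close>

lemma ptime_head [ptime_intros]:
  assumes "ptime l"
  shows "ptime (\<lambda>x. head d (l x))"
proof -
  have *: "fold (\<lambda>y _. y) ys d = head d (rev ys)" for ys
    by (induction ys rule: rev_induct) auto
  have "ptime (\<lambda>x. fold (\<lambda>y _. y) (rev (l x)) d)"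
  proof (rule ptime_fold[where B = "\<lambda>x. sz (l x) + sz d"])
    fix x ys zs assume "rev (l x) = ys @ zs"
    then have "set ys \<subseteq> set (l x)" by (metis Un_upper1 set_append set_rev)
    then show "sz (fold (\<lambda>y _. y) ys d) \<le> sz (l x) + sz d"
      unfolding * by (cases "rev ys") (auto dest!: sz_mem_le simp: trans_le_add1 less_imp_le
        simp flip: set_rev[of ys])
  qed (auto intro!: ptime_intros pbound_intros assms ptime_pbound)
  then show ?thesis by (simp add: *)
qed

lemma ptime_drop [ptime_intros]:
  assumes "ptime n" "ptime l"
  shows "ptime (\<lambda>x. drop (n x) (l x))"
proof -
  have *: "fold (\<lambda>_. tl) us xs = drop (length us) xs" for us :: "unit list" and xs :: "'b list"
    by (induction us arbitrary: xs) (auto simp: drop_Suc)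
  have "ptime (\<lambda>x. fold (\<lambda>_. tl) (replicate (n x) ()) (l x))"
  proof (rule ptime_fold[where B = "\<lambda>x. sz (l x)"])
    fix x and ys zs :: "unit list"
    have "sz (l x) = sz (take (length ys) (l x)) + sz (drop (length ys) (l x))"
      by (metis append_take_drop_id sz_append)
    then show "sz (fold (\<lambda>_. tl) ys (l x)) \<le> sz (l x)" by (simp add: *)
  qed (auto intro!: ptime_intros ptime_replicate_unit assms ptime_pbound)
  then show ?thesis unfolding * by simp
qed

lemma ptime_diff [ptime_intros]:
  assumes "ptime m" "ptime n"
  shows "ptime (\<lambda>x. (m x :: nat) - n x)"
proof -
  have "ptime (\<lambda>x. length (drop (n x) (replicate (m x) ())))"
    by (intro ptime_intros ptime_replicate_unit assms)
  then show ?thesis by simp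
qed

lemma ptime_take [ptime_intros]:
  assumes "ptime n" "ptime l"
  shows "ptime (\<lambda>x. take (n x) (l x))"
proof -
  have "ptime (\<lambda>x. rev (drop (length (l x) - n x) (rev (l x))))"
    by (intro ptime_intros assms)
  moreover have "rev (drop (length ys - k) (rev ys)) = take k ys" for k and ys :: "'b list"
    by (cases "k \<le> length ys") (auto simp: drop_rev)
  ultimately show ?thesis by simp
qed

lemma ptime_replicate [ptime_intros]:
  assumes "ptime n" "ptime f"
  shows "ptime (\<lambda>x. replicate (n x) (f x))"
proof -
  have "ptime (\<lambda>x. map (\<lambda>_. f x) (replicate (n x) ()))"
    by (intro ptime_intros ptime_replicate_unit assms ptime_comp[OF assms(2)])
  then show ?thesis by simp
qed

lemma ptime_plus [ptime_intros]:
  assumes "ptime m" "ptime n"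
  shows "ptime (\<lambda>x. (m x :: nat) + n x)"
proof -
  have "ptime (\<lambda>x. length (replicate (m x) () @ replicate (n x) ()))"
    by (intro ptime_intros assms)
  then show ?thesis by simp
qed

lemma ptime_times [ptime_intros]:
  assumes "ptime m" "ptime n"
  shows "ptime (\<lambda>x. (m x :: nat) * n x)"
proof -
  have "ptime (\<lambda>x. length (concat (replicate (m x) (replicate (n x) ()))))"
    by (intro ptime_intros assms)
  then show ?thesis by (simp add: length_concat map_replicate sum_list_replicate)
qed

lemma ptime_power [ptime_intros]: "ptime m \<Longrightarrow> ptime (\<lambda>x. (m x :: nat) ^ e)"
  by (induction e) (auto intro: ptime_intros)

lemma ptime_le [ptime_intros]:
  assumes "ptime m" "ptime n"
  shows "ptime (\<lambda>x. (m x :: nat) \<le> n x)"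
proof -
  have "ptime (\<lambda>x. replicate (m x - n x) () = [])"
    by (intro ptime_intros assms)
  then show ?thesis by simp
qed

lemma ptime_less [ptime_intros]:
  assumes "ptime m" "ptime n"
  shows "ptime (\<lambda>x. (m x :: nat) < n x)"
  using ptime_le[OF ptime_Suc[OF assms(1)] assms(2)] by (simp add: Suc_le_eq)

lemma ptime_eq_nat [ptime_intros]:
  assumes "ptime m" "ptime n"
  shows "ptime (\<lambda>x. (m x :: nat) = n x)"
  unfolding eq_iff by (intro ptime_intros assms)

lemma ptime_upt [ptime_intros]:
  assumes "ptime n"
  shows "ptime (\<lambda>x. [0..<n x])"
proof -
  have *: "fold (\<lambda>_ acc. acc @ [length acc]) us [0..<k] = [0..<k + length us]" for us :: "unit list" and k
  proof (induction us arbitrary: k)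
    case (Cons u us)
    then show ?case using Cons.IH[of "Suc k"] by simp
  qed simp
  have "ptime (\<lambda>x. fold (\<lambda>_ acc. acc @ [length acc]) (replicate (n x) ()) [])"
  proof (rule ptime_fold[where B = "\<lambda>x. sz (n x) * Suc (sz (n x))"])
    fix x ys zs assume "replicate (n x) () = ys @ zs"
    then have "length ys \<le> n x" by (metis length_append length_replicate le_add1)
    have "sz [0..<length ys] \<le> length [0..<length ys] * Suc (n x)"
      using \<open>length ys \<le> n x\<close> by (intro sz_list_le) auto
    also have "\<dots> \<le> n x * Suc (n x)" using \<open>length ys \<le> n x\<close> by (intro mult_le_mono1) simp
    finally show "sz (fold (\<lambda>_ acc. acc @ [length acc]) ys []) \<le> sz (n x) * Suc (sz (n x))"
      using *[of ys 0] by simp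
  qed (intro ptime_intros pbound_intros ptime_pbound assms)+
  then show ?thesis unfolding *[of _ 0, simplified] by simp
qed

text \<open>Beyond the end of a list, \<open>nth\<close> is an unspecified function of the index,
  about which nothing can be computed. The default makes lookup total.\<close>

definition nth_or :: "'a \<Rightarrow> 'a list \<Rightarrow> nat \<Rightarrow> 'a" where
  "nth_or d xs i = head d (drop i xs)"

lemma nth_or_eq: "i < length xs \<Longrightarrow> nth_or d xs i = xs ! i"
  unfolding nth_or_def by (simp flip: Cons_nth_drop_Suc)

lemma ptime_nth_or [ptime_intros]:
  "ptime l \<Longrightarrow> ptime n \<Longrightarrow> ptime (\<lambda>x. nth_or d (l x) (n x))"
  unfolding nth_or_def by (intro ptime_intros)

text \<open>The language tests for \<open>Atom\<close> only, so equality is derived type by type,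
  with equality on the components as a premise.\<close>

lemma ptime_eq_prod [ptime_intros]:
  assumes "ptime (\<lambda>p::'a::coded \<times> 'a. fst p = snd p)" "ptime (\<lambda>p::'b::coded \<times> 'b. fst p = snd p)"
    "ptime f" "ptime g"
  shows "ptime (\<lambda>x. (f x :: 'a \<times> 'b) = g x)"
proof -
  have "ptime (\<lambda>x. fst (f x) = fst (g x) \<and> snd (f x) = snd (g x))"
    by (intro ptime_intros ptime_app2[OF assms(1)] ptime_app2[OF assms(2)] assms(3,4))
  then show ?thesis by (simp add: prod_eq_iff)
qed

lemma ptime_eq_list [ptime_intros]:
  assumes eq: "ptime (\<lambda>p::'a::coded \<times> 'a. fst p = snd p)" and fg: "ptime f" "ptime g"
  shows "ptime (\<lambda>x. (f x :: 'a list) = g x)"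
proof -
  define d where "d = (undefined :: 'a)"
  have "ptime (\<lambda>x. length (f x) = length (g x) \<and>
      (\<forall>i\<in>set [0..<length (f x)]. nth_or d (f x) i = nth_or d (g x) i))"
    by (intro ptime_intros ptime_app2[OF eq] fg ptime_comp[OF fg(1), of fst] ptime_comp[OF fg(2), of fst])
  moreover have "(length xs = length ys \<and> (\<forall>i\<in>set [0..<length xs]. nth_or d xs i = nth_or d ys i)) \<longleftrightarrow>
      xs = ys" for xs ys
    by (auto simp: nth_or_eq intro!: nth_equalityI)
  ultimately show ?thesis by simp
qed

lemma ptime_member [ptime_intros]:
  assumes eq: "ptime (\<lambda>p::'a::coded \<times> 'a. fst p = snd p)" and fg: "ptime f" "ptime g"
  shows "ptime (\<lambda>x. (f x :: 'a) \<in> set (g x))"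
proof -
  have "ptime (\<lambda>x. \<exists>y\<in>set (g x). f x = y)"
    by (intro ptime_intros ptime_app2[OF eq] fg ptime_comp[OF fg(1), of fst])
  then show ?thesis by simp
qed

text \<open>The length \<open>k\<close> is a constant of the program and not an input: the number of
  tuples is polynomial only for fixed \<open>k\<close>. The reduction relies on this with length
  \<open>2 ^ (d + 1)\<close>.\<close>

lemma ptime_n_lists [ptime_intros]: "ptime l \<Longrightarrow> ptime (\<lambda>x. List.n_lists k (l x))"
proof (induction k)
  case (Suc k)
  show ?case unfolding List.n_lists.simps
    by (intro ptime_intros Suc.IH Suc.prems ptime_comp[OF Suc.prems, of fst])
qed (simp add: ptime_intros)


section \<open>Composition of fpt-reductions\<close>

primrec bound_exp :: "exp \<Rightarrow> nat" where
  "bound_exp (Var x) = Suc x"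
| "bound_exp Quote_Atom = 0"
| "bound_exp (exp.Cons a b) = max (bound_exp a) (bound_exp b)"
| "bound_exp (Hd a) = bound_exp a"
| "bound_exp (Tl a) = bound_exp a"

primrec bound_com :: "com \<Rightarrow> nat" where
  "bound_com Skip = 0"
| "bound_com (Assign x a) = max (Suc x) (bound_exp a)"
| "bound_com (Seq c c') = max (bound_com c) (bound_com c')"
| "bound_com (If a c c') = max (bound_exp a) (max (bound_com c) (bound_com c'))"
| "bound_com (While a c) = max (bound_exp a) (bound_com c)"

lemma eval_exp_cong: "(\<And>i. i < bound_exp a \<Longrightarrow> s i = r i) \<Longrightarrow> eval_exp a s = eval_exp a r"
  by (induction a) auto

lemma exec_frame:
  assumes "exec c s t s'" "bound_com c \<le> m" "\<And>i. i < m \<Longrightarrow> s i = r i"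
  shows "exec c r t (\<lambda>i. if i < m then s' i else r i)"
  using assms
proof (induction arbitrary: r rule: exec.induct)
  case (Skip s)
  then have "(\<lambda>i. if i < m then s i else r i) = r" by auto
  then show ?case by (simp add: exec.Skip[simplified])
next
  case (Assign x a s)
  have "eval_exp a s = eval_exp a r" using Assign by (intro eval_exp_cong) auto
  then have "(\<lambda>i. if i < m then (s(x := eval_exp a s)) i else r i) = r(x := eval_exp a r)"
    using Assign by (auto simp: fun_eq_iff)
  then show ?case by (simp only: exec.Assign)
next
  case (Seq c\<^sub>1 s t\<^sub>1 s' c\<^sub>2 t\<^sub>2 s'')
  let ?r = "\<lambda>i. if i < m then s' i else r i"
  have "exec c\<^sub>1 r t\<^sub>1 ?r" using Seq by auto
  moreover have "exec c\<^sub>2 ?r t\<^sub>2 (\<lambda>i. if i < m then s'' i else ?r i)" using Seq.IH(2)[of ?r] Seq.prems by auto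
  moreover have "(\<lambda>i. if i < m then s'' i else ?r i) = (\<lambda>i. if i < m then s'' i else r i)" by auto
  ultimately show ?case using exec.Seq by metis
next
  case (IfTrue a s c\<^sub>1 t s' c\<^sub>2)
  have "eval_exp a s = eval_exp a r" using IfTrue by (intro eval_exp_cong) auto
  then show ?case using IfTrue by (intro exec.IfTrue) auto
next
  case (IfFalse a s c\<^sub>2 t s' c\<^sub>1)
  have "eval_exp a s = eval_exp a r" using IfFalse by (intro eval_exp_cong) auto
  then show ?case using IfFalse by (intro exec.IfFalse) auto
next
  case (WhileFalse a s c)
  have "eval_exp a s = eval_exp a r" using WhileFalse by (intro eval_exp_cong) auto
  moreover have "(\<lambda>i. if i < m then s i else r i) = r" using WhileFalse by auto
  ultimately show ?case using WhileFalse exec.WhileFalse[of a r c] by metis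
next
  case (WhileTrue a s c t\<^sub>1 s' t\<^sub>2 s'')
  let ?r = "\<lambda>i. if i < m then s' i else r i"
  have "eval_exp a s = eval_exp a r" using WhileTrue by (intro eval_exp_cong) auto
  moreover have "exec c r t\<^sub>1 ?r" using WhileTrue by auto
  moreover have "exec (While a c) ?r t\<^sub>2 (\<lambda>i. if i < m then s'' i else ?r i)"
    using WhileTrue.IH(2)[of ?r] WhileTrue.prems by auto
  moreover have "(\<lambda>i. if i < m then s'' i else ?r i) = (\<lambda>i. if i < m then s'' i else r i)" by auto
  ultimately show ?case using exec.WhileTrue WhileTrue.hyps(1) by metis
qed

text \<open>Applied to the initial store itself, the frame property yields a run whose final store
  agrees with \<open>s\<close> from register \<open>i\<close> on; by determinism it ends in
  \<open>s'\<close>.\<close>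

lemma exec_unchanged:
  assumes "exec c s t s'" "bound_com c \<le> i"
  shows "s' i = s i"
  using exec_deterministic[OF assms(1) exec_frame[OF assms refl]] by (metis less_irrefl)

primrec clear_regs :: "nat \<Rightarrow> nat \<Rightarrow> com" where
  "clear_regs k 0 = Skip"
| "clear_regs k (Suc n) = Seq (clear_regs k n) (Assign (k + n) Quote_Atom)"

lemma exec_clear_regs: "exec (clear_regs k n) s (Suc n) (\<lambda>i. if k \<le> i \<and> i < k + n then Atom else s i)"
proof (induction n)
  case 0
  have "(\<lambda>i. if k \<le> i \<and> i < k + 0 then Atom else s i) = s" by (intro ext) auto
  then show ?case using exec.Skip[of s] by simp
next
  case (Suc n)
  let ?s = "\<lambda>i. if k \<le> i \<and> i < k + n then Atom else s i"
  have "exec (Assign (k + n) Quote_Atom) ?s 1 (?s(k + n := eval_exp Quote_Atom ?s))" by (rule exec.Assign)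
  moreover have "?s(k + n := eval_exp Quote_Atom ?s) = (\<lambda>i. if k \<le> i \<and> i < k + Suc n then Atom else s i)"
    by (intro ext) auto
  ultimately show ?case using exec.Seq[OF Suc] by fastforce
qed

text \<open>\<open>computable\<close> starts in the empty store and says nothing about the other
  registers at the end. The frame property and a final clearing turn such a program into one that
  obeys the register discipline of \<open>realizes\<close>.\<close>

lemma computable_iff_realizable: "computable f \<longleftrightarrow> realizable f"
proof
  assume "computable f"
  then obtain c where c: "\<forall>n. \<exists>t s. exec c (empty_store(0 := data_of_nat n)) t s \<and> s 0 = data_of_nat (f n)"
    unfolding computable_def by blast
  from choice[OF c] obtain T where
    T: "\<forall>n. \<exists>s. exec c (empty_store(0 := data_of_nat n)) (T n) s \<and> s 0 = data_of_nat (f n)" by blast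
  define m where "m = Suc (bound_com c)"
  have "realizes (Seq c (clear_regs 1 m)) (Suc m) f (\<lambda>n. T n + Suc m)"
    unfolding realizes_def
  proof (intro allI impI)
    fix s :: store and n :: nat
    assume s: "s 0 = repr n" "\<forall>i. 0 < i \<and> i < Suc m \<longrightarrow> s i = Atom"
    obtain s' where s': "exec c (empty_store(0 := data_of_nat n)) (T n) s'" "s' 0 = data_of_nat (f n)"
      using T by blast
    let ?s = "\<lambda>i. if i < m then s' i else s i"
    have "exec c s (T n) ?s"
      using s by (intro exec_frame[OF s'(1)]) (auto simp: m_def empty_store_def repr_nat_def)
    from exec.Seq[OF this exec_clear_regs[of 1 m]]
    have "exec (Seq c (clear_regs 1 m)) s (T n + Suc m) (\<lambda>i. if 1 \<le> i \<and> i < 1 + m then Atom else ?s i)" .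
    moreover have "(\<lambda>i. if 1 \<le> i \<and> i < 1 + m then Atom else ?s i) = s(0 := repr (f n))"
      using s s' by (auto simp: fun_eq_iff m_def repr_nat_def)
    ultimately show "runs (Seq c (clear_regs 1 m)) s (T n + Suc m) (s(0 := repr (f n)))"
      unfolding runs_def by auto
  qed
  then show "realizable f" unfolding realizable_def by blast
next
  assume "realizable f"
  then obtain c m T where R: "realizes c m f T" unfolding realizable_def by blast
  have "\<exists>t s. exec c (empty_store(0 := data_of_nat n)) t s \<and> s 0 = data_of_nat (f n)" for n
    using realizesD[OF R, of "empty_store(0 := data_of_nat n)" n]
    unfolding runs_def repr_nat_def by (fastforce simp: empty_store_def)
  then show "computable f" unfolding computable_def by blast
qed

lemma ptime_computable: "ptime f \<Longrightarrow> computable f"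
  by (simp add: computable_iff_realizable ptime_realizable)

text \<open>A reduction bounds its new parameter by \<open>g k\<close> only, and the bounds of the
  next reduction need not be monotone. Their sum over all \<open>j \<le> g k\<close> is a computable
  substitute for a monotone bound.\<close>

lemma realizable_sum:
  fixes f :: "nat \<Rightarrow> nat"
  assumes "realizable f" "realizable g"
  shows "realizable (\<lambda>n. \<Sum>j\<le>g n. f j)"
proof -
  have *: "fold (\<lambda>j acc. acc + f j) xs b = b + sum_list (map f xs)" for xs b
    by (induction xs arbitrary: b) (auto simp: add.assoc)
  have "realizable (\<lambda>p. snd (snd p) + f (fst (snd p)))"
  proof -
    have 1: "realizable (\<lambda>p. (snd (snd p), f (fst (snd p))))"
      by (intro realizable_Pair realizable_comp[OF assms(1)] ptime_realizable ptime_intros)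
    have "realizable (\<lambda>p. fst p + (snd p :: nat))" by (intro ptime_realizable ptime_intros)
    from realizable_comp[OF this 1] show ?thesis by simp
  qed
  moreover have "realizable (\<lambda>n. [0..<Suc (g n)])"
    by (rule realizable_comp[OF _ assms(2)]) (intro ptime_realizable ptime_intros)
  ultimately have "realizable (\<lambda>n. fold (\<lambda>j acc. acc + f j) [0..<Suc (g n)] 0)"
    by (intro realizable_fold) (auto intro: ptime_realizable ptime_intros)
  then show ?thesis by (simp add: * interv_sum_list_conv_sum_set_nat atLeast0LessThan lessThan_Suc_atMost del: upt_Suc)
qed

text \<open>
  The size of a tree may double in one step. The largest number of right branches on a path
  grows by a constant only, and it bounds the length of words.
\<close>

primrec spine :: "data \<Rightarrow> nat" where
  "spine Atom = 0"
| "spine (Cell a b) = max (spine a) (Suc (spine b))"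

lemma spine_word: "length w \<le> spine (data_of_word w)" "spine (data_of_word w) \<le> Suc (length w)"
  by (induction w) auto

lemma spine_nat: "spine (data_of_nat n) = n"
  by (induction n) auto

lemma spine_hd: "spine (hd_data d) \<le> spine d" and spine_tl: "spine (tl_data d) \<le> spine d"
  by (cases d; simp)+

lemma spine_eval_exp:
  assumes "\<And>i. spine (s i) \<le> N"
  shows "spine (eval_exp a s) \<le> N + size a"
proof (induction a)
  case (Hd a)
  then show ?case using spine_hd[of "eval_exp a s"] by simp
next
  case (Tl a)
  then show ?case using spine_tl[of "eval_exp a s"] by simp
qed (use assms in auto)

text \<open>Only assigned expressions contribute, as tests do not change the store. The sum is a
  crude but uniform bound on the growth in one step.\<close>

primrec exp_sizes :: "com \<Rightarrow> nat" where
  "exp_sizes Skip = 0"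
| "exp_sizes (Assign x a) = size a"
| "exp_sizes (Seq c c') = exp_sizes c + exp_sizes c'"
| "exp_sizes (If a c c') = exp_sizes c + exp_sizes c'"
| "exp_sizes (While a c) = exp_sizes c"

lemma spine_exec:
  assumes "exec c s t s'" "exp_sizes c \<le> B" "\<And>i. spine (s i) \<le> N"
  shows "spine (s' i) \<le> N + B * t"
  using assms
proof (induction arbitrary: N i rule: exec.induct)
  case (Assign x a s)
  then show ?case using spine_eval_exp[of s N a] by (auto intro: trans_le_add1)
next
  case (Seq c\<^sub>1 s t\<^sub>1 s' c\<^sub>2 t\<^sub>2 s'')
  have "spine (s' j) \<le> N + B * t\<^sub>1" for j using Seq by auto
  from Seq.IH(2)[OF _ this, of i] Seq.prems show ?case by (simp add: algebra_simps)
next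
  case (WhileTrue a s c t\<^sub>1 s' t\<^sub>2 s'')
  have "spine (s' j) \<le> N + B * t\<^sub>1" for j using WhileTrue by auto
  from WhileTrue.IH(2)[OF _ this, of i] WhileTrue.prems show ?case by (simp add: algebra_simps)
next
  case (IfTrue a s c\<^sub>1 t s' c\<^sub>2)
  have "spine (s' i) \<le> N + B * t" using IfTrue.IH[of N i] IfTrue.prems by simp
  then show ?case by simp
next
  case (IfFalse a s c\<^sub>2 t s' c\<^sub>1)
  have "spine (s' i) \<le> N + B * t" using IfFalse.IH[of N i] IfFalse.prems by simp
  then show ?case by simp
qed (auto intro: trans_le_add1)

theorem fpt_reducible_trans:
  assumes "fpt_reducible A B" "fpt_reducible B C"
  shows "fpt_reducible A C"
proof -
  obtain c f g d where 1: "computable f" "computable g"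
    "\<And>x k. \<exists>x' k' t s. exec c (empty_store(0 := data_of_word x, 1 := data_of_nat k)) t s \<and>
       s 0 = data_of_word x' \<and> s 1 = data_of_nat k' \<and> t \<le> f k * (length x + 1) ^ d \<and> k' \<le> g k \<and>
       ((x, k) \<in> A \<longleftrightarrow> (x', k') \<in> B)"
    using assms(1) unfolding fpt_reducible_def by blast
  obtain c' f' g' d' where 2: "computable f'" "computable g'"
    "\<And>x k. \<exists>x' k' t s. exec c' (empty_store(0 := data_of_word x, 1 := data_of_nat k)) t s \<and>
       s 0 = data_of_word x' \<and> s 1 = data_of_nat k' \<and> t \<le> f' k * (length x + 1) ^ d' \<and> k' \<le> g' k \<and>
       ((x, k) \<in> B \<longleftrightarrow> (x', k') \<in> C)"
    using assms(2) unfolding fpt_reducible_def by blast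
  note real = 1(1,2)[unfolded computable_iff_realizable] 2(1,2)[unfolded computable_iff_realizable]
  define m where "m = bound_com c"
  define b where "b = exp_sizes c"
  define S where "S k = (\<Sum>j\<le>g k. f' j)" for k
  define G where "G k = (\<Sum>j\<le>g k. g' j)" for k
  \<comment> \<open>With \<open>N = length x + 1\<close>, the growth of spines gives
    \<open>length x1 + 1 \<le> (k + 2 + b * f k) * N ^ (d + 1)\<close> for the intermediate word,
    and the second running time raises this to the power \<open>d'\<close>. The exponent
    \<open>e\<close> dominates both \<open>d\<close> and \<open>(d + 1) * d'\<close>.\<close>
  define F where "F k = f k + Suc m + S k * (k + 2 + b * f k) ^ d'" for k
  define e where "e = d + (d + 1) * d'"
  \<comment> \<open>The second program needs every register other than 0 and 1 cleared. Registers
    from \<open>bound_com c\<close> on were never written by the first, so clearing \<open>m\<close>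
    of them is enough.\<close>
  define p where "p = Seq c (Seq (clear_regs 2 m) c')"
  have S: "realizable S" unfolding S_def by (rule realizable_sum[OF real(3,2)])
  have G: "realizable G" unfolding G_def by (rule realizable_sum[OF real(4,2)])
  have "realizable F"
  proof -
    have "realizable (\<lambda>k. (k, f k, S k))"
      by (intro realizable_Pair real S ptime_realizable ptime_intros)
    moreover have "realizable (\<lambda>q::nat \<times> nat \<times> nat. fst (snd q) + Suc m + snd (snd q) * (fst q + 2 + b * fst (snd q)) ^ d')"
      by (intro ptime_realizable ptime_intros)
    ultimately show ?thesis unfolding F_def using realizable_comp[where f = "\<lambda>k. (k, f k, S k)"] by fastforce
  qed
  moreover have "\<exists>x' k' t s. exec p (empty_store(0 := data_of_word x, 1 := data_of_nat k)) t s \<and>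
       s 0 = data_of_word x' \<and> s 1 = data_of_nat k' \<and> t \<le> F k * (length x + 1) ^ e \<and> k' \<le> G k \<and>
       ((x, k) \<in> A \<longleftrightarrow> (x', k') \<in> C)" for x k
  proof -
    let ?s = "empty_store(0 := data_of_word x, 1 := data_of_nat k)"
    obtain x1 k1 t1 s1 where s1: "exec c ?s t1 s1" "s1 0 = data_of_word x1" "s1 1 = data_of_nat k1"
      "t1 \<le> f k * (length x + 1) ^ d" "k1 \<le> g k" "(x, k) \<in> A \<longleftrightarrow> (x1, k1) \<in> B"
      using 1(3) by blast
    obtain x2 k2 t2 s2 where s2: "exec c' (empty_store(0 := data_of_word x1, 1 := data_of_nat k1)) t2 s2"
      "s2 0 = data_of_word x2" "s2 1 = data_of_nat k2" "t2 \<le> f' k1 * (length x1 + 1) ^ d'" "k2 \<le> g' k1"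
      "(x1, k1) \<in> B \<longleftrightarrow> (x2, k2) \<in> C"
      using 2(3) by blast
    have "(\<lambda>i. if 2 \<le> i \<and> i < 2 + m then Atom else s1 i) = empty_store(0 := data_of_word x1, 1 := data_of_nat k1)"
    proof
      fix i
      consider "i = 0" | "i = 1" | "2 \<le> i" "i < 2 + m" | "2 + m \<le> i" by linarith
      then show "(if 2 \<le> i \<and> i < 2 + m then Atom else s1 i) = (empty_store(0 := data_of_word x1, 1 := data_of_nat k1)) i"
      proof cases
        case 4
        then have "s1 i = ?s i" by (intro exec_unchanged[OF s1(1)]) (simp add: m_def)
        then show ?thesis using 4 by (simp add: empty_store_def)
      qed (use s1 in \<open>simp_all add: empty_store_def\<close>)
    qed
    then have "exec (clear_regs 2 m) s1 (Suc m) (empty_store(0 := data_of_word x1, 1 := data_of_nat k1))"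
      using exec_clear_regs[of 2 m s1] by simp
    from exec.Seq[OF s1(1) exec.Seq[OF this s2(1)]] have ex: "exec p ?s (t1 + (Suc m + t2)) s2"
      unfolding p_def .
    define N where "N = length x + 1"
    have N: "N \<ge> 1" "N ^ j \<ge> 1" for j by (simp_all add: N_def)
    have "spine (?s i) \<le> N + k" for i
      using spine_word(2)[of x] spine_nat[of k] by (auto simp: N_def empty_store_def)
    from spine_exec[OF s1(1) _ this, of b 0] have "length x1 \<le> N + k + b * t1"
      using spine_word(1)[of x1] s1(2) by (simp add: b_def)
    also have "\<dots> \<le> N + k + b * (f k * N ^ d)" using s1(4) by (simp add: N_def)
    finally have "length x1 + 1 \<le> N + k + 1 + b * f k * N ^ d" by simp
    also have "\<dots> \<le> (k + 2 + b * f k) * N ^ (d + 1)"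
    proof -
      have "N \<le> N ^ (d + 1)" "N ^ d \<le> N ^ (d + 1)" using N self_le_power[of N "d + 1"] by auto
      moreover from this have "k + 1 \<le> (k + 1) * N ^ (d + 1)" "b * f k * N ^ d \<le> b * f k * N ^ (d + 1)"
        using mult_le_mono2[OF N(2)[of "d + 1"], of "k + 1"] by (simp, simp add: mult_le_mono2)
      moreover have "(k + 2 + b * f k) * N ^ (d + 1) = N ^ (d + 1) + (k + 1) * N ^ (d + 1) + b * f k * N ^ (d + 1)"
        by (simp add: algebra_simps)
      ultimately show ?thesis by linarith
    qed
    finally have "(length x1 + 1) ^ d' \<le> ((k + 2 + b * f k) * N ^ (d + 1)) ^ d'"
      by (rule power_mono) simp
    then have "(length x1 + 1) ^ d' \<le> (k + 2 + b * f k) ^ d' * N ^ ((d + 1) * d')"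
      by (simp only: power_mult_distrib power_mult)
    moreover have "f' k1 \<le> S k" "g' k1 \<le> G k"
      using s1(5) member_le_sum[of k1 "{..g k}" f'] member_le_sum[of k1 "{..g k}" g']
      by (auto simp: S_def G_def)
    ultimately have t2: "t2 \<le> (S k * (k + 2 + b * f k) ^ d') * N ^ ((d + 1) * d')" and k2: "k2 \<le> G k"
      using order_trans[OF s2(4) mult_le_mono[of "f' k1" "S k" "(length x1 + 1) ^ d'"]] s2(5)
      by (simp_all only: mult.assoc order_trans)
    have t1: "t1 \<le> f k * N ^ d" using s1(4) by (simp add: N_def)
    have e: "N ^ d \<le> N ^ e" "N ^ ((d + 1) * d') \<le> N ^ e" "1 \<le> N ^ e"
      using N(1) unfolding e_def by (auto intro: power_increasing)
    have "t1 \<le> f k * N ^ e" by (rule order_trans[OF t1 mult_le_mono2[OF e(1)]])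
    moreover have "Suc m \<le> Suc m * N ^ e" using mult_le_mono2[OF e(3), of "Suc m"] by simp
    moreover have "t2 \<le> (S k * (k + 2 + b * f k) ^ d') * N ^ e"
      by (rule order_trans[OF t2 mult_le_mono2[OF e(2)]])
    ultimately have "t1 + (Suc m + t2) \<le> F k * N ^ e"
      unfolding F_def add_mult_distrib by linarith
    then show ?thesis using ex s1 s2 k2 unfolding N_def by blast
  qed
  ultimately show ?thesis unfolding fpt_reducible_def computable_iff_realizable using G by blast
qed

lemma fpt_reducible_ptime:
  fixes R :: "bool list \<times> nat \<Rightarrow> bool list \<times> nat"
  assumes R: "ptime R" and g: "ptime g" "\<And>x k. snd (R (x, k)) \<le> g k"
    and iff: "\<And>x k. (x, k) \<in> A \<longleftrightarrow> R (x, k) \<in> B"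
  shows "fpt_reducible A B"
proof -
  obtain c m T where c: "realizes c m R T" "pbound T" using R unfolding ptime_def by blast
  obtain e where e: "\<And>x. T x \<le> (sz x + 2) ^ e" using c(2) unfolding pbound_def by blast
  define p where "p = Seq (Assign 0 (exp.Cons (Var 0) (Var 1))) (Seq (Assign 1 Quote_Atom)
    (Seq c (Seq (Assign 1 (Tl (Var 0))) (Assign 0 (Hd (Var 0))))))"
  \<comment> \<open>The joint size of word and parameter, plus 2, is at most
    \<open>(k + 4) * (length x + 1)\<close>, and a power of this product splits into a factor for
    \<open>k\<close> and one for \<open>x\<close>. The summand \<open>k + 4\<close> pays for the
    four assignments that pack and unpack the registers.\<close>
  define f where "f k = (k + 4) + (k + 4) ^ e" for k :: nat
  have "ptime f" unfolding f_def by (intro ptime_intros)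
  moreover have "\<exists>x' k' t s. exec p (empty_store(0 := data_of_word x, 1 := data_of_nat k)) t s \<and>
       s 0 = data_of_word x' \<and> s 1 = data_of_nat k' \<and> t \<le> f k * (length x + 1) ^ e \<and> k' \<le> g k \<and>
       ((x, k) \<in> A \<longleftrightarrow> (x', k') \<in> B)" for x k
  proof -
    obtain x' k' where R': "R (x, k) = (x', k')" by (cases "R (x, k)")
    let ?s = "empty_store(0 := data_of_word x, 1 := data_of_nat k)"
    have r: "repr (x, k) = Cell (data_of_word x) (data_of_nat k)"
      by (simp add: repr_prod_def repr_word repr_nat_def)
    have r': "repr (x', k') = Cell (data_of_word x') (data_of_nat k')"
      by (simp add: repr_prod_def repr_word repr_nat_def)
    define s1 where "s1 = ?s(0 := repr (x, k))"
    define s2 where "s2 = s1(1 := Atom)"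
    define s3 where "s3 = s2(0 := repr (x', k'))"
    define s4 where "s4 = s3(1 := data_of_nat k')"
    define s5 where "s5 = s4(0 := data_of_word x')"
    note S = s1_def s2_def s3_def s4_def s5_def
    have "runs c s2 (T (x, k)) s3"
      unfolding s3_def R'[symmetric] by (rule realizesD[OF c(1)]) (auto simp: S empty_store_def)
    then have "runs p ?s (T (x, k) + 4) s5"
      unfolding p_def
      apply -
      apply (rule runs_Seq[where T\<^sub>1 = 1 and s' = s1])
        apply (rule runs_Assign; simp add: S r)
       apply (rule runs_Seq[where T\<^sub>1 = 1 and s' = s2])
         apply (rule runs_Assign; simp add: S)
        apply (rule runs_Seq, assumption)
         apply (rule runs_Seq[where T\<^sub>1 = 1 and T\<^sub>2 = 1 and s' = s4 and T = 2])
           apply (rule runs_Assign; simp add: S r')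
          apply (rule runs_Assign; simp add: S r')
         apply (rule order_refl | simp)+
      done
    then obtain t where t: "t \<le> T (x, k) + 4" "exec p ?s t s5" unfolding runs_def by blast
    have "sz x \<le> length x * Suc 1" by (rule sz_list_le) (rule sz_bool_le)
    then have "sz (x, k) + 2 \<le> (k + 4) * (length x + 1)" by (simp add: algebra_simps)
    then have "T (x, k) \<le> (k + 4) ^ e * (length x + 1) ^ e"
      using e[of "(x, k)"] power_mono[of "sz (x, k) + 2" _ e] order_trans
      by (fastforce simp only: power_mult_distrib)
    moreover have "4 \<le> (k + 4) * (length x + 1) ^ e"
      using mult_le_mono[of 4 "k + 4" 1 "(length x + 1) ^ e"] by simp
    ultimately have "t \<le> f k * (length x + 1) ^ e"
      using t(1) unfolding f_def add_mult_distrib by linarith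
    moreover have "s5 0 = data_of_word x'" "s5 1 = data_of_nat k'" by (auto simp: S)
    moreover have "k' \<le> g k" using g(2)[of x k] R' by simp
    moreover have "(x, k) \<in> A \<longleftrightarrow> (x', k') \<in> B" using iff[of x k] R' by simp
    ultimately show ?thesis using t(2) by blast
  qed
  ultimately show ?thesis unfolding fpt_reducible_def using ptime_computable g(1) by blast
qed


section \<open>Circuits of weft 1\<close>

text \<open>Pairs and lists already have representations as trees, which \<open>gate\<close> lacks.
  The tags are those used by \<open>enc_gate\<close>.\<close>

fun gate_pair :: "gate \<Rightarrow> nat \<times> nat list" where
  "gate_pair Input = (0, [])"
| "gate_pair (Neg i) = (1, [i])"
| "gate_pair (Conj js) = (2, js)"
| "gate_pair (Disj js) = (3, js)"

type_synonym pcircuit = "(nat \<times> nat list) list"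

definition tag :: "pcircuit \<Rightarrow> nat \<Rightarrow> nat" where
  "tag L j = fst (nth_or (0, []) L j)"

definition args :: "pcircuit \<Rightarrow> nat \<Rightarrow> nat list" where
  "args L j = snd (nth_or (0, []) L j)"

text \<open>A true conjunction and a false disjunction are dual, and this predicate lets one proof
  treat both. A negation counts as existential; with a single argument the two readings
  agree.\<close>

definition universal :: "pcircuit \<Rightarrow> nat \<Rightarrow> bool \<Rightarrow> bool" where
  "universal L j b \<longleftrightarrow> tag L j = 2 \<and> b \<or> tag L j = 3 \<and> \<not> b"

definition arg_value :: "pcircuit \<Rightarrow> nat \<Rightarrow> bool \<Rightarrow> bool" where
  "arg_value L j b = (b \<noteq> (tag L j = 1))"

text \<open>
  Gate \<open>j\<close> has value \<open>b\<close> iff all arguments (if \<open>universal L j b\<close>) respectively some argument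
  (otherwise) have value \<open>arg_value L j b\<close>.
\<close>

definition pvaluation :: "pcircuit \<Rightarrow> (nat \<Rightarrow> bool) \<Rightarrow> bool" where
  "pvaluation L v \<longleftrightarrow> (\<forall>j<length L. tag L j \<noteq> 0 \<longrightarrow> (\<forall>b. (v j = b) \<longleftrightarrow>
     (if universal L j b then \<forall>i\<in>set (args L j). v i = arg_value L j b
      else \<exists>i\<in>set (args L j). v i = arg_value L j b)))"

definition pgate_ok :: "nat \<times> nat list \<Rightarrow> bool" where
  "pgate_ok g \<longleftrightarrow> fst g = 0 \<and> snd g = [] \<or> fst g = 1 \<and> length (snd g) = 1 \<or>
     (fst g = 2 \<or> fst g = 3) \<and> distinct (snd g) \<and> 2 \<le> length (snd g)"

definition pwf :: "pcircuit \<Rightarrow> bool" where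
  "pwf L \<longleftrightarrow> L \<noteq> [] \<and>
     (\<forall>i\<in>set [0..<length L]. pgate_ok (nth_or (0, []) L i) \<and> (\<forall>j\<in>set (args L i). j < i))"

text \<open>\<open>small\<close> and \<open>weft1\<close> replace the quantification over all paths
  by a recursion that can be executed: depth at most \<open>e\<close>, with no large gate on any
  path, respectively at most one.\<close>

primrec small :: "pcircuit \<Rightarrow> nat \<Rightarrow> nat \<Rightarrow> bool" where
  "small L 0 j \<longleftrightarrow> args L j = []"
| "small L (Suc e) j \<longleftrightarrow> length (args L j) \<le> 2 \<and> (\<forall>i\<in>set (args L j). small L e i)"

primrec weft1 :: "pcircuit \<Rightarrow> nat \<Rightarrow> nat \<Rightarrow> bool" where
  "weft1 L 0 j \<longleftrightarrow> args L j = []"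
| "weft1 L (Suc e) j \<longleftrightarrow>
    (if length (args L j) \<le> 2 then \<forall>i\<in>set (args L j). weft1 L e i
     else \<forall>i\<in>set (args L j). small L e i)"

text \<open>
  Large universal gates need no justification here; the vertices of the conflict graph test them.
\<close>

definition justified :: "pcircuit \<Rightarrow> (nat \<times> bool) list \<Rightarrow> nat \<Rightarrow> bool \<Rightarrow> bool" where
  "justified L \<sigma> j b \<longleftrightarrow> tag L j = 0 \<or>
     (if universal L j b then length (args L j) \<le> 2 \<longrightarrow> (\<forall>i\<in>set (args L j). (i, arg_value L j b) \<in> set \<sigma>)
      else \<exists>i\<in>set (args L j). (i, arg_value L j b) \<in> set \<sigma>)"

text \<open>
  A pair \<open>(l, a)\<close> says that the \<open>l\<close>-th true input is \<open>a - 1\<close>; position 0 is a sentinel, whence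
  the shift. \<open>located \<alpha> j b\<close>: such pairs show that the input \<open>j\<close> has value \<open>b\<close>.
\<close>

definition located :: "(nat \<times> nat) list \<Rightarrow> nat \<Rightarrow> bool \<Rightarrow> bool" where
  "located \<alpha> j b \<longleftrightarrow> (if b then \<exists>q\<in>set \<alpha>. snd q = Suc j
     else \<exists>q\<in>set \<alpha>. \<exists>r\<in>set \<alpha>. fst r = Suc (fst q) \<and> snd q < Suc j \<and> Suc j < snd r)"

text \<open>Three-valued evaluation: \<open>j\<close> has value \<open>b\<close> whatever the inputs not located by \<open>\<alpha>\<close> are.\<close>

primrec known :: "pcircuit \<Rightarrow> nat \<Rightarrow> (nat \<times> nat) list \<Rightarrow> nat \<Rightarrow> bool \<Rightarrow> bool" where
  "known L 0 \<alpha> j b \<longleftrightarrow> tag L j = 0 \<and> located \<alpha> j b"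
| "known L (Suc e) \<alpha> j b \<longleftrightarrow>
    (if tag L j = 0 then located \<alpha> j b
     else if universal L j b then \<forall>i\<in>set (args L j). known L e \<alpha> i (arg_value L j b)
     else \<exists>i\<in>set (args L j). known L e \<alpha> i (arg_value L j b))"

text \<open>The lists are read as fragments of one strictly increasing sequence. Order is compared
  in one direction only; the other direction is covered because the graph tests each pair of
  vertices both ways.\<close>

definition consistent :: "(nat \<times> nat) list \<Rightarrow> (nat \<times> nat) list \<Rightarrow> bool" where
  "consistent \<alpha> \<beta> \<longleftrightarrow> (\<forall>q\<in>set \<alpha>. \<forall>r\<in>set \<beta>.
     (fst q = fst r \<longrightarrow> snd q = snd r) \<and> (fst q < fst r \<longrightarrow> snd q < snd r))"

definition slot :: "pcircuit \<Rightarrow> nat \<Rightarrow> nat \<Rightarrow> nat \<Rightarrow> bool" where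
  "slot L \<kappa> l a \<longleftrightarrow> (if l = 0 then a = 0 else if l = Suc \<kappa> then a = Suc (length L)
     else 0 < a \<and> a \<le> length L \<and> tag L (a - 1) = 0)"

type_synonym vertex = "(nat \<times> bool) list \<times> (nat \<times> nat) list"

definition good :: "pcircuit \<Rightarrow> nat \<Rightarrow> nat \<Rightarrow> vertex \<Rightarrow> bool" where
  "good L d \<kappa> x \<longleftrightarrow> (length L - 1, True) \<in> set (fst x) \<and>
     (\<forall>q\<in>set (fst x). justified L (fst x) (fst q) (snd q) \<and> \<not> known L d (snd x) (fst q) (\<not> snd q)) \<and>
     consistent (snd x) (snd x) \<and> (\<forall>q\<in>set (snd x). slot L \<kappa> (fst q) (snd q))"

definition literals :: "pcircuit \<Rightarrow> (nat \<times> bool) list" where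
  "literals L = concat (map (\<lambda>j. [(j, True), (j, False)]) [0..<length L])"

definition positions :: "pcircuit \<Rightarrow> nat \<Rightarrow> (nat \<times> nat) list" where
  "positions L \<kappa> = concat (map (\<lambda>l. map (\<lambda>a. (l, a)) [0..<length L + 2]) [0..<\<kappa> + 2])"

text \<open>Lists of exactly \<open>2 ^ (d + 1)\<close> entries stand for sets of at most that size,
  since entries may repeat. Thus all certificates and all index tuples have one fixed
  length.\<close>

definition vertices :: "pcircuit \<Rightarrow> nat \<Rightarrow> nat \<Rightarrow> vertex list" where
  "vertices L d \<kappa> = filter (good L d \<kappa>) (concat (map (\<lambda>\<sigma>.
     map (\<lambda>\<alpha>. (\<sigma>, \<alpha>)) (List.n_lists (2 ^ (d + 1)) (positions L \<kappa>)))
     (List.n_lists (2 ^ (d + 1)) (literals L))))"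

definition key :: "vertex \<Rightarrow> nat list" where
  "key x = map fst (snd x)"

text \<open>Equality of first components makes a selection agree on one certificate. A vertex with
  empty certificate is compatible with nothing; such vertices are kept for the additional
  colors.\<close>

definition compatible :: "vertex \<Rightarrow> vertex \<Rightarrow> bool" where
  "compatible x y \<longleftrightarrow> fst x \<noteq> [] \<and> fst x = fst y \<and> consistent (snd x) (snd y)"

definition tuples :: "nat \<Rightarrow> nat \<Rightarrow> nat list list" where
  "tuples d \<kappa> = List.n_lists (2 ^ (d + 1)) [0..<\<kappa> + 2]"

lemma set_vertices: "set (vertices L d \<kappa>) = {(\<sigma>, \<alpha>). good L d \<kappa> (\<sigma>, \<alpha>) \<and>
    length \<sigma> = 2 ^ (d + 1) \<and> (\<forall>q\<in>set \<sigma>. fst q < length L) \<and>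
    length \<alpha> = 2 ^ (d + 1) \<and> (\<forall>q\<in>set \<alpha>. fst q < \<kappa> + 2 \<and> snd q < length L + 2)}"
proof -
  have "set (literals L) = {q. fst q < length L}"
    by (auto simp: literals_def; case_tac b; simp)
  moreover have "set (positions L \<kappa>) = {q. fst q < \<kappa> + 2 \<and> snd q < length L + 2}"
    by (auto simp: positions_def image_iff simp del: upt_Suc)
  ultimately show ?thesis
    by (auto simp: vertices_def set_n_lists image_iff subset_iff simp del: upt_Suc) force+
qed

lemma set_tuples: "set (tuples d \<kappa>) = {\<tau>. length \<tau> = 2 ^ (d + 1) \<and> (\<forall>l\<in>set \<tau>. l < \<kappa> + 2)}"
  by (auto simp: tuples_def set_n_lists simp del: upt_Suc)

lemma small_weft1: "small L e j \<Longrightarrow> weft1 L e j"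
  by (induction e arbitrary: j) auto

lemma justified_mono: "justified L \<sigma> j b \<Longrightarrow> set \<sigma> \<subseteq> set \<sigma>' \<Longrightarrow> justified L \<sigma>' j b"
  unfolding justified_def by (auto split: if_splits)

section \<open>Certificates and three-valued evaluation\<close>

locale weft1_circuit =
  fixes L :: pcircuit and d :: nat
  assumes wf: "pwf L" and weft: "weft1 L d (length L - 1)"
begin

lemma nonempty: "L \<noteq> []" "0 < length L"
  using wf by (auto simp: pwf_def)

lemma arg_less: "j < length L \<Longrightarrow> i \<in> set (args L j) \<Longrightarrow> i < j"
  using wf by (auto simp: pwf_def)

lemma tag_0_iff: "j < length L \<Longrightarrow> tag L j = 0 \<longleftrightarrow> args L j = []"
  using wf unfolding pwf_def pgate_ok_def tag_def args_def by fastforce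

lemma pvaluationD:
  "pvaluation L v \<Longrightarrow> j < length L \<Longrightarrow> tag L j \<noteq> 0 \<Longrightarrow> (v j = b) \<longleftrightarrow>
     (if universal L j b then \<forall>i\<in>set (args L j). v i = arg_value L j b
      else \<exists>i\<in>set (args L j). v i = arg_value L j b)"
  unfolding pvaluation_def by blast

text \<open>A universal gate with at most two arguments keeps all of them, an existential gate keeps
  one witness, and a large universal gate or an input is a leaf. A binary tree of depth
  \<open>e\<close> has at most 2 ^ (e + 1) - 1 nodes, whence the strict inequality.\<close>

lemma certificate_exists:
  assumes v: "pvaluation L v" and "weft1 L e j" "j < length L"
  shows "\<exists>\<sigma>. length \<sigma> < 2 ^ (e + 1) \<and> (j, v j) \<in> set \<sigma> \<and>
    (\<forall>q\<in>set \<sigma>. fst q < length L \<and> v (fst q) = snd q \<and> justified L \<sigma> (fst q) (snd q))"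
  using assms(2,3)
proof (induction e arbitrary: j)
  case 0
  then have "tag L j = 0" using tag_0_iff by simp
  then show ?case using 0 by (intro exI[of _ "[(j, v j)]"]) (auto simp: justified_def)
next
  case (Suc e)
  let ?ok = "\<lambda>\<sigma>. \<forall>q\<in>set \<sigma>. fst q < length L \<and> v (fst q) = snd q \<and> justified L \<sigma> (fst q) (snd q)"
  have sub: "\<exists>\<sigma>. length \<sigma> < 2 ^ (e + 1) \<and> (i, v i) \<in> set \<sigma> \<and> ?ok \<sigma>" if "i \<in> set (args L j)" for i
  proof (rule Suc.IH)
    show "weft1 L e i" using Suc.prems(1) that small_weft1 by (auto split: if_splits)
    show "i < length L" using arg_less[OF Suc.prems(2) that] Suc.prems(2) by simp
  qed
  consider "tag L j = 0 \<or> (universal L j (v j) \<and> length (args L j) > 2)"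
    | "tag L j \<noteq> 0" "universal L j (v j)" "length (args L j) \<le> 2" | "tag L j \<noteq> 0" "\<not> universal L j (v j)"
    by linarith
  then show ?case
  proof cases
    case 1
    have "length [(j, v j)] < 2 ^ (Suc e + 1)" using one_less_power[of "2::nat" "Suc e + 1"] by simp
    then show ?thesis using Suc.prems 1
      by (intro exI[of _ "[(j, v j)]"]) (auto simp: justified_def)
  next
    case 2
    have all: "\<forall>i\<in>set (args L j). v i = arg_value L j (v j)"
      using pvaluationD[OF v Suc.prems(2) 2(1), of "v j"] 2(2) by simp
    \<comment> \<open>Two certificates with fewer than 2 ^ (e + 1) entries each leave room for the
      entry of \<open>j\<close> itself.\<close>
    have "\<exists>\<tau>. length \<tau> < 2 ^ (e + 2) - 1 \<and> (\<forall>i\<in>set (args L j). (i, v i) \<in> set \<tau>) \<and> ?ok \<tau>"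
    proof -
      consider "args L j = []" | i where "args L j = [i]" | i i' where "args L j = [i, i']"
        using 2(3) by (cases "args L j" rule: remdups_adj.cases) auto
      then show ?thesis
      proof cases
        case 1
        then show ?thesis using one_less_power[of "2::nat" "e + 2"] by (intro exI[of _ "[]"]) simp
      next
        case (2 i)
        then obtain \<sigma> where "length \<sigma> < 2 ^ (e + 1)" "(i, v i) \<in> set \<sigma>" "?ok \<sigma>" using sub[of i] by auto
        then show ?thesis using 2 by (intro exI[of _ \<sigma>]) auto
      next
        case (3 i i')
        then obtain \<sigma> \<sigma>' where s: "length \<sigma> < 2 ^ (e + 1)" "(i, v i) \<in> set \<sigma>" "?ok \<sigma>"
          "length \<sigma>' < 2 ^ (e + 1)" "(i', v i') \<in> set \<sigma>'" "?ok \<sigma>'" using sub[of i] sub[of i'] by auto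
        have "?ok (\<sigma> @ \<sigma>')"
          using s(3,6) justified_mono[of L \<sigma> _ _ "\<sigma> @ \<sigma>'"] justified_mono[of L \<sigma>' _ _ "\<sigma> @ \<sigma>'"] by auto
        then show ?thesis using 3 s by (intro exI[of _ "\<sigma> @ \<sigma>'"]) auto
      qed
    qed
    then obtain \<tau> where \<tau>: "length \<tau> < 2 ^ (e + 2) - 1" "\<forall>i\<in>set (args L j). (i, v i) \<in> set \<tau>" "?ok \<tau>" by blast
    have "\<forall>q\<in>set \<tau>. justified L ((j, v j) # \<tau>) (fst q) (snd q)"
      using \<tau>(3) justified_mono set_subset_Cons by metis
    moreover have "justified L ((j, v j) # \<tau>) j (v j)"
      unfolding justified_def using \<tau>(2) all 2 by auto
    ultimately have "?ok ((j, v j) # \<tau>)" using \<tau>(3) Suc.prems(2) by auto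
    then show ?thesis using \<tau> by (intro exI[of _ "(j, v j) # \<tau>"]) auto
  next
    case 3
    obtain i where i: "i \<in> set (args L j)" "v i = arg_value L j (v j)"
      using pvaluationD[OF v Suc.prems(2) 3(1), of "v j"] 3(2) by auto
    from sub[OF i(1)] obtain \<sigma> where \<sigma>: "length \<sigma> < 2 ^ (e + 1)" "(i, v i) \<in> set \<sigma>" "?ok \<sigma>" by blast
    have "justified L ((j, v j) # \<sigma>) j (v j)"
      unfolding justified_def using i \<sigma>(2) 3 by auto
    moreover have "\<forall>q\<in>set \<sigma>. justified L ((j, v j) # \<sigma>) (fst q) (snd q)"
      using \<sigma>(3) justified_mono set_subset_Cons by metis
    ultimately have "?ok ((j, v j) # \<sigma>)" using \<sigma>(3) Suc.prems(2) by auto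
    then show ?thesis using \<sigma> by (intro exI[of _ "(j, v j) # \<sigma>"]) auto
  qed
qed

text \<open>The number \<open>e\<close> limits the recursion only: exhausting it loses knowledge but
  never produces a false claim, so it need not be related to the depth of the circuit.\<close>

lemma known_sound:
  assumes v: "pvaluation L v" and loc: "\<And>j b. j < length L \<Longrightarrow> tag L j = 0 \<Longrightarrow> located \<alpha> j b \<Longrightarrow> v j = b"
  shows "known L e \<alpha> j b \<Longrightarrow> j < length L \<Longrightarrow> v j = b"
proof (induction e arbitrary: j b)
  case 0
  then show ?case using loc by auto
next
  case (Suc e)
  have IH: "v i = c" if "known L e \<alpha> i c" "i \<in> set (args L j)" for i c
    using Suc.IH[OF that(1)] arg_less[OF Suc.prems(2) that(2)] Suc.prems(2) by simp
  show ?case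
  proof (cases "tag L j = 0")
    case True
    then show ?thesis using Suc.prems loc by simp
  next
    case False
    then show ?thesis unfolding pvaluationD[OF v Suc.prems(2) False]
      using Suc.prems(1) IH by (auto split: if_splits)
  qed
qed

lemma known_complete:
  assumes v: "pvaluation L v" and "small L e j" "j < length L"
  shows "\<exists>I. length I \<le> 2 ^ e \<and> (\<forall>i\<in>set I. i < length L \<and> tag L i = 0) \<and>
    (\<forall>\<alpha> f. (\<forall>i\<in>set I. located \<alpha> i (v i)) \<longrightarrow> e \<le> f \<longrightarrow> known L f \<alpha> j (v j))"
  using assms(2,3)
proof (induction e arbitrary: j)
  case 0
  then have "tag L j = 0" using tag_0_iff by simp
  moreover have "known L f \<alpha> j (v j)" if "located \<alpha> j (v j)" for \<alpha> f
    using \<open>tag L j = 0\<close> that by (cases f) auto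
  ultimately show ?case using 0 by (intro exI[of _ "[j]"]) auto
next
  case (Suc e)
  let ?P = "\<lambda>I i. (\<forall>i\<in>set I. i < length L \<and> tag L i = 0) \<and>
    (\<forall>\<alpha> f. (\<forall>i\<in>set I. located \<alpha> i (v i)) \<longrightarrow> e \<le> f \<longrightarrow> known L f \<alpha> i (v i))"
  have sub: "\<exists>I. length I \<le> 2 ^ e \<and> ?P I i" if "i \<in> set (args L j)" for i
    using Suc.IH[of i] Suc.prems that arg_less[OF Suc.prems(2) that] by auto
  show ?case
  proof (cases "tag L j = 0")
    case True
    have "known L f \<alpha> j (v j)" if "located \<alpha> j (v j)" for \<alpha> f
      using True that by (cases f) auto
    then show ?thesis using Suc.prems True by (intro exI[of _ "[j]"]) auto
  next
    case False
    have "\<exists>I. length I \<le> 2 ^ Suc e \<and> (\<forall>i\<in>set (args L j). ?P I i) \<and> (\<forall>i\<in>set I. i < length L \<and> tag L i = 0)"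
    proof -
      consider "args L j = []" | i where "args L j = [i]" | i i' where "args L j = [i, i']"
        using Suc.prems(1) by (cases "args L j" rule: remdups_adj.cases) auto
      then show ?thesis
      proof cases
        case 1
        then show ?thesis by (intro exI[of _ "[]"]) auto
      next
        case (2 i)
        then obtain I where "length I \<le> 2 ^ e" "?P I i" using sub[of i] by auto
        then show ?thesis using 2 by (intro exI[of _ I]) auto
      next
        case (3 i i')
        then obtain I I' where "length I \<le> 2 ^ e" "?P I i" "length I' \<le> 2 ^ e" "?P I' i'"
          using sub[of i] sub[of i'] by auto
        then show ?thesis using 3 by (intro exI[of _ "I @ I'"]) auto
      qed
    qed
    then obtain I where I: "length I \<le> 2 ^ Suc e" "\<forall>i\<in>set (args L j). ?P I i"
      "\<forall>i\<in>set I. i < length L \<and> tag L i = 0" by blast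
    have "known L f \<alpha> j (v j)" if loc: "\<forall>i\<in>set I. located \<alpha> i (v i)" and "Suc e \<le> f" for \<alpha> f
    proof -
      obtain f' where f: "f = Suc f'" "e \<le> f'" using \<open>Suc e \<le> f\<close> by (cases f) auto
      have k: "known L f' \<alpha> i (v i)" if "i \<in> set (args L j)" for i
        using I(2) that loc f(2) by blast
      show ?thesis
        using pvaluationD[OF v Suc.prems(2) False, of "v j"] k False unfolding f(1)
        by (auto split: if_splits) metis+
    qed
    then show ?thesis using I by blast
  qed
qed


text \<open>Every part receives the same certificate together with the entries of one global
  sequence at its own indices. Such a vertex refutes nothing, because the facts it shows are true of
  \<open>v\<close> and \<open>known\<close> is sound.\<close>

lemma solution_of_valuation:
  assumes v: "pvaluation L v" "v (length L - 1)" and card: "card {i. i < length L \<and> tag L i = 0 \<and> v i} = \<kappa>"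
  shows "\<exists>h. (\<forall>\<tau>\<in>set (tuples d \<kappa>). h \<tau> \<in> set (vertices L d \<kappa>) \<and> key (h \<tau>) = \<tau>) \<and>
    (\<forall>\<tau>\<in>set (tuples d \<kappa>). \<forall>\<tau>'\<in>set (tuples d \<kappa>). \<tau> \<noteq> \<tau>' \<longrightarrow> compatible (h \<tau>) (h \<tau>'))"
proof -
  define T where "T = {i. i < length L \<and> tag L i = 0 \<and> v i}"
  have "finite T" unfolding T_def by simp
  define xs where "xs = sorted_list_of_set T"
  have xs: "set xs = T" "length xs = \<kappa>" "sorted_wrt (<) xs"
    using \<open>finite T\<close> card unfolding xs_def T_def by (simp_all)
  define x where "x l = (if l = 0 then 0 else if l \<le> \<kappa> then Suc (xs ! (l - 1)) else Suc (length L))" for l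
  have xs_T: "xs ! i \<in> T" if "i < \<kappa>" for i using xs that by (metis nth_mem)
  have mono: "x l < x l'" if "l < l'" "l' < \<kappa> + 2" for l l'
  proof -
    have "xs ! (l - 1) < xs ! (l' - 1)" if "l \<noteq> 0" "l' \<le> \<kappa>"
      using sorted_wrt_nth_less[OF xs(3), of "l - 1" "l' - 1"] xs(2) that \<open>l < l'\<close> by simp
    moreover have "xs ! (l - 1) < length L" if "l \<noteq> 0" "l \<le> \<kappa>"
      using xs_T[of "l - 1"] that by (simp add: T_def)
    ultimately show ?thesis using that by (auto simp: x_def)
  qed
  have located: "v j = b" if j: "j < length L" "tag L j = 0" and loc: "located (map (\<lambda>l. (l, x l)) \<tau>) j b"
    and \<tau>: "\<forall>l\<in>set \<tau>. l < \<kappa> + 2" for \<tau> j b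
  proof (cases b)
    case True
    then obtain l where l: "l \<in> set \<tau>" "x l = Suc j" using loc by (auto simp: located_def)
    then have "l \<noteq> 0" "l \<le> \<kappa>" using j(1) by (auto simp: x_def split: if_splits)
    then have "j \<in> T" using xs_T[of "l - 1"] l(2) by (simp add: x_def)
    then show ?thesis using True by (simp add: T_def)
  next
    case False
    then obtain l where l: "l \<in> set \<tau>" "Suc l \<in> set \<tau>" "x l < Suc j" "Suc j < x (Suc l)"
      using loc by (auto simp: located_def)
    \<comment> \<open>A true \<open>j\<close> would be an entry of the sequence strictly between the
      consecutive positions \<open>l\<close> and \<open>Suc l\<close>, against monotonicity.\<close>
    have "\<not> v j"
    proof
      assume "v j"
      then have "j \<in> set xs" using j xs by (simp add: T_def)
      then obtain i where i: "i < \<kappa>" "xs ! i = j" using xs(2) by (metis in_set_conv_nth)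
      then have "x (Suc i) = Suc j" by (simp add: x_def)
      moreover have "Suc i \<le> l \<or> Suc l \<le> Suc i" by linarith
      ultimately show False
        using mono[of "Suc i" l] mono[of "Suc l" "Suc i"] l \<tau> i(1) by (cases "Suc i = l"; cases "i = l") auto
    qed
    then show ?thesis using False by simp
  qed
  obtain \<sigma>\<^sub>0 where \<sigma>\<^sub>0: "length \<sigma>\<^sub>0 < 2 ^ (d + 1)" "(length L - 1, True) \<in> set \<sigma>\<^sub>0"
    "\<forall>q\<in>set \<sigma>\<^sub>0. fst q < length L \<and> v (fst q) = snd q \<and> justified L \<sigma>\<^sub>0 (fst q) (snd q)"
    using certificate_exists[OF v(1) weft] nonempty v(2) by auto
  \<comment> \<open>Repeating the output literal brings the certificate to the fixed length without
    changing its set.\<close>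
  define \<sigma> where "\<sigma> = \<sigma>\<^sub>0 @ replicate (2 ^ (d + 1) - length \<sigma>\<^sub>0) (length L - 1, True)"
  have \<sigma>: "set \<sigma> = set \<sigma>\<^sub>0" "length \<sigma> = 2 ^ (d + 1)"
    using \<sigma>\<^sub>0(1,2) unfolding \<sigma>_def by auto
  have ok: "\<forall>q\<in>set \<sigma>. fst q < length L \<and> v (fst q) = snd q \<and> justified L \<sigma> (fst q) (snd q)"
    using \<sigma>\<^sub>0(3) justified_mono[of L \<sigma>\<^sub>0 _ _ \<sigma>] unfolding \<sigma>(1) by simp
  define h where "h \<tau> = (\<sigma>, map (\<lambda>l. (l, x l)) \<tau>)" for \<tau>
  have cons: "consistent (map (\<lambda>l. (l, x l)) \<tau>) (map (\<lambda>l. (l, x l)) \<tau>')"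
    if "\<forall>l\<in>set \<tau>'. l < \<kappa> + 2" for \<tau> \<tau>'
    using mono that by (auto simp: consistent_def)
  have "h \<tau> \<in> set (vertices L d \<kappa>)" if "\<tau> \<in> set (tuples d \<kappa>)" for \<tau>
  proof -
    have \<tau>: "length \<tau> = 2 ^ (d + 1)" "\<forall>l\<in>set \<tau>. l < \<kappa> + 2" using that by (auto simp: set_tuples)
    have slot: "slot L \<kappa> l (x l)" "x l < length L + 2" if "l < \<kappa> + 2" for l
      using xs_T[of "l - 1"] that by (cases "l - 1 < \<kappa>"; force simp: slot_def x_def T_def)+
    have "\<not> known L d (map (\<lambda>l. (l, x l)) \<tau>) (fst q) (\<not> snd q)" if "q \<in> set \<sigma>" for q
    proof
      assume *: "known L d (map (\<lambda>l. (l, x l)) \<tau>) (fst q) (\<not> snd q)"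
      have "v (fst q) = (\<not> snd q)"
        by (rule known_sound[OF v(1) _ *]) (use located \<tau>(2) ok that in auto)
      then show False using ok that by simp
    qed
    then have "good L d \<kappa> (h \<tau>)"
      using \<sigma>\<^sub>0(2) \<sigma>(1) ok cons[OF \<tau>(2)] \<tau>(2) slot(1) by (auto simp: good_def h_def)
    then show ?thesis
      using \<tau> slot(2) \<sigma>(2) ok by (auto simp: set_vertices h_def)
  qed
  moreover have "compatible (h \<tau>) (h \<tau>')" if "\<tau>' \<in> set (tuples d \<kappa>)" for \<tau> \<tau>'
    using cons[of \<tau>' \<tau>] \<sigma>(2) that by (auto simp: compatible_def h_def set_tuples)
  moreover have "key (h \<tau>) = \<tau>" for \<tau> by (simp add: key_def h_def comp_def)
  ultimately show ?thesis by blast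
qed

lemma pvaluation_exists: "\<exists>v. pvaluation L v \<and> (\<forall>i<length L. tag L i = 0 \<longrightarrow> (v i \<longleftrightarrow> i \<in> T))"
proof -
  have "\<exists>v. (\<forall>j<n. (tag L j = 0 \<longrightarrow> (v j \<longleftrightarrow> j \<in> T)) \<and> (tag L j \<noteq> 0 \<longrightarrow> (\<forall>b. (v j = b) \<longleftrightarrow>
     (if universal L j b then \<forall>i\<in>set (args L j). v i = arg_value L j b
      else \<exists>i\<in>set (args L j). v i = arg_value L j b))))" (is "\<exists>v. \<forall>j<n. ?P v j") if "n \<le> length L" for n
    using that
  proof (induction n)
    case (Suc n)
    then obtain v where v: "\<forall>j<n. (tag L j = 0 \<longrightarrow> (v j \<longleftrightarrow> j \<in> T)) \<and> (tag L j \<noteq> 0 \<longrightarrow> (\<forall>b. (v j = b) \<longleftrightarrow>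
     (if universal L j b then \<forall>i\<in>set (args L j). v i = arg_value L j b
      else \<exists>i\<in>set (args L j). v i = arg_value L j b)))" by auto
    define val where "val w b = (if universal L n b then \<forall>i\<in>set (args L n). w i = arg_value L n b
      else \<exists>i\<in>set (args L n). w i = arg_value L n b)" for w b
    define v' where "v' = v(n := (if tag L n = 0 then n \<in> T else val v True))"
    have ne: "n \<notin> set (args L j)" if "j \<le> n" for j
      using arg_less[of j n] that Suc.prems by auto
    have eq: "v' i = v i" if "i \<in> set (args L j)" "j \<le> n" for i j
      using ne[OF that(2)] that(1) by (auto simp: v'_def)
    \<comment> \<open>The new gate must satisfy the condition for both truth values at once. For
      conjunction and disjunction this is De Morgan duality; for a negation it holds because there
      is exactly one argument.\<close>
    have dual: "val v False \<longleftrightarrow> \<not> val v True" if tag: "tag L n \<noteq> 0"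
    proof -
      have "n < length L" using Suc.prems by simp
      then have "pgate_ok (nth_or (0, []) L n)" using wf by (simp add: pwf_def)
      then consider "tag L n = 1" "length (args L n) = 1" | "tag L n = 2" | "tag L n = 3"
        using tag by (auto simp: pgate_ok_def tag_def args_def)
      then show ?thesis
      proof cases
        case 1
        then obtain i where "args L n = [i]" by (auto simp: length_Suc_conv)
        then show ?thesis using 1 by (simp add: val_def universal_def arg_value_def)
      qed (auto simp: val_def universal_def arg_value_def)
    qed
    have "(tag L j = 0 \<longrightarrow> (v' j \<longleftrightarrow> j \<in> T)) \<and> (tag L j \<noteq> 0 \<longrightarrow> (\<forall>b. (v' j = b) \<longleftrightarrow>
       (if universal L j b then \<forall>i\<in>set (args L j). v' i = arg_value L j b
        else \<exists>i\<in>set (args L j). v' i = arg_value L j b)))" if "j < Suc n" for j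
    proof (cases "j = n")
      case True
      have "(v' n = b) \<longleftrightarrow> val v' b" if "tag L n \<noteq> 0" for b
      proof -
        have "val v' b \<longleftrightarrow> val v b" using eq[OF _ order_refl] by (simp add: val_def)
        moreover have "v' n \<longleftrightarrow> val v True" using that by (simp add: v'_def)
        ultimately show ?thesis using dual[OF that] by (cases b) simp_all
      qed
      then show ?thesis unfolding True val_def by (simp add: v'_def)
    next
      case False
      then have "j < n" using that by simp
      then have "v' j = v j" by (simp add: v'_def)
      moreover have "v' i = v i" if "i \<in> set (args L j)" for i using eq[OF that] \<open>j < n\<close> by simp
      ultimately show ?thesis using v \<open>j < n\<close> by simp
    qed
    then show ?case by blast
  qed simp
  from this[OF order_refl] obtain v where v: "\<forall>j<length L. ?P v j" by (elim exE)
  then have "pvaluation L v" unfolding pvaluation_def by simp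
  then show ?thesis using v by (intro exI[of _ v]) simp
qed

text \<open>The constant tuples determine a sequence, the sequence a set of true inputs, and this
  set the valuation \<open>v\<close>. Going down the depth, every literal of the common certificate
  is true in \<open>v\<close>: small steps follow by justification. If a large universal gate had
  the wrong value, the inputs below one bad argument could be located by a single tuple, whose
  vertex would then refute the literal.\<close>

lemma valuation_of_solution:
  assumes h: "\<forall>\<tau>\<in>set (tuples d \<kappa>). h \<tau> \<in> set (vertices L d \<kappa>) \<and> key (h \<tau>) = \<tau>"
    and comp: "\<forall>\<tau>\<in>set (tuples d \<kappa>). \<forall>\<tau>'\<in>set (tuples d \<kappa>). \<tau> \<noteq> \<tau>' \<longrightarrow> compatible (h \<tau>) (h \<tau>')"
  shows "\<exists>v. pvaluation L v \<and> v (length L - 1) \<and> card {i. i < length L \<and> tag L i = 0 \<and> v i} = \<kappa>"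
proof -
  define R :: nat where "R = 2 ^ (d + 1)"
  have "R > 0" by (simp add: R_def)
  define \<alpha> where "\<alpha> \<tau> = snd (h \<tau>)" for \<tau>
  \<comment> \<open>Any part could supply the certificate; that of index 0 always exists, and all
    others must agree with it.\<close>
  define \<sigma> where "\<sigma> = fst (h (replicate R 0))"
  have good: "good L d \<kappa> (h \<tau>)" if "\<tau> \<in> set (tuples d \<kappa>)" for \<tau>
    using h that by (auto simp: set_vertices)
  have rep: "replicate R l \<in> set (tuples d \<kappa>)" if "l < \<kappa> + 2" for l
    using that by (auto simp: set_tuples R_def)
  have cons: "consistent (\<alpha> \<tau>) (\<alpha> \<tau>')" if "\<tau> \<in> set (tuples d \<kappa>)" "\<tau>' \<in> set (tuples d \<kappa>)" for \<tau> \<tau>'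
    using comp good that unfolding \<alpha>_def by (cases "\<tau> = \<tau>'") (auto simp: compatible_def good_def)
  have \<sigma>: "fst (h \<tau>) = \<sigma>" if "\<tau> \<in> set (tuples d \<kappa>)" for \<tau>
    using comp that rep[of 0] unfolding \<sigma>_def compatible_def by (metis trans_less_add2 zero_less_numeral)
  \<comment> \<open>The tuple repeating \<open>l\<close> speaks of position \<open>l\<close> alone,
    so its vertex fixes the entry there; consistency carries it to every other vertex.\<close>
  define x where "x l = snd (hd (\<alpha> (replicate R l)))" for l
  have hd_rep: "(l, x l) \<in> set (\<alpha> (replicate R l))" if "l < \<kappa> + 2" for l
  proof -
    have "map fst (\<alpha> (replicate R l)) = replicate R l" using h rep[OF that] by (simp add: \<alpha>_def key_def)
    then obtain a as where "\<alpha> (replicate R l) = (l, a) # as"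
      using \<open>R > 0\<close> by (cases "\<alpha> (replicate R l)"; cases R) auto
    then show ?thesis by (simp add: x_def)
  qed
  have \<alpha>: "\<alpha> \<tau> = map (\<lambda>l. (l, x l)) \<tau>" if "\<tau> \<in> set (tuples d \<kappa>)" for \<tau>
  proof -
    have m: "map fst (\<alpha> \<tau>) = \<tau>" using h that by (simp add: \<alpha>_def key_def)
    have "q = (fst q, x (fst q))" if "q \<in> set (\<alpha> \<tau>)" for q
    proof -
      have "fst q \<in> set \<tau>" using that m by (metis image_eqI list.set_map)
      then have "fst q < \<kappa> + 2" using \<open>\<tau> \<in> _\<close> by (auto simp: set_tuples)
      then have "snd q = x (fst q)"
        using cons[OF \<open>\<tau> \<in> _\<close> rep] hd_rep that unfolding consistent_def by fastforce
      then show ?thesis by (simp add: prod_eq_iff)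
    qed
    then have "map (\<lambda>q. (fst q, x (fst q))) (\<alpha> \<tau>) = \<alpha> \<tau>" by (simp add: map_idI)
    then show ?thesis using m by (metis (no_types, lifting) list.map_comp comp_def map_eq_conv)
  qed
  have mono: "x l < x l'" if "l < l'" "l' < \<kappa> + 2" for l l'
    using cons[OF rep rep, of l l'] hd_rep[of l] hd_rep[of l'] that unfolding consistent_def by fastforce
  have slot: "slot L \<kappa> l (x l)" if "l < \<kappa> + 2" for l
    using good[OF rep[OF that]] hd_rep[OF that] unfolding good_def \<alpha>_def by fastforce
  have x0: "x 0 = 0" and xn: "x (Suc \<kappa>) = Suc (length L)" using slot[of 0] slot[of "Suc \<kappa>"] by (auto simp: slot_def)
  define T where "T = (\<lambda>l. x l - 1) ` {1..\<kappa>}"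
  have x_pos: "0 < x l" "x l \<le> length L" "tag L (x l - 1) = 0" if "l \<in> {1..\<kappa>}" for l
    using slot[of l] that by (auto simp: slot_def)
  obtain v where v: "pvaluation L v" "\<forall>i<length L. tag L i = 0 \<longrightarrow> (v i \<longleftrightarrow> i \<in> T)"
    using pvaluation_exists by blast
  have "i < length L \<and> tag L i = 0" if i: "i \<in> T" for i
  proof -
    obtain l where l: "l \<in> {1..\<kappa>}" "i = x l - 1" using i by (auto simp: T_def)
    then show ?thesis using x_pos[OF l(1)] by auto
  qed
  then have "{i. i < length L \<and> tag L i = 0 \<and> v i} = T" using v(2) by blast
  moreover have "card T = \<kappa>"
  proof -
    have "inj_on (\<lambda>l. x l - 1) {1..\<kappa>}"
    proof (rule linorder_inj_onI)
      fix l l' assume "l < l'" "l \<in> {1..\<kappa>}" "l' \<in> {1..\<kappa>}"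
      then show "x l - 1 \<noteq> x l' - 1" using mono[of l l'] x_pos(1)[of l] by auto
    qed auto
    then show ?thesis by (simp add: T_def card_image)
  qed
  moreover have "v (length L - 1)"
  proof -
    \<comment> \<open>A true input is located by its own entry. A false one lies between the last
      entry below it and the next; the sentinels guarantee that both exist.\<close>
    have cover: "\<exists>l l'. l < \<kappa> + 2 \<and> l' < \<kappa> + 2 \<and> (\<forall>\<tau>. {l, l'} \<subseteq> set \<tau> \<longrightarrow> located (map (\<lambda>l. (l, x l)) \<tau>) j (v j))"
      if j: "j < length L" "tag L j = 0" for j
    proof (cases "v j")
      case True
      then obtain l where l: "l \<in> {1..\<kappa>}" "j = x l - 1" using v(2) j by (auto simp: T_def)
      then have "x l = Suc j" using x_pos(1)[of l] by simp
      then show ?thesis using l(1) True by (intro exI[of _ l]) (auto simp: located_def)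
    next
      case False
      define l where "l = Max {l. l < \<kappa> + 2 \<and> x l < Suc j}"
      have fin: "finite {l. l < \<kappa> + 2 \<and> x l < Suc j}" by simp
      have "0 \<in> {l. l < \<kappa> + 2 \<and> x l < Suc j}" using x0 by simp
      then have "l \<in> {l. l < \<kappa> + 2 \<and> x l < Suc j}" unfolding l_def using fin by (intro Max_in) auto
      then have l: "l < \<kappa> + 2" "x l < Suc j" by auto
      then have "l \<noteq> Suc \<kappa>" using xn j(1) by auto
      then have l': "Suc l < \<kappa> + 2" using l by simp
      have "\<not> x (Suc l) < Suc j"
      proof
        assume "x (Suc l) < Suc j"
        then have "Suc l \<le> l" unfolding l_def using l' by (intro Max_ge[OF fin]) (simp add: l_def)
        then show False by simp
      qed
      moreover have "x (Suc l) \<noteq> Suc j"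
      proof
        assume *: "x (Suc l) = Suc j"
        then have "Suc l \<noteq> Suc \<kappa>" using xn j(1) by auto
        then have "j \<in> T" using * l' by (auto simp: T_def image_iff intro!: bexI[of _ "Suc l"])
        then show False using False v(2) j by simp
      qed
      ultimately have "Suc j < x (Suc l)" by simp
      then show ?thesis using l l' False
        by (intro exI[of _ l] exI[of _ "Suc l"]) (auto simp: located_def image_iff)
    qed
    \<comment> \<open>Up to 2 ^ d inputs with two indices each fit into one tuple of length 2 ^ (d +
      1); index 0 fills the rest.\<close>
    have "\<exists>\<tau>\<in>set (tuples d \<kappa>). \<forall>i\<in>set I. located (\<alpha> \<tau>) i (v i)"
      if I: "length I \<le> 2 ^ d" "\<forall>i\<in>set I. i < length L \<and> tag L i = 0" for I
    proof -
      obtain l l' where l: "\<forall>j\<in>set I. l j < \<kappa> + 2 \<and> l' j < \<kappa> + 2 \<and>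
          (\<forall>\<tau>. {l j, l' j} \<subseteq> set \<tau> \<longrightarrow> located (map (\<lambda>l. (l, x l)) \<tau>) j (v j))"
        using cover I(2) by metis
      define \<tau> where "\<tau> = map l I @ map l' I @ replicate (R - 2 * length I) 0"
      have "length \<tau> = R" using I(1) by (simp add: \<tau>_def R_def)
      then have "\<tau> \<in> set (tuples d \<kappa>)" using l by (auto simp: set_tuples \<tau>_def R_def)
      moreover have "located (map (\<lambda>l. (l, x l)) \<tau>) j (v j)" if "j \<in> set I" for j
      proof -
        have "{l j, l' j} \<subseteq> set \<tau>" using that by (auto simp: \<tau>_def)
        then show ?thesis using l that by blast
      qed
      ultimately show ?thesis using \<alpha> by metis
    qed
    note covers = this
    have not_known: "\<not> known L d (\<alpha> \<tau>) j (\<not> b)" and just: "justified L \<sigma> j b"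
      if "\<tau> \<in> set (tuples d \<kappa>)" "(j, b) \<in> set \<sigma>" for \<tau> j b
      using good[OF that(1)] \<sigma>[OF that(1)] that(2) unfolding good_def \<alpha>_def by auto
    have certified: "v j = b" if "weft1 L e j" "e \<le> d" "j < length L" "(j, b) \<in> set \<sigma>" for e j b
      using that
    proof (induction e arbitrary: j b)
      case 0
      then have tag: "tag L j = 0" using tag_0_iff by simp
      then obtain \<tau> where \<tau>: "\<tau> \<in> set (tuples d \<kappa>)" "located (\<alpha> \<tau>) j (v j)" using covers[of "[j]"] 0 by auto
      have "known L d (\<alpha> \<tau>) j (v j)" using \<tau>(2) tag by (cases d) auto
      then show ?case using not_known[OF \<tau>(1) 0(4)] by (cases b; cases "v j") auto
    next
      case (Suc e)
      show ?case
      proof (cases "tag L j = 0")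
        case True
        then obtain \<tau> where \<tau>: "\<tau> \<in> set (tuples d \<kappa>)" "located (\<alpha> \<tau>) j (v j)" using covers[of "[j]"] Suc by auto
        have "known L d (\<alpha> \<tau>) j (v j)" using \<tau>(2) True by (cases d) auto
        then show ?thesis using not_known[OF \<tau>(1) Suc.prems(4)] by (cases b; cases "v j") auto
      next
        case False
        have IH: "v i = c" if "i \<in> set (args L j)" "(i, c) \<in> set \<sigma>" for i c
        proof (rule Suc.IH)
          show "weft1 L e i" using Suc.prems(1) that small_weft1 by (auto split: if_splits)
          show "i < length L" using arg_less[OF Suc.prems(3) that(1)] Suc.prems(3) by simp
        qed (use Suc.prems(2) that in auto)
        have "justified L \<sigma> j b" using just[OF rep[of 0] Suc.prems(4)] by simp
        then consider "universal L j b" "length (args L j) > 2"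
          | "universal L j b" "\<forall>i\<in>set (args L j). (i, arg_value L j b) \<in> set \<sigma>"
          | "\<not> universal L j b" "\<exists>i\<in>set (args L j). (i, arg_value L j b) \<in> set \<sigma>"
          using False unfolding justified_def by (auto split: if_splits)
        then show ?thesis
        proof cases
          case 1
          show ?thesis
          proof (rule ccontr)
            assume "v j \<noteq> b"
            then obtain i where i: "i \<in> set (args L j)" "v i \<noteq> arg_value L j b"
              using pvaluationD[OF v(1) Suc.prems(3) False, of b] 1(1) by auto
            have "small L e i" using Suc.prems(1) 1(2) i(1) by simp
            moreover have "i < length L" using arg_less[OF Suc.prems(3) i(1)] Suc.prems(3) by simp
            ultimately obtain I where I: "length I \<le> 2 ^ e" "\<forall>i\<in>set I. i < length L \<and> tag L i = 0"
              "\<And>\<alpha> f. (\<forall>i\<in>set I. located \<alpha> i (v i)) \<Longrightarrow> e \<le> f \<Longrightarrow> known L f \<alpha> i (v i)"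
              using known_complete[OF v(1), of e i] by blast
            have "length I \<le> 2 ^ d" using I(1) Suc.prems(2) power_increasing[of e d "2::nat"] by linarith
            from covers[OF this I(2)] obtain \<tau> where \<tau>: "\<tau> \<in> set (tuples d \<kappa>)"
              "\<forall>i\<in>set I. located (\<alpha> \<tau>) i (v i)" by blast
            obtain f where f: "d = Suc f" "e \<le> f" using Suc.prems(2) by (cases d) auto
            have "known L f (\<alpha> \<tau>) i (v i)" by (rule I(3)[OF \<tau>(2) f(2)])
            \<comment> \<open>If \<open>b\<close> needs all arguments, the opposite value needs only
              one, so the bad argument by itself makes \<open>\<not> b\<close> known.\<close>
            moreover have "\<not> universal L j (\<not> b)" "arg_value L j (\<not> b) = v i"
              using 1(1) i(2) by (auto simp: universal_def arg_value_def)
            ultimately have "known L d (\<alpha> \<tau>) j (\<not> b)" using False i(1) by (auto simp: f(1))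
            then show False using not_known[OF \<tau>(1) Suc.prems(4)] by simp
          qed
        next
          case 2
          then show ?thesis using pvaluationD[OF v(1) Suc.prems(3) False, of b] IH by simp
        next
          case 3
          then show ?thesis using pvaluationD[OF v(1) Suc.prems(3) False, of b] IH by auto
        qed
      qed
    qed
    have "(length L - 1, True) \<in> set \<sigma>" using good[OF rep[of 0]] \<sigma>[OF rep[of 0]] by (simp add: good_def)
    then show ?thesis using certified[OF weft order_refl] nonempty by auto
  qed
  ultimately show ?thesis using v(1) by blast
qed

end


section \<open>Circuits and their list form\<close>

lemma snd_gate_pair: "snd (gate_pair g) = preds g"
  by (cases g) auto

lemma gate_pair_ok: "pgate_ok (gate_pair g) \<longleftrightarrow> gate_ok g"
  by (cases g) (auto simp: pgate_ok_def)

lemma pgate_ok_gate_pair: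
  assumes "pgate_ok p"
  shows "\<exists>g. p = gate_pair g"
proof -
  obtain t js where p: "p = (t, js)" by (cases p)
  consider "t = 0" "js = []" | "t = 1" "length js = 1" | "t = 2" | "t = 3"
    using assms by (auto simp: p pgate_ok_def)
  then show ?thesis
  proof cases
    case 1
    then show ?thesis by (intro exI[of _ Input]) (simp add: p)
  next
    case 2
    then obtain i where "js = [i]" by (auto simp: length_Suc_conv)
    then show ?thesis using 2 by (intro exI[of _ "Neg i"]) (simp add: p)
  next
    case 3
    then show ?thesis by (intro exI[of _ "Conj js"]) (simp add: p)
  next
    case 4
    then show ?thesis by (intro exI[of _ "Disj js"]) (simp add: p)
  qed
qed

context
  fixes C :: circuit and L :: pcircuit
  assumes L: "L = map gate_pair C"
begin

lemma nth_pcircuit: "j < length C \<Longrightarrow> nth_or (0, []) L j = gate_pair (C ! j)"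
  by (simp add: L nth_or_eq)

lemma tag_pcircuit: "j < length C \<Longrightarrow> tag L j = fst (gate_pair (C ! j))"
  by (simp add: tag_def nth_pcircuit)

lemma args_pcircuit: "j < length C \<Longrightarrow> args L j = preds (C ! j)"
  by (simp add: args_def nth_pcircuit snd_gate_pair)

lemma length_pcircuit: "length L = length C"
  by (simp add: L)

lemma pwf_iff: "pwf L \<longleftrightarrow> wf_circuit C"
proof -
  have "L \<noteq> [] \<longleftrightarrow> C \<noteq> []" by (simp add: L)
  then show ?thesis
    by (auto simp: pwf_def wf_circuit_def length_pcircuit nth_pcircuit args_pcircuit gate_pair_ok)
qed

lemma pvaluation_iff:
  assumes "wf_circuit C"
  shows "pvaluation L v \<longleftrightarrow> valuation C v"
proof -
  have "(tag L j \<noteq> 0 \<longrightarrow> (\<forall>b. (v j = b) \<longleftrightarrow>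
     (if universal L j b then \<forall>i\<in>set (args L j). v i = arg_value L j b
      else \<exists>i\<in>set (args L j). v i = arg_value L j b))) \<longleftrightarrow> v j = gate_value (C ! j) v (v j)"
    if "j < length C" for j
  proof (cases "C ! j")
    case Input
    then show ?thesis using that by (simp add: tag_pcircuit)
  next
    case (Neg i)
    then show ?thesis using that
      by (simp add: tag_pcircuit args_pcircuit universal_def arg_value_def) blast
  next
    case (Conj js)
    then show ?thesis using that
      by (simp add: tag_pcircuit args_pcircuit universal_def arg_value_def all_bool_eq) blast
  next
    case (Disj js)
    then show ?thesis using that
      by (simp add: tag_pcircuit args_pcircuit universal_def arg_value_def all_bool_eq) blast
  qed
  then show ?thesis
    unfolding pvaluation_def valuation_def length_pcircuit by (intro all_cong1 imp_cong refl)
qed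

lemma weighted_satisfiable_iff:
  assumes "wf_circuit C"
  shows "weighted_satisfiable C k \<longleftrightarrow>
    (\<exists>v. pvaluation L v \<and> v (length L - 1) \<and> card {i. i < length L \<and> tag L i = 0 \<and> v i} = k)"
proof -
  have "tag L i = 0 \<longleftrightarrow> C ! i = Input" if "i < length C" for i
    using that by (cases "C ! i") (auto simp: tag_pcircuit)
  then have "{i. i < length L \<and> tag L i = 0 \<and> v i} = {i. i < length C \<and> C ! i = Input \<and> v i}" for v
    by (auto simp: length_pcircuit)
  then show ?thesis
    unfolding weighted_satisfiable_def using pvaluation_iff[OF assms] by (simp add: length_pcircuit)
qed

section \<open>Weft and depth by recursion instead of paths\<close>

definition path_to :: "nat list \<Rightarrow> nat \<Rightarrow> bool" where
  "path_to xs j \<longleftrightarrow> xs \<noteq> [] \<and> set xs \<subseteq> {..<length C} \<and>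
     successively (\<lambda>i j. i \<in> set (preds (C ! j))) xs \<and> C ! hd xs = Input \<and> last xs = j"

definition large_count :: "nat list \<Rightarrow> nat" where
  "large_count xs = length (filter (\<lambda>i. length (preds (C ! i)) > 2) xs)"

lemma path_to_less: "path_to xs j \<Longrightarrow> j < length C"
  unfolding path_to_def by (metis last_in_set lessThan_iff subsetD)

lemma path_to_snoc:
  assumes "j < length C"
  shows "path_to (xs @ [j]) j \<longleftrightarrow> (if xs = [] then C ! j = Input else path_to xs (last xs) \<and> last xs \<in> set (preds (C ! j)))"
  using assms by (auto simp: path_to_def successively_append_iff)

lemma path_to_cases:
  assumes "path_to xs j"
  obtains "xs = [j]" "C ! j = Input" | ys where "xs = ys @ [j]" "path_to ys (last ys)" "last ys \<in> set (preds (C ! j))" "ys \<noteq> []"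
proof -
  have j: "j < length C" by (rule path_to_less[OF assms])
  obtain ys where "xs = ys @ [j]" using assms by (metis append_butlast_last_id path_to_def)
  then show thesis using that assms path_to_snoc[OF j, of ys] by (cases "ys = []") auto
qed

lemma small_path: "small L e j \<Longrightarrow> path_to xs j \<Longrightarrow> length xs \<le> Suc e \<and> large_count xs = 0"
proof (induction e arbitrary: j xs)
  case 0
  have "j < length C" by (rule path_to_less[OF 0(2)])
  from 0(2) show ?case
    by (cases rule: path_to_cases) (use 0(1) \<open>j < length C\<close> in \<open>auto simp: args_pcircuit large_count_def\<close>)
next
  case (Suc e)
  have "j < length C" by (rule path_to_less[OF Suc.prems(2)])
  from Suc.prems(2) show ?case
  proof (cases rule: path_to_cases)
    case (2 ys)
    then have "length ys \<le> Suc e \<and> large_count ys = 0"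
      using Suc.prems(1) \<open>j < length C\<close> by (intro Suc.IH[of "last ys"]) (auto simp: args_pcircuit)
    then show ?thesis using 2 Suc.prems(1) \<open>j < length C\<close> by (auto simp: args_pcircuit large_count_def)
  qed (auto simp: large_count_def)
qed

lemma weft1_path: "weft1 L e j \<Longrightarrow> path_to xs j \<Longrightarrow> length xs \<le> Suc e \<and> large_count xs \<le> 1"
proof (induction e arbitrary: j xs)
  case 0
  have "j < length C" by (rule path_to_less[OF 0(2)])
  from 0(2) show ?case
    by (cases rule: path_to_cases) (use 0(1) \<open>j < length C\<close> in \<open>auto simp: args_pcircuit large_count_def\<close>)
next
  case (Suc e)
  have j: "j < length C" by (rule path_to_less[OF Suc.prems(2)])
  from Suc.prems(2) show ?case
  proof (cases rule: path_to_cases)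
    case (2 ys)
    show ?thesis
    proof (cases "length (preds (C ! j)) \<le> 2")
      case True
      then have "length ys \<le> Suc e \<and> large_count ys \<le> 1"
        using Suc.prems(1) j 2 by (intro Suc.IH[of "last ys"]) (auto simp: args_pcircuit)
      then show ?thesis using 2 True by (auto simp: large_count_def)
    next
      case False
      then have "length ys \<le> Suc e \<and> large_count ys = 0"
        using Suc.prems(1) j 2 by (intro small_path[of e "last ys"]) (auto simp: args_pcircuit)
      then show ?thesis using 2 by (auto simp: large_count_def)
    qed
  qed (auto simp: large_count_def)
qed

context
  assumes wf: "wf_circuit C"
begin

lemma pred_less: "j < length C \<Longrightarrow> i \<in> set (preds (C ! j)) \<Longrightarrow> i < j"
  using wf by (auto simp: wf_circuit_def)

text \<open>\<open>weft_le\<close> and \<open>depth_le\<close> constrain only paths that begin at an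
  input. In a well-formed circuit every other gate has a predecessor, so each gate ends such a path,
  and failure of a recursive test can be turned into an offending one.\<close>

lemma path_exists: "j < length C \<Longrightarrow> \<exists>xs. path_to xs j"
proof (induction j rule: less_induct)
  case (less j)
  show ?case
  proof (cases "C ! j = Input")
    case True
    then show ?thesis using less.prems by (intro exI[of _ "[j]"]) (simp add: path_to_def)
  next
    case False
    have "gate_ok (C ! j)" using wf less.prems by (simp add: wf_circuit_def)
    then have "preds (C ! j) \<noteq> []" using False by (cases "C ! j") auto
    then obtain i where i: "i \<in> set (preds (C ! j))" by (meson list.set_sel(1))
    then obtain xs where "path_to xs i" using less.IH[of i] pred_less[OF less.prems i] less.prems by auto
    then have "path_to (xs @ [j]) j" using i less.prems by (simp add: path_to_snoc) (auto simp: path_to_def)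
    then show ?thesis by blast
  qed
qed

lemma path_extend: "path_to xs i \<Longrightarrow> i \<in> set (preds (C ! j)) \<Longrightarrow> j < length C \<Longrightarrow> path_to (xs @ [j]) j"
  by (simp add: path_to_snoc) (auto simp: path_to_def)

lemma not_small_path:
  "\<not> small L e j \<Longrightarrow> j < length C \<Longrightarrow> \<exists>xs. path_to xs j \<and> (length xs > Suc e \<or> large_count xs \<ge> 1)"
proof (induction e arbitrary: j)
  case 0
  then have "preds (C ! j) \<noteq> []" by (simp add: args_pcircuit)
  then obtain i where i: "i \<in> set (preds (C ! j))" by (meson list.set_sel(1))
  then obtain xs where xs: "path_to xs i" using path_exists pred_less[OF 0(2) i] 0(2) by (meson less_trans)
  then have "length (xs @ [j]) > Suc 0" by (auto simp: path_to_def)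
  then show ?case using path_extend[OF xs i 0(2)] by blast
next
  case (Suc e)
  show ?case
  proof (cases "length (preds (C ! j)) \<le> 2")
    case True
    then obtain i where i: "i \<in> set (preds (C ! j))" "\<not> small L e i"
      using Suc.prems by (auto simp: args_pcircuit)
    then obtain xs where xs: "path_to xs i" "length xs > Suc e \<or> large_count xs \<ge> 1"
      using Suc.IH[of i] pred_less[OF Suc.prems(2) i(1)] Suc.prems(2) by auto
    then have "length (xs @ [j]) > Suc (Suc e) \<or> large_count (xs @ [j]) \<ge> 1" by (auto simp: large_count_def)
    then show ?thesis using path_extend[OF xs(1) i(1) Suc.prems(2)] by blast
  next
    case False
    obtain xs where xs: "path_to xs j" using path_exists Suc.prems(2) by blast
    then have "j \<in> set xs" by (auto simp: path_to_def)
    then have "large_count xs \<ge> 1" using False by (auto simp: large_count_def Suc_le_eq filter_empty_conv not_le)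
    then show ?thesis using xs by blast
  qed
qed

lemma not_weft1_path:
  "\<not> weft1 L e j \<Longrightarrow> j < length C \<Longrightarrow> \<exists>xs. path_to xs j \<and> (length xs > Suc e \<or> large_count xs \<ge> 2)"
proof (induction e arbitrary: j)
  case 0
  then have "preds (C ! j) \<noteq> []" by (simp add: args_pcircuit)
  then obtain i where i: "i \<in> set (preds (C ! j))" by (meson list.set_sel(1))
  then obtain xs where xs: "path_to xs i" using path_exists pred_less[OF 0(2) i] 0(2) by (meson less_trans)
  then have "length (xs @ [j]) > Suc 0" by (auto simp: path_to_def)
  then show ?case using path_extend[OF xs i 0(2)] by blast
next
  case (Suc e)
  show ?case
  proof (cases "length (preds (C ! j)) \<le> 2")
    case True
    then obtain i where i: "i \<in> set (preds (C ! j))" "\<not> weft1 L e i"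
      using Suc.prems by (auto simp: args_pcircuit)
    then obtain xs where xs: "path_to xs i" "length xs > Suc e \<or> large_count xs \<ge> 2"
      using Suc.IH[of i] pred_less[OF Suc.prems(2) i(1)] Suc.prems(2) by auto
    then have "length (xs @ [j]) > Suc (Suc e) \<or> large_count (xs @ [j]) \<ge> 2" by (auto simp: large_count_def)
    then show ?thesis using path_extend[OF xs(1) i(1) Suc.prems(2)] by blast
  next
    case False
    then obtain i where i: "i \<in> set (preds (C ! j))" "\<not> small L e i"
      using Suc.prems by (auto simp: args_pcircuit)
    then obtain xs where xs: "path_to xs i" "length xs > Suc e \<or> large_count xs \<ge> 1"
      using not_small_path[of e i] pred_less[OF Suc.prems(2) i(1)] Suc.prems(2) by auto
    then have "length (xs @ [j]) > Suc (Suc e) \<or> large_count (xs @ [j]) \<ge> 2"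
      using False by (auto simp: large_count_def)
    then show ?thesis using path_extend[OF xs(1) i(1) Suc.prems(2)] by blast
  qed
qed

lemma weft1_iff: "weft1 L d (length L - 1) \<longleftrightarrow> weft_le C 1 \<and> depth_le C d"
proof -
  have C: "length C - 1 < length C" using wf by (cases C) (auto simp: wf_circuit_def)
  have p: "circuit_path C xs \<longleftrightarrow> path_to xs (length C - 1)" for xs
    by (auto simp: circuit_path_def path_to_def)
  have "weft_le C 1 \<and> depth_le C d \<longleftrightarrow>
      (\<forall>xs. path_to xs (length C - 1) \<longrightarrow> length xs \<le> Suc d \<and> large_count xs \<le> 1)"
    unfolding weft_le_def depth_le_def p large_count_def by (auto simp: le_diff_conv)
  also have "\<dots> \<longleftrightarrow> weft1 L d (length L - 1)"
    unfolding length_pcircuit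
  proof
    assume *: "\<forall>xs. path_to xs (length C - 1) \<longrightarrow> length xs \<le> Suc d \<and> large_count xs \<le> 1"
    show "weft1 L d (length C - 1)"
    proof (rule ccontr)
      assume "\<not> weft1 L d (length C - 1)"
      from not_weft1_path[OF this C] obtain xs where
        "path_to xs (length C - 1)" "length xs > Suc d \<or> large_count xs \<ge> 2" by blast
      then show False using * by fastforce
    qed
  qed (use weft1_path in blast)
  finally show ?thesis by blast
qed

end
end

section \<open>The conflict graph\<close>

text \<open>\<open>LEAST\<close> is informative only if some number of colors works. An injective
  coloring of a finite set is proper when no edge is a singleton; the rest is monotonicity in the
  number of colors.\<close>

lemma chromatic_number_le_iff:
  assumes "finite S" "\<And>u. {u} \<notin> E"
  shows "chromatic_number S E \<le> k \<longleftrightarrow> (\<exists>c. proper_coloring S E k c)"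
proof
  obtain c :: "'a \<Rightarrow> nat" and n where c: "c ` S = {i. i < n}" "inj_on c S"
    using finite_imp_inj_to_nat_seg[OF assms(1)] by auto
  have "u \<noteq> v" if "{u, v} \<in> E" for u v using that assms(2) by (metis insert_absorb2)
  then have "proper_coloring S E n c"
    using c by (auto simp: proper_coloring_def lessThan_def dest: inj_onD)
  then have "\<exists>k c. proper_coloring S E k c" by (intro exI)
  then have "\<exists>c. proper_coloring S E (chromatic_number S E) c"
    unfolding chromatic_number_def by (rule LeastI_ex)
  then obtain c' where c': "proper_coloring S E (chromatic_number S E) c'" by blast
  assume "chromatic_number S E \<le> k"
  then have "{..<chromatic_number S E} \<subseteq> {..<k}" by simp
  then have "proper_coloring S E k c'" using c' unfolding proper_coloring_def by (meson order_trans)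
  then show "\<exists>c. proper_coloring S E k c" by blast
next
  assume "\<exists>c. proper_coloring S E k c"
  then show "chromatic_number S E \<le> k" unfolding chromatic_number_def by (rule Least_le)
qed

text \<open>Vertices are positions in \<open>vs\<close>, which form the initial segment required by
  \<open>pcp_code\<close>. Both orders of a pair are examined, so failure of \<open>R\<close> in
  either direction creates the edge.\<close>

definition conflict_edges :: "'v \<Rightarrow> ('v \<Rightarrow> 'v \<Rightarrow> bool) \<Rightarrow> 'v list \<Rightarrow> (nat \<times> nat) list" where
  "conflict_edges x\<^sub>0 R vs = filter (\<lambda>p. fst p \<noteq> snd p \<and> \<not> R (nth_or x\<^sub>0 vs (fst p)) (nth_or x\<^sub>0 vs (snd p)))
     (concat (map (\<lambda>u. map (\<lambda>v. (u, v)) [0..<length vs]) [0..<length vs]))"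

definition parts :: "'v \<Rightarrow> ('v \<Rightarrow> 'k) \<Rightarrow> 'v list \<Rightarrow> 'k list \<Rightarrow> nat list list" where
  "parts x\<^sub>0 ky vs ks = map (\<lambda>t. filter (\<lambda>u. ky (nth_or x\<^sub>0 vs u) = t) [0..<length vs]) ks"

text \<open>The vertices selected in the \<open>k - 1\<close> extra parts are adjacent to everything
  selected and use up \<open>k - 1\<close> colors, so the others must be independent. If some part
  is empty, the word describes no instance; then no choice \<open>h\<close> exists either, and the
  equivalence persists.\<close>

lemma PCP_conflict_graph:
  fixes vs :: "'v list" and ky :: "'v \<Rightarrow> 'k"
  assumes ks: "distinct (ks @ extra)" "k \<ge> 1" "length extra = k - 1"
    and ky: "\<And>x. x \<in> set vs \<Longrightarrow> ky x \<in> set (ks @ extra)"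
    and extra: "\<And>t. t \<in> set extra \<Longrightarrow> \<exists>x\<in>set vs. ky x = t"
      "\<And>x y. x \<in> set vs \<Longrightarrow> y \<in> set vs \<Longrightarrow> ky x \<in> set extra \<Longrightarrow> \<not> R x y"
  shows "(enc_pcp (length vs) (conflict_edges x\<^sub>0 R vs) (parts x\<^sub>0 ky vs (ks @ extra)) k, length (ks @ extra)) \<in> PCP_with K
    \<longleftrightarrow> k \<in> K \<and> (\<exists>h. (\<forall>t\<in>set ks. h t \<in> set vs \<and> ky (h t) = t) \<and>
      (\<forall>t\<in>set ks. \<forall>t'\<in>set ks. t \<noteq> t' \<longrightarrow> R (h t) (h t')))"
proof -
  define V where "V = {..<length vs}"
  define E where "E = {{u, v} | u v. (u, v) \<in> set (conflict_edges x\<^sub>0 R vs)}"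
  define part where "part t = {u. u < length vs \<and> ky (vs ! u) = t}" for t
  define P where "P = set ` set (parts x\<^sub>0 ky vs (ks @ extra))"
  have es: "set (conflict_edges x\<^sub>0 R vs) =
      {(u, v). u < length vs \<and> v < length vs \<and> u \<noteq> v \<and> \<not> R (vs ! u) (vs ! v)}"
    by (auto simp: conflict_edges_def nth_or_eq image_iff)
  have E_iff: "{u, v} \<in> E \<longleftrightarrow> u < length vs \<and> v < length vs \<and> u \<noteq> v \<and> (\<not> R (vs ! u) (vs ! v) \<or> \<not> R (vs ! v) (vs ! u))" for u v
    unfolding E_def es by (auto simp: doubleton_eq_iff)
  have simple: "simple_graph V E"
    unfolding simple_graph_def V_def E_def es by auto
  have "{u} \<notin> E" for u using E_iff[of u u] by simp
  then have col: "chromatic_number S (induced_edges E S) \<le> k \<longleftrightarrow> (\<exists>c. proper_coloring S (induced_edges E S) k c)"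
    if "S \<subseteq> V" for S
    using that by (intro chromatic_number_le_iff) (auto simp: V_def induced_edges_def intro: finite_subset)
  have P: "P = part ` set (ks @ extra)"
    unfolding P_def parts_def part_def by (force simp: nth_or_eq image_iff)
  have disj: "part t \<inter> part t' = {}" if "t \<noteq> t'" for t t' using that by (auto simp: part_def)
  have inst: "pcp_instance V E P \<longleftrightarrow> (\<forall>t\<in>set (ks @ extra). part t \<noteq> {})"
  proof
    assume "pcp_instance V E P"
    then have "{} \<notin> P" by (auto simp: pcp_instance_def partition_on_def)
    then show "\<forall>t\<in>set (ks @ extra). part t \<noteq> {}" unfolding P by (metis image_eqI)
  next
    assume *: "\<forall>t\<in>set (ks @ extra). part t \<noteq> {}"
    have "\<Union>P = V"
    proof
      show "V \<subseteq> \<Union>P"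
      proof
        fix u assume "u \<in> V"
        then have "u \<in> part (ky (vs ! u))" "ky (vs ! u) \<in> set (ks @ extra)"
          using ky[of "vs ! u"] by (auto simp: V_def part_def)
        then show "u \<in> \<Union>P" unfolding P by blast
      qed
    qed (auto simp: P V_def part_def)
    moreover have "disjoint P" unfolding P disjoint_def using disj by (metis (no_types, lifting) imageE)
    ultimately show "pcp_instance V E P"
      using simple * unfolding pcp_instance_def partition_on_def P by auto
  qed
  have card: "card P = length (ks @ extra)" if "\<forall>t\<in>set (ks @ extra). part t \<noteq> {}"
  proof -
    have "inj_on part (set (ks @ extra))"
    proof (rule inj_onI)
      fix t t' assume "t \<in> set (ks @ extra)" "part t = part t'"
      then show "t = t'" using that disj[of t t'] by force
    qed
    then show ?thesis unfolding P using distinct_card[OF ks(1)] by (simp add: card_image)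
  qed
  have mem: "(enc_pcp (length vs) (conflict_edges x\<^sub>0 R vs) (parts x\<^sub>0 ky vs (ks @ extra)) k, length (ks @ extra)) \<in> PCP_with K
      \<longleftrightarrow> k \<in> K \<and> pcp_instance V E P \<and> card P = length (ks @ extra) \<and> pcp_yes V E P k"
    unfolding PCP_with_def pcp_code_def by (auto simp: enc_pcp_inject V_def E_def P_def)
  show ?thesis unfolding mem
  proof (intro iffI conjI; (elim conjE)?)
    assume "pcp_instance V E P" "pcp_yes V E P k"
    then obtain S c where S: "selection V P S" "proper_coloring S (induced_edges E S) k c"
      using col by (auto simp: pcp_yes_def selection_def)
    have "\<exists>u. S \<inter> part t = {u}" if "t \<in> set (ks @ extra)" for t
      using S(1) that unfolding selection_def P by (metis card_1_singletonE image_eqI)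
    then obtain u where u: "\<And>t. t \<in> set (ks @ extra) \<Longrightarrow> S \<inter> part t = {u t}" by metis
    have u_part: "u t \<in> S" "u t < length vs" "ky (vs ! u t) = t" "vs ! u t \<in> set vs" if "t \<in> set (ks @ extra)" for t
    proof -
      have "u t \<in> S \<inter> part t" using u[OF that] by blast
      then show "u t \<in> S" "u t < length vs" "ky (vs ! u t) = t" "vs ! u t \<in> set vs"
        by (simp_all add: part_def)
    qed
    have adj: "c (u t) \<noteq> c (u t')"
      if "t \<in> set (ks @ extra)" "t' \<in> set (ks @ extra)" "t \<noteq> t'" "\<not> R (vs ! u t) (vs ! u t')" for t t'
    proof -
      have "u t \<noteq> u t'" using u_part(3)[OF that(1)] u_part(3)[OF that(2)] that(3) by auto
      then have "{u t, u t'} \<in> induced_edges E S"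
        using u_part[OF that(1)] u_part[OF that(2)] that(4) by (simp add: induced_edges_def E_iff)
      then show ?thesis
        using S(2) u_part(1)[OF that(1)] u_part(1)[OF that(2)] unfolding proper_coloring_def by blast
    qed
    have "R (vs ! u t) (vs ! u t')" if t: "t \<in> set ks" "t' \<in> set ks" "t \<noteq> t'" for t t'
    proof (rule ccontr)
      assume nR: "\<not> R (vs ! u t) (vs ! u t')"
      \<comment> \<open>Two conflicting vertices together with those of the extra parts would form a
        clique of size \<open>k + 1\<close>.\<close>
      let ?A = "{t, t'} \<union> set extra"
      have sub: "?A \<subseteq> set (ks @ extra)" using t by auto
      have "inj_on (\<lambda>t. c (u t)) ?A"
      proof (rule inj_onI, rule ccontr)
        fix a b assume ab: "a \<in> ?A" "b \<in> ?A" "c (u a) = c (u b)" "a \<noteq> b"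
        have ab': "a \<in> set (ks @ extra)" "b \<in> set (ks @ extra)" using ab sub by auto
        consider "a = t" "b = t'" | "a = t'" "b = t" | "a \<in> set extra" | "b \<in> set extra" using ab by auto
        then show False
        proof cases
          case 1
          then show ?thesis using adj[OF ab' ab(4)] nR ab(3) by simp
        next
          case 2
          then show ?thesis using adj[OF ab'(2,1)] nR ab(3,4) by simp
        next
          case 3
          then have "\<not> R (vs ! u a) (vs ! u b)" using extra(2) u_part ab' by metis
          then show ?thesis using adj[OF ab' ab(4)] ab(3) by simp
        next
          case 4
          then have "\<not> R (vs ! u b) (vs ! u a)" using extra(2) u_part ab' by metis
          then show ?thesis using adj[OF ab'(2,1)] ab(3,4) by simp
        qed
      qed
      moreover have "(\<lambda>t. c (u t)) ` ?A \<subseteq> {..<k}"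
        using S(2) u_part(1) sub unfolding proper_coloring_def by blast
      ultimately have "card ?A \<le> k" using card_inj_on_le[of _ ?A "{..<k}"] by simp
      moreover have "card ?A = k + 1"
      proof -
        have "t \<notin> set extra" "t' \<notin> set extra" using t ks(1) by auto
        then have "card ?A = card {t, t'} + card (set extra)" by (intro card_Un_disjoint) auto
        then show ?thesis using t(3) ks distinct_card[of extra] by simp
      qed
      ultimately show False by simp
    qed
    then show "\<exists>h. (\<forall>t\<in>set ks. h t \<in> set vs \<and> ky (h t) = t) \<and>
        (\<forall>t\<in>set ks. \<forall>t'\<in>set ks. t \<noteq> t' \<longrightarrow> R (h t) (h t'))"
      using u_part(3,4) by (intro exI[of _ "\<lambda>t. vs ! u t"]) simp
  next
    assume "\<exists>h. (\<forall>t\<in>set ks. h t \<in> set vs \<and> ky (h t) = t) \<and>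
        (\<forall>t\<in>set ks. \<forall>t'\<in>set ks. t \<noteq> t' \<longrightarrow> R (h t) (h t'))"
    then obtain h where h: "\<And>t. t \<in> set ks \<Longrightarrow> h t \<in> set vs \<and> ky (h t) = t"
      "\<And>t t'. t \<in> set ks \<Longrightarrow> t' \<in> set ks \<Longrightarrow> t \<noteq> t' \<Longrightarrow> R (h t) (h t')" by blast
    have "\<exists>u. u < length vs \<and> ky (vs ! u) = t \<and> (t \<in> set ks \<longrightarrow> vs ! u = h t)" if "t \<in> set (ks @ extra)" for t
    proof (cases "t \<in> set ks")
      case True
      then show ?thesis using h(1)[of t] by (metis in_set_conv_nth)
    next
      case False
      then show ?thesis using extra(1)[of t] that by (metis Un_iff in_set_conv_nth set_append)
    qed
    then obtain u where u: "\<And>t. t \<in> set (ks @ extra) \<Longrightarrow> u t < length vs \<and> ky (vs ! u t) = t \<and> (t \<in> set ks \<longrightarrow> vs ! u t = h t)"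
      by metis
    have ne: "\<forall>t\<in>set (ks @ extra). part t \<noteq> {}" using u by (auto simp: part_def)
    show "pcp_instance V E P" using inst ne by simp
    show "card P = length (ks @ extra)" using card ne by simp
    define S where "S = u ` set (ks @ extra)"
    have S: "S \<subseteq> V" using u by (auto simp: S_def V_def)
    have "S \<inter> part t = {u t}" if t: "t \<in> set (ks @ extra)" for t
    proof
      show "S \<inter> part t \<subseteq> {u t}"
      proof
        fix w assume w: "w \<in> S \<inter> part t"
        then obtain t' where "t' \<in> set (ks @ extra)" "w = u t'" by (auto simp: S_def)
        moreover from this have "t' = t" using u[of t'] w by (simp add: part_def)
        ultimately show "w \<in> {u t}" by simp
      qed
      show "{u t} \<subseteq> S \<inter> part t" using t u[OF t] by (simp add: S_def part_def)
    qed
    then have sel: "selection V P S" using S unfolding selection_def P by auto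
    obtain f :: "'k \<Rightarrow> nat" where f: "f ` set extra = {i. i < k - 1}" "inj_on f (set extra)"
    proof -
      have "\<exists>f n. f ` set extra = {i::nat. i < n} \<and> inj_on f (set extra)"
        by (rule finite_imp_inj_to_nat_seg) simp
      then obtain f n where f: "f ` set extra = {i::nat. i < n}" "inj_on f (set extra)" by blast
      have "card (set extra) = k - 1" using ks distinct_card[of extra] by simp
      then have "n = k - 1" using card_image[OF f(2)] f(1) by simp
      then show thesis using that f by blast
    qed
    \<comment> \<open>Each extra part has its own color below \<open>k - 1\<close>; the independent
      vertices share color \<open>k - 1\<close>.\<close>
    define c where "c w = (if ky (vs ! w) \<in> set extra then f (ky (vs ! w)) else k - 1)" for w
    have "proper_coloring S (induced_edges E S) k c"
      unfolding proper_coloring_def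
    proof (intro conjI ballI impI)
      have "f t < k - 1" if "t \<in> set extra" for t using f(1) that by blast
      then show "c ` S \<subseteq> {..<k}" using ks(2) by (fastforce simp: c_def)
    next
      fix a b assume "a \<in> S" "b \<in> S" "{a, b} \<in> induced_edges E S"
      then obtain t t' where t: "t \<in> set (ks @ extra)" "t' \<in> set (ks @ extra)" "a = u t" "b = u t'"
        and ab: "a \<noteq> b" "\<not> R (vs ! a) (vs ! b) \<or> \<not> R (vs ! b) (vs ! a)"
        by (auto simp: S_def induced_edges_def E_iff)
      have "t \<noteq> t'" using t ab(1) by auto
      have k: "ky (vs ! a) = t" "ky (vs ! b) = t'" using u t by auto
      have "\<not> (t \<in> set ks \<and> t' \<in> set ks)" using h(2) u t ab(2) \<open>t \<noteq> t'\<close> by metis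
      moreover have "f s < k - 1" if "s \<in> set extra" for s using f(1) that by blast
      moreover have "f t \<noteq> f t'" if "t \<in> set extra" "t' \<in> set extra" using f(2) that \<open>t \<noteq> t'\<close> by (auto dest: inj_onD)
      ultimately show "c a \<noteq> c b" using t(1,2) unfolding c_def k by (auto split: if_splits) fastforce+
    qed
    then show "pcp_yes V E P k" using sel col[OF S] unfolding pcp_yes_def by blast
  qed
qed


section \<open>The reduction\<close>

text \<open>
  All components of the code of a circuit are unary numbers, so a word is first split into
  numbers. Parsing is total; words that are not codes are recognized by encoding the result again.
\<close>

definition token_step :: "bool \<Rightarrow> nat \<times> nat list \<Rightarrow> nat \<times> nat list" where
  "token_step b p = (if b then (Suc (fst p), snd p) else (0, snd p @ [fst p]))"

definition tokens :: "bool list \<Rightarrow> nat list" where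
  "tokens w = snd (fold token_step w (0, []))"

text \<open>Any tag other than 0 and 1 is taken to be followed by a length and that many gate names.
  Meaningless tags are left to \<open>pgate_ok\<close>, and truncated input to the comparison with
  the encoding.\<close>

definition parse_step :: "nat list \<times> pcircuit \<Rightarrow> nat list \<times> pcircuit" where
  "parse_step p = (if head 0 (fst p) = 0 then (tl (fst p), snd p @ [(0, [])])
     else if head 0 (fst p) = 1 then (tl (tl (fst p)), snd p @ [(1, [head 0 (tl (fst p))])])
     else (drop (head 0 (tl (fst p))) (tl (tl (fst p))),
       snd p @ [(head 0 (fst p), take (head 0 (tl (fst p))) (tl (tl (fst p))))]))"

definition parse :: "bool list \<Rightarrow> pcircuit" where
  "parse w = snd (fold (\<lambda>_. parse_step) (replicate (head 0 (tokens w)) ()) (tl (tokens w), []))"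

definition gate_tokens :: "nat \<times> nat list \<Rightarrow> nat list" where
  "gate_tokens g = fst g # (if fst g \<le> 1 then snd g else length (snd g) # snd g)"

definition enc_pcircuit :: "pcircuit \<Rightarrow> bool list" where
  "enc_pcircuit L = concat (map enc_nat (length L # concat (map gate_tokens L)))"

lemma enc_circuit_eq: "enc_circuit C = enc_pcircuit (map gate_pair C)"
proof -
  have "enc_gate g = concat (map enc_nat (gate_tokens (gate_pair g)))" for g
    by (cases g) (auto simp: gate_tokens_def enc_list_def)
  then have "concat (map enc_gate C) = concat (map enc_nat (concat (map gate_tokens (map gate_pair C))))"
    by (induction C) auto
  then show ?thesis by (simp add: enc_circuit_def enc_list_def enc_pcircuit_def)
qed

lemma tokens_enc: "tokens (concat (map enc_nat ns)) = ns"
proof -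
  have 1: "(token_step True ^^ n) (0, acc) = (n, acc)" for n acc
    by (induction n) (auto simp: token_step_def)
  have "fold token_step (concat (map enc_nat ns)) (0, acc) = (0, acc @ ns)" for acc
    by (induction ns arbitrary: acc) (auto simp: enc_nat_def 1 token_step_def)
  then show ?thesis by (simp add: tokens_def)
qed

lemma parse_enc_circuit: "parse (enc_circuit C) = map gate_pair C"
proof -
  have step: "parse_step (gate_tokens (gate_pair g) @ ts, acc) = (ts, acc @ [gate_pair g])" for g ts acc
    by (cases g) (auto simp: gate_tokens_def parse_step_def)
  have "(parse_step ^^ length C) (concat (map gate_tokens (map gate_pair C)), acc) =
      ([], acc @ map gate_pair C)" for acc
    by (induction C arbitrary: acc) (auto simp: step funpow_Suc_right simp del: funpow.simps(2))
  then show ?thesis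
    unfolding parse_def enc_circuit_eq enc_pcircuit_def tokens_enc by simp
qed

definition valid :: "nat \<Rightarrow> bool list \<Rightarrow> bool" where
  "valid d w \<longleftrightarrow> enc_pcircuit (parse w) = w \<and> pwf (parse w) \<and> weft1 (parse w) d (length (parse w) - 1)"

lemma valid_enc_circuit:
  "valid d (enc_circuit C) \<longleftrightarrow> wf_circuit C \<and> weft_le C 1 \<and> depth_le C d"
  unfolding valid_def parse_enc_circuit enc_circuit_eq[symmetric] pwf_iff[OF refl]
  using weft1_iff[OF refl, of C d] by blast

lemma valid_obtains:
  assumes "valid d w"
  obtains C where "w = enc_circuit C"
proof -
  have w: "enc_pcircuit (parse w) = w" and wf: "pwf (parse w)" using assms by (auto simp: valid_def)
  have "\<exists>g. p = gate_pair g" if p: "p \<in> set (parse w)" for p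
  proof -
    obtain i where "i < length (parse w)" "p = parse w ! i" using p by (metis in_set_conv_nth)
    then have "pgate_ok p" using wf by (auto simp: pwf_def nth_or_eq)
    then show ?thesis by (rule pgate_ok_gate_pair)
  qed
  then have "\<exists>C. parse w = map gate_pair C" by (auto simp: ex_map_conv)
  then obtain C where "parse w = map gate_pair C" by blast
  then show thesis using that[of C] w by (simp add: enc_circuit_eq)
qed

text \<open>Parts are named by index tuples of length at least 2, so that names of length 1 are free.\<close>

definition extra_keys :: "nat \<Rightarrow> nat list list" where
  "extra_keys k = map (\<lambda>i. [i]) [0..<k - 1]"

definition extra_vertices :: "nat \<Rightarrow> vertex list" where
  "extra_vertices k = map (\<lambda>i. ([], [(i, 0)])) [0..<k - 1]"

definition all_vertices :: "nat \<Rightarrow> nat \<Rightarrow> pcircuit \<Rightarrow> nat \<Rightarrow> vertex list" where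
  "all_vertices k d L \<kappa> = vertices L d \<kappa> @ extra_vertices k"

definition all_keys :: "nat \<Rightarrow> nat \<Rightarrow> nat \<Rightarrow> nat list list" where
  "all_keys k d \<kappa> = tuples d \<kappa> @ extra_keys k"

definition pcp_word :: "nat \<Rightarrow> nat list list \<Rightarrow> vertex list \<Rightarrow> bool list" where
  "pcp_word k ks vs = enc_pcp (length vs) (conflict_edges ([], []) compatible vs) (parts ([], []) key vs ks) k"

text \<open>Invalid words go to the empty word. It codes no instance, since every code begins with a
  number and thus contains \<open>False\<close>.\<close>

definition reduction :: "nat \<Rightarrow> nat \<Rightarrow> bool list \<times> nat \<Rightarrow> bool list \<times> nat" where
  "reduction k d x = (if valid d (fst x)
     then (pcp_word k (all_keys k d (snd x)) (all_vertices k d (parse (fst x)) (snd x)), length (all_keys k d (snd x)))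
     else ([], 0))"

lemma reduction_correct:
  assumes "k \<ge> 1"
  shows "(w, \<kappa>) \<in> WCS 1 d \<longleftrightarrow> reduction k d (w, \<kappa>) \<in> PCP_with {k}"
    and "(w, \<kappa>) \<in> WCS 1 d \<longleftrightarrow> reduction k d (w, \<kappa>) \<in> PCP"
proof -
  \<comment> \<open>Every code produced carries the same \<open>k\<close>, so one argument serves
    both \<open>{k}\<close> and \<open>UNIV\<close>.\<close>
  have "(w, \<kappa>) \<in> WCS 1 d \<longleftrightarrow> reduction k d (w, \<kappa>) \<in> PCP_with K" if "k \<in> K" for K
  proof (cases "valid d w")
    case False
    have "[] \<noteq> enc_pcp n es ps k'" for n es ps k' by (simp add: enc_pcp_def enc_nat_def)
    then have "([], 0) \<notin> PCP_with K" unfolding PCP_with_def pcp_code_def by auto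
    moreover have "(w, \<kappa>) \<notin> WCS 1 d" using False valid_enc_circuit by (auto simp: WCS_def)
    ultimately show ?thesis using False by (simp add: reduction_def)
  next
    case True
    then obtain C where w: "w = enc_circuit C" by (rule valid_obtains)
    define L where "L = map gate_pair C"
    have C: "wf_circuit C" "weft_le C 1" "depth_le C d" using True by (auto simp: w valid_enc_circuit)
    interpret weft1_circuit L d
      using pwf_iff[OF L_def] weft1_iff[OF L_def C(1)] C by unfold_locales auto
    have mem: "(w, \<kappa>) \<in> WCS 1 d \<longleftrightarrow> weighted_satisfiable C \<kappa>"
    proof -
      have "C' = C" if "enc_circuit C' = enc_circuit C" for C'
      proof -
        have "prefix_code enc_circuit"
          unfolding enc_circuit_def by (rule prefix_code_enc_list[OF prefix_code_enc_gate])
        from prefix_codeD[OF this, of C' "[]" C "[]"] show ?thesis using that by simp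
      qed
      then show ?thesis using C by (auto simp: WCS_def w)
    qed
    have key_vertices: "key x \<in> set (tuples d \<kappa>)" if "x \<in> set (vertices L d \<kappa>)" for x
      using that by (auto simp: set_vertices set_tuples key_def)
    have len2: "length t \<noteq> 1" if "t \<in> set (tuples d \<kappa>)" for t
      using that by (auto simp: set_tuples)
    have len1: "length t = 1" if "t \<in> set (extra_keys k)" for t
      using that by (auto simp: extra_keys_def)
    have key_extra: "key x \<in> set (extra_keys k)" "fst x = []" if "x \<in> set (extra_vertices k)" for x
      using that by (auto simp: extra_vertices_def extra_keys_def key_def)
    have "distinct (tuples d \<kappa>)" unfolding tuples_def by (intro distinct_n_lists) simp
    moreover have "distinct (extra_keys k)" by (auto simp: extra_keys_def distinct_map inj_on_def)
    ultimately have dist: "distinct (tuples d \<kappa> @ extra_keys k)" using len1 len2 by auto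
    have "reduction k d (w, \<kappa>) \<in> PCP_with K \<longleftrightarrow>
      k \<in> K \<and> (\<exists>h. (\<forall>t\<in>set (tuples d \<kappa>). h t \<in> set (all_vertices k d L \<kappa>) \<and> key (h t) = t) \<and>
      (\<forall>t\<in>set (tuples d \<kappa>). \<forall>t'\<in>set (tuples d \<kappa>). t \<noteq> t' \<longrightarrow> compatible (h t) (h t')))"
    proof -
      have r: "reduction k d (w, \<kappa>) = (enc_pcp (length (all_vertices k d L \<kappa>))
          (conflict_edges ([], []) compatible (all_vertices k d L \<kappa>))
          (parts ([], []) key (all_vertices k d L \<kappa>) (tuples d \<kappa> @ extra_keys k)) k,
          length (tuples d \<kappa> @ extra_keys k))"
        using True by (simp add: reduction_def w parse_enc_circuit L_def pcp_word_def all_keys_def)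
      show ?thesis unfolding r
      proof (rule PCP_conflict_graph[OF dist assms])
        show "length (extra_keys k) = k - 1" by (simp add: extra_keys_def)
        show "key x \<in> set (tuples d \<kappa> @ extra_keys k)" if "x \<in> set (all_vertices k d L \<kappa>)" for x
          using that key_vertices[of x] key_extra(1)[of x] by (auto simp: all_vertices_def)
        show "\<exists>x\<in>set (all_vertices k d L \<kappa>). key x = t" if t: "t \<in> set (extra_keys k)" for t
        proof -
          obtain i where "i < k - 1" "t = [i]" using t by (auto simp: extra_keys_def)
          then show ?thesis
            by (intro bexI[of _ "([], [(i, 0)])"]) (auto simp: all_vertices_def extra_vertices_def key_def)
        qed
        show "\<not> compatible x y"
          if "x \<in> set (all_vertices k d L \<kappa>)" "y \<in> set (all_vertices k d L \<kappa>)" "key x \<in> set (extra_keys k)" for x y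
        proof -
          have "x \<in> set (extra_vertices k)"
            using that(1,3) key_vertices[of x] len1[of "key x"] len2[of "key x"] by (auto simp: all_vertices_def)
          then show ?thesis using key_extra(2)[of x] by (simp add: compatible_def)
        qed
      qed
    qed
    moreover have "h t \<in> set (all_vertices k d L \<kappa>) \<and> key (h t) = t \<longleftrightarrow> h t \<in> set (vertices L d \<kappa>) \<and> key (h t) = t"
      if "t \<in> set (tuples d \<kappa>)" for h t
      using that key_extra(1)[of "h t"] len1[of t] len2[of t] by (auto simp: all_vertices_def)
    ultimately have "reduction k d (w, \<kappa>) \<in> PCP_with K \<longleftrightarrow>
      (\<exists>h. (\<forall>t\<in>set (tuples d \<kappa>). h t \<in> set (vertices L d \<kappa>) \<and> key (h t) = t) \<and>
      (\<forall>t\<in>set (tuples d \<kappa>). \<forall>t'\<in>set (tuples d \<kappa>). t \<noteq> t' \<longrightarrow> compatible (h t) (h t')))"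
      using \<open>k \<in> K\<close> by (simp cong: ball_cong)
    also have "\<dots> \<longleftrightarrow> (\<exists>v. pvaluation L v \<and> v (length L - 1) \<and> card {i. i < length L \<and> tag L i = 0 \<and> v i} = \<kappa>)"
    proof
      assume "\<exists>h. (\<forall>t\<in>set (tuples d \<kappa>). h t \<in> set (vertices L d \<kappa>) \<and> key (h t) = t) \<and>
        (\<forall>t\<in>set (tuples d \<kappa>). \<forall>t'\<in>set (tuples d \<kappa>). t \<noteq> t' \<longrightarrow> compatible (h t) (h t'))"
      then show "\<exists>v. pvaluation L v \<and> v (length L - 1) \<and> card {i. i < length L \<and> tag L i = 0 \<and> v i} = \<kappa>"
        by (elim exE conjE) (rule valuation_of_solution)
    next
      assume "\<exists>v. pvaluation L v \<and> v (length L - 1) \<and> card {i. i < length L \<and> tag L i = 0 \<and> v i} = \<kappa>"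
      then obtain v where v: "pvaluation L v" "v (length L - 1)" "card {i. i < length L \<and> tag L i = 0 \<and> v i} = \<kappa>"
        by blast
      then show "\<exists>h. (\<forall>t\<in>set (tuples d \<kappa>). h t \<in> set (vertices L d \<kappa>) \<and> key (h t) = t) \<and>
        (\<forall>t\<in>set (tuples d \<kappa>). \<forall>t'\<in>set (tuples d \<kappa>). t \<noteq> t' \<longrightarrow> compatible (h t) (h t'))"
        by (intro solution_of_valuation)
    qed
    finally show ?thesis unfolding mem weighted_satisfiable_iff[OF L_def C(1)] by simp
  qed
  then show "(w, \<kappa>) \<in> WCS 1 d \<longleftrightarrow> reduction k d (w, \<kappa>) \<in> PCP_with {k}"
    "(w, \<kappa>) \<in> WCS 1 d \<longleftrightarrow> reduction k d (w, \<kappa>) \<in> PCP" by (auto simp: PCP_def)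
qed

lemma reduction_parameter: "snd (reduction k d (w, \<kappa>)) \<le> (\<kappa> + 2) ^ 2 ^ (d + 1) + k"
  by (auto simp: reduction_def all_keys_def tuples_def extra_keys_def length_n_lists)


section \<open>The reduction takes polynomial time\<close>

lemma ptime_app4:
  assumes "ptime (\<lambda>p. h (fst p) (fst (snd p)) (fst (snd (snd p))) (snd (snd (snd p))))"
    "ptime f\<^sub>1" "ptime f\<^sub>2" "ptime f\<^sub>3" "ptime f\<^sub>4"
  shows "ptime (\<lambda>x. h (f\<^sub>1 x) (f\<^sub>2 x) (f\<^sub>3 x) (f\<^sub>4 x))"
  using ptime_comp[OF assms(1) ptime_Pair[OF assms(2) ptime_Pair[OF assms(3) ptime_Pair[OF assms(4,5)]]]]
  by simp

lemma ptime_enc_nat [ptime_intros]: "ptime f \<Longrightarrow> ptime (\<lambda>x. enc_nat (f x))"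
  unfolding enc_nat_def by (intro ptime_intros)

lemma ptime_enc_pair [ptime_intros]: "ptime f \<Longrightarrow> ptime (\<lambda>x. enc_pair (f x))"
  unfolding enc_pair_def by (intro ptime_intros)

lemma ptime_enc_list [ptime_intros]:
  assumes "ptime e" "ptime l"
  shows "ptime (\<lambda>x. enc_list e (l x))"
  unfolding enc_list_def by (intro ptime_intros ptime_comp[OF assms(1)] assms(2))

lemma ptime_tokens [ptime_intros]: "ptime f \<Longrightarrow> ptime (\<lambda>x. tokens (f x))"
proof (rule ptime_comp[of tokens])
  have "ptime (\<lambda>w. fold token_step w (0, []))"
  proof (rule ptime_fold[where B = "\<lambda>w. Suc (sz w)"])
    fix w ys zs :: "bool list" assume w: "w = ys @ zs"
    \<comment> \<open>A bit either increases the running number or moves it into the list at the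
      cost of one cell, so the total grows by at most 1.\<close>
    have inv: "fst (fold token_step bs p) + sz (snd (fold token_step bs p)) \<le> fst p + sz (snd p) + length bs" for bs p
    proof (induction bs arbitrary: p)
      case (Cons b bs)
      have "fst (token_step b p) + sz (snd (token_step b p)) \<le> fst p + sz (snd p) + 1"
        by (auto simp: token_step_def)
      then show ?case using Cons.IH[of "token_step b p"] by simp
    qed simp
    have "sz (fold token_step ys (0, [])) = Suc (fst (fold token_step ys (0, [])) + sz (snd (fold token_step ys (0, []))))"
      by (cases "fold token_step ys (0, [])") simp
    also have "\<dots> \<le> Suc (length ys)" using inv[of ys "(0, [])"] by simp
    also have "\<dots> \<le> Suc (sz w)" using length_le_sz[of ys] by (simp add: w)
    finally show "sz (fold token_step ys (0, [])) \<le> Suc (sz w)" .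
  next
    show "ptime (\<lambda>p::bool list \<times> bool \<times> nat \<times> nat list. token_step (fst (snd p)) (snd (snd p)))"
      unfolding token_step_def by (intro ptime_intros)
  qed (intro ptime_intros pbound_intros)+
  then show "ptime tokens" unfolding tokens_def by (intro ptime_intros)
qed

lemma sz_take_drop: "sz (take n xs) + sz (drop n xs) = sz xs"
  by (metis append_take_drop_id sz_append)

text \<open>Tokens pass from the unread list to the output, so the combined size grows by a constant
  only, although whole argument lists are moved at once.\<close>

lemma sz_parse_step:
  "sz (fst (parse_step p)) + sz (snd (parse_step p)) \<le> sz (fst p) + sz (snd p) + 5"
proof -
  obtain ts acc where p: "p = (ts, acc)" by (cases p)
  show ?thesis
  proof (cases ts)
    case Nil
    then show ?thesis by (simp add: p parse_step_def)
  next
    case (Cons t ts')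
    then show ?thesis using sz_take_drop[of "head 0 ts'" "tl ts'"]
      by (cases ts') (auto simp: p parse_step_def)
  qed
qed

lemma ptime_parse [ptime_intros]: "ptime f \<Longrightarrow> ptime (\<lambda>x. parse (f x))"
proof (rule ptime_comp[of parse])
  have "ptime (\<lambda>w. fold (\<lambda>_. parse_step) (replicate (head 0 (tokens w)) ()) (tl (tokens w), []))"
  proof (rule ptime_fold[where B = "\<lambda>w. Suc (sz (tl (tokens w)) + 5 * sz (head 0 (tokens w)))"])
    fix w and ys zs :: "unit list" assume "replicate (head 0 (tokens w)) () = ys @ zs"
    then have len: "length ys \<le> head 0 (tokens w)" by (metis length_append length_replicate le_add1)
    let ?f = "fold (\<lambda>_. parse_step)"
    have inv: "sz (fst (?f us p)) + sz (snd (?f us p)) \<le> sz (fst p) + sz (snd p) + 5 * length us" for us :: "unit list" and p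
    proof (induction us arbitrary: p)
      case (Cons u us)
      show ?case using sz_parse_step[of p] Cons.IH[of "parse_step p"] by simp
    qed simp
    have "sz (?f ys (tl (tokens w), [])) = Suc (sz (fst (?f ys (tl (tokens w), []))) + sz (snd (?f ys (tl (tokens w), []))))"
      by (cases "?f ys (tl (tokens w), [])") simp
    then show "sz (?f ys (tl (tokens w), [])) \<le> Suc (sz (tl (tokens w)) + 5 * sz (head 0 (tokens w)))"
      using inv[of ys "(tl (tokens w), [])"] len by simp
  next
    show "ptime (\<lambda>p::bool list \<times> unit \<times> nat list \<times> pcircuit. parse_step (snd (snd p)))"
      unfolding parse_step_def by (intro ptime_intros)
  qed (intro ptime_intros pbound_intros ptime_pbound)+
  then show "ptime parse" unfolding parse_def by (intro ptime_intros)
qed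

lemma ptime_tag [ptime_intros]: "ptime L \<Longrightarrow> ptime j \<Longrightarrow> ptime (\<lambda>x. tag (L x) (j x))"
  unfolding tag_def by (intro ptime_intros)

lemma ptime_args [ptime_intros]: "ptime L \<Longrightarrow> ptime j \<Longrightarrow> ptime (\<lambda>x. args (L x) (j x))"
  unfolding args_def by (intro ptime_intros)

lemma ptime_universal [ptime_intros]:
  "ptime L \<Longrightarrow> ptime j \<Longrightarrow> ptime b \<Longrightarrow> ptime (\<lambda>x. universal (L x) (j x) (b x))"
  unfolding universal_def by (intro ptime_intros)

lemma ptime_arg_value [ptime_intros]:
  "ptime L \<Longrightarrow> ptime j \<Longrightarrow> ptime b \<Longrightarrow> ptime (\<lambda>x. arg_value (L x) (j x) (b x))"
  unfolding arg_value_def by (intro ptime_intros)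

lemma ptime_distinct [ptime_intros]:
  assumes "ptime l"
  shows "ptime (\<lambda>x. distinct (l x :: nat list))"
proof -
  have "ptime (\<lambda>x. \<forall>i\<in>set [0..<length (l x)]. \<forall>j\<in>set [0..<length (l x)].
      i \<noteq> j \<longrightarrow> nth_or 0 (l x) i \<noteq> nth_or 0 (l x) j)"
    by (intro ptime_intros assms ptime_comp[OF assms])
  moreover have "(\<forall>i\<in>set [0..<length xs]. \<forall>j\<in>set [0..<length xs]. i \<noteq> j \<longrightarrow> nth_or 0 xs i \<noteq> nth_or 0 xs j) \<longleftrightarrow>
      distinct xs" for xs :: "nat list"
    by (auto simp: distinct_conv_nth nth_or_eq)
  ultimately show ?thesis by (simp only:)
qed

lemma ptime_pwf [ptime_intros]:
  assumes "ptime L"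
  shows "ptime (\<lambda>x. pwf (L x))"
  unfolding pwf_def pgate_ok_def by (intro ptime_intros assms ptime_comp[OF assms])

text \<open>As \<open>e\<close> is constant, the recursion is unrolled into nested bounded
  quantifiers of the program. The degree of the polynomial depends on \<open>e\<close>; the same
  holds for \<open>weft1\<close> and \<open>known\<close>.\<close>

lemma ptime_small: "ptime (\<lambda>p. small (fst p) e (snd p))"
proof (induction e)
  case 0
  show ?case by (simp only: small.simps) (intro ptime_intros)
next
  case (Suc e)
  show ?case by (simp only: small.simps) (intro ptime_intros ptime_app2[of "\<lambda>L j. small L e j", OF Suc])
qed

lemma ptime_weft1: "ptime (\<lambda>p. weft1 (fst p) e (snd p))"
proof (induction e)
  case 0
  show ?case by (simp only: weft1.simps) (intro ptime_intros)
next
  case (Suc e)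
  show ?case
    by (simp only: weft1.simps)
      (intro ptime_intros ptime_app2[of "\<lambda>L j. weft1 L e j", OF Suc]
        ptime_app2[of "\<lambda>L j. small L e j", OF ptime_small])
qed

lemma ptime_valid [ptime_intros]: "ptime f \<Longrightarrow> ptime (\<lambda>x. valid d (f x))"
proof (rule ptime_comp[of "valid d"])
  show "ptime (valid d)"
    unfolding valid_def enc_pcircuit_def gate_tokens_def
    by (intro ptime_intros ptime_app2[of "\<lambda>L j. weft1 L d j", OF ptime_weft1])
qed

lemma ptime_justified [ptime_intros]:
  assumes "ptime L" "ptime \<sigma>" "ptime j" "ptime b"
  shows "ptime (\<lambda>x. justified (L x) (\<sigma> x) (j x) (b x))"
  unfolding justified_def
  by (intro ptime_intros assms ptime_comp[OF assms(1)] ptime_comp[OF assms(2)] ptime_comp[OF assms(3)]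
      ptime_comp[OF assms(4)])

lemma ptime_located [ptime_intros]:
  assumes "ptime \<alpha>" "ptime j" "ptime b"
  shows "ptime (\<lambda>x. located (\<alpha> x) (j x) (b x))"
  unfolding located_def
  by (intro ptime_intros assms ptime_comp[OF assms(1)] ptime_comp[OF assms(2)])

lemma ptime_known:
  "ptime (\<lambda>p. known (fst p) e (fst (snd p)) (fst (snd (snd p))) (snd (snd (snd p))))"
proof (induction e)
  case 0
  show ?case by (simp only: known.simps) (intro ptime_intros)
next
  case (Suc e)
  show ?case
    by (simp only: known.simps) (intro ptime_intros ptime_app4[of "\<lambda>L \<alpha> j b. known L e \<alpha> j b", OF Suc])
qed

lemma ptime_consistent [ptime_intros]:
  assumes "ptime \<alpha>" "ptime \<beta>"
  shows "ptime (\<lambda>x. consistent (\<alpha> x) (\<beta> x))"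
  unfolding consistent_def by (intro ptime_intros assms ptime_comp[OF assms(2)])

lemma ptime_good [ptime_intros]:
  assumes "ptime L" "ptime \<kappa>" "ptime x"
  shows "ptime (\<lambda>i. good (L i) d (\<kappa> i) (x i))"
  unfolding good_def slot_def
  by (intro ptime_intros ptime_app4[of "\<lambda>L \<alpha> j b. known L d \<alpha> j b", OF ptime_known] assms
      ptime_comp[OF assms(1)] ptime_comp[OF assms(2)] ptime_comp[OF assms(3)])

lemma ptime_vertices [ptime_intros]:
  assumes "ptime L" "ptime \<kappa>"
  shows "ptime (\<lambda>x. vertices (L x) d (\<kappa> x))"
  unfolding vertices_def literals_def positions_def
  by (intro ptime_intros assms ptime_comp[OF assms(1)] ptime_comp[OF assms(2)])

lemma ptime_tuples [ptime_intros]: "ptime \<kappa> \<Longrightarrow> ptime (\<lambda>x. tuples d (\<kappa> x))"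
  unfolding tuples_def by (intro ptime_intros)

lemma ptime_pcp_word [ptime_intros]:
  assumes "ptime ks" "ptime vs"
  shows "ptime (\<lambda>x. pcp_word k (ks x) (vs x))"
  unfolding pcp_word_def enc_pcp_def conflict_edges_def parts_def compatible_def key_def
  by (intro ptime_intros assms ptime_comp[OF assms(2)])

lemma ptime_reduction: "ptime (reduction k d)"
  unfolding reduction_def all_keys_def all_vertices_def by (intro ptime_intros)

lemma WCS_reducible:
  assumes "k \<ge> 1"
  shows "fpt_reducible (WCS 1 d) (PCP_with {k})" "fpt_reducible (WCS 1 d) PCP"
proof -
  have "ptime (\<lambda>\<kappa>::nat. (\<kappa> + 2) ^ 2 ^ (d + 1) + k)" by (intro ptime_intros)
  note r = fpt_reducible_ptime[OF ptime_reduction this reduction_parameter]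
  show "fpt_reducible (WCS 1 d) (PCP_with {k})" "fpt_reducible (WCS 1 d) PCP"
    by (rule r, rule reduction_correct[OF assms])+
qed

theorem theorem7:
  shows "W_hard 1 PCP \<and> (\<forall>k\<ge>1. W_hard 1 (PCP_with {k}))"
  unfolding W_hard_def W_def using WCS_reducible fpt_reducible_trans by blast

end
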